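(* Let $(R,\mathfrak m)$ be a commutative Noetherian local ring and let $M$ be a finitely generated $R$-module with $d=\dim M\geqslant2$. Let $H^0_{\mathfrak m}(M)$ be the $0$th local cohomology module of $M$ with respect to $\mathfrak m$. The following statements are equivalent: (i) $M/H^0_{\mathfrak m}(M)$ is a Cohen-Macaulay module and $\mathfrak m H^0_{\mathfrak m}(M)=0$. (ii) Every system of parameters of $M$ has the property of parametric decomposition.
   Context: For $n\geqslant1$ let $\Lambda_{d,n}=\{(\alpha_1,\ldots,\alpha_d)\in\mathbb Z^d\mid \alpha_i\geqslant1 \text{ for all } 1\leqslant i\leqslant d \text{ and } \sum_{i=1}^d\alpha_i=d+n-1\}$. A system of parameters $x_1,\ldots,x_d$ of $M$, generating the ideal $\mathfrak q=(x_1,\ldots,x_d)$ of $R$, has the property of parametric decomposition if $$\mathfrak q^nM=\bigcap_{\alpha\in\Lambda_{d,n}}(x_1^{\alpha_1},\ldots,x_d^{\alpha_d})M\quad\text{for all } n\geqslant1.$$ *)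

theory Defs
  imports "HOL-Algebra.Ring_Divisibility" "HOL-Algebra.Ideal_Product" "HOL-Algebra.Module"
    "HOL-Library.Extended_Nat"
begin

locale local_ring = maximalideal \<mm> R + cring R for \<mm> and R (structure) +
  assumes maximalideal_unique: "maximalideal I R \<Longrightarrow> I = \<mm>"

definition gen_submodule ::
  "('a, 'r) ring_scheme \<Rightarrow> ('a, 'b, 'm) module_scheme \<Rightarrow> 'b set \<Rightarrow> 'b set"
  where "gen_submodule R M S = \<Inter>{N. submodule N R M \<and> S \<subseteq> N}"

definition fin_gen_module :: "('a, 'r) ring_scheme \<Rightarrow> ('a, 'b, 'm) module_scheme \<Rightarrow> bool"
  where "fin_gen_module R M \<longleftrightarrow>
    (\<exists>A. finite A \<and> A \<subseteq> carrier M \<and> gen_submodule R M A = carrier M)"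

text \<open>The product \<open>I N\<close> of an ideal \<open>I\<close> and a submodule \<open>N\<close> of \<open>M\<close>.\<close>

definition ideal_smult ::
  "('a, 'r) ring_scheme \<Rightarrow> ('a, 'b, 'm) module_scheme \<Rightarrow> 'a set \<Rightarrow> 'b set \<Rightarrow> 'b set"
  where "ideal_smult R M I N = gen_submodule R M {a \<odot>\<^bsub>M\<^esub> x |a x. a \<in> I \<and> x \<in> N}"

text \<open>The locale \<^locale>\<open>module\<close> ignores the inherited ring fields \<^const>\<open>mult\<close> and
  \<^const>\<open>one\<close>; they are filled in here as for \<^const>\<open>FactRing\<close>.\<close>

definition quot_module ::
  "('a, 'b, 'm) module_scheme \<Rightarrow> 'b set \<Rightarrow> ('a, 'b set) module"
  where "quot_module M N =
    \<lparr>carrier = a_rcosets\<^bsub>M\<^esub> N, mult = rcoset_mult M N, one = N +>\<^bsub>M\<^esub> \<one>\<^bsub>M\<^esub>,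
     zero = N, add = set_add M,
     smult = (\<lambda>a C. \<Union>x\<in>C. N +>\<^bsub>M\<^esub> (a \<odot>\<^bsub>M\<^esub> x))\<rparr>"

text \<open>The supremum of the lengths \<open>k\<close> of strict chains \<open>A\<^sub>0 \<subset> \<dots> \<subset> A\<^sub>k\<close> in \<open>\<A>\<close>. For
  \<open>\<A> = {}\<close> the value is \<open>0\<close>; hence the zero ring and the zero module get dimension \<open>0\<close>
  below, where \<open>-\<infinity>\<close> is also customary.\<close>

definition sup_chain_length :: "'a set set \<Rightarrow> enat"
  where "sup_chain_length \<A> =
    Sup {enat (length As - 1) |As. As \<noteq> [] \<and> set As \<subseteq> \<A> \<and> sorted_wrt (\<subset>) As}"

definition krull_dim :: "('a, 'r) ring_scheme \<Rightarrow> enat"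
  where "krull_dim R = sup_chain_length {P. primeideal P R}"

definition annihilator :: "('a, 'r) ring_scheme \<Rightarrow> ('a, 'b, 'm) module_scheme \<Rightarrow> 'a set"
  where "annihilator R M = {a \<in> carrier R. \<forall>x\<in>carrier M. a \<odot>\<^bsub>M\<^esub> x = \<zero>\<^bsub>M\<^esub>}"

definition module_dim :: "('a, 'r) ring_scheme \<Rightarrow> ('a, 'b, 'm) module_scheme \<Rightarrow> enat"
  where "module_dim R M = krull_dim (R Quot annihilator R M)"

definition module_length :: "('a, 'r) ring_scheme \<Rightarrow> ('a, 'b, 'm) module_scheme \<Rightarrow> enat"
  where "module_length R M = sup_chain_length {N. submodule N R M}"

text \<open>The submodule \<open>(x\<^sub>1, \<dots>, x\<^sub>k) M\<close>, for the sequence given as a list.\<close>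

definition seq_smult ::
  "('a, 'r) ring_scheme \<Rightarrow> ('a, 'b, 'm) module_scheme \<Rightarrow> 'a list \<Rightarrow> 'b set"
  where "seq_smult R M xs = ideal_smult R M (Idl\<^bsub>R\<^esub> (set xs)) (carrier M)"

definition regular_seq ::
  "('a, 'r) ring_scheme \<Rightarrow> ('a, 'b, 'm) module_scheme \<Rightarrow> 'a list \<Rightarrow> bool"
  where "regular_seq R M xs \<longleftrightarrow> set xs \<subseteq> carrier R \<and>
    (\<forall>i<length xs. let Q = quot_module M (seq_smult R M (take i xs)) in
       \<forall>z\<in>carrier Q. (xs ! i) \<odot>\<^bsub>Q\<^esub> z = \<zero>\<^bsub>Q\<^esub> \<longrightarrow> z = \<zero>\<^bsub>Q\<^esub>) \<and>
    seq_smult R M xs \<noteq> carrier M"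

definition depth ::
  "('a, 'r) ring_scheme \<Rightarrow> 'a set \<Rightarrow> ('a, 'b, 'm) module_scheme \<Rightarrow> enat"
  where "depth R \<mm> M = Sup {enat (length xs) |xs. set xs \<subseteq> \<mm> \<and> regular_seq R M xs}"

definition cohen_macaulay ::
  "('a, 'r) ring_scheme \<Rightarrow> 'a set \<Rightarrow> ('a, 'b, 'm) module_scheme \<Rightarrow> bool"
  where "cohen_macaulay R \<mm> M \<longleftrightarrow>
    carrier M = {\<zero>\<^bsub>M\<^esub>} \<or> depth R \<mm> M = module_dim R M"

text \<open>\<open>H\<^sup>0\<^sub>\<mm>(M)\<close>, the submodule of elements killed by some power of \<open>\<mm>\<close>. Powers of ideals
  are powers in the multiplicative monoid \<^const>\<open>ideals_set\<close>.\<close>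

definition local_cohomology_0 ::
  "('a, 'r) ring_scheme \<Rightarrow> 'a set \<Rightarrow> ('a, 'b, 'm) module_scheme \<Rightarrow> 'b set"
  where "local_cohomology_0 R \<mm> M =
    {x \<in> carrier M. \<exists>n::nat. \<forall>a\<in>\<mm> [^]\<^bsub>ideals_set R\<^esub> n. a \<odot>\<^bsub>M\<^esub> x = \<zero>\<^bsub>M\<^esub>}"

definition system_of_parameters ::
  "('a, 'r) ring_scheme \<Rightarrow> 'a set \<Rightarrow> ('a, 'b, 'm) module_scheme \<Rightarrow> 'a list \<Rightarrow> bool"
  where "system_of_parameters R \<mm> M xs \<longleftrightarrow>
    enat (length xs) = module_dim R M \<and> set xs \<subseteq> \<mm> \<and>
    module_length R (quot_module M (seq_smult R M xs)) < \<infinity>"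

definition Lambda_set :: "nat \<Rightarrow> nat \<Rightarrow> nat list set"
  where "Lambda_set d n =
    {\<alpha>. length \<alpha> = d \<and> (\<forall>i<d. \<alpha> ! i \<ge> 1) \<and> sum_list \<alpha> = d + n - 1}"

definition parametric_decomposition ::
  "('a, 'r) ring_scheme \<Rightarrow> ('a, 'b, 'm) module_scheme \<Rightarrow> 'a list \<Rightarrow> bool"
  where "parametric_decomposition R M xs \<longleftrightarrow>
    (\<forall>n::nat. n \<ge> 1 \<longrightarrow>
      ideal_smult R M ((Idl\<^bsub>R\<^esub> (set xs)) [^]\<^bsub>ideals_set R\<^esub> n) (carrier M) =
      (\<Inter>\<alpha>\<in>Lambda_set (length xs) n. seq_smult R M (map2 (\<lambda>x k. x [^]\<^bsub>R\<^esub> k) xs \<alpha>)))"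

end

theory Submission
  imports Defs
begin

text \<open>Write \<open>H = H\<^sup>0\<^sub>\<mm>(M)\<close> and \<open>\<qq>\<close> for the ideal of a system of parameters.

  (i) \<open>\<Longrightarrow>\<close> (ii): prime avoidance exchanges a maximal \<open>M/H\<close>-regular sequence, one element at a time, for
  any system of parameters of \<open>M\<close>. So all systems of parameters, in particular those of powers \<open>x\<^sub>i\<^sup>a\<close>, are
  \<open>M/H\<close>-regular in every order, which gives the decomposition of \<open>\<qq>\<^sup>n(M/H)\<close> by induction on \<open>d\<close>
  and \<open>n\<close>. It lifts to \<open>M\<close> because \<open>\<mm>H = 0\<close> forces \<open>H \<inter> \<qq>M = 0\<close>.

  (ii) \<open>\<Longrightarrow>\<close> (i): only \<open>n = 2\<close> is needed. Let \<open>x, y\<^sub>2, \<dots>, y\<^sub>d\<close> be a system of parameters and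
  \<open>Y = (y\<^sub>2, \<dots>, y\<^sub>d)M\<close>. If \<open>xu \<in> Y\<close>, then \<open>xu\<close> lies in all components of the decomposition of
  \<open>\<qq>\<^sup>2M\<close>, so \<open>u\<close> can be changed modulo \<open>\<qq>M\<close> such that \<open>xu \<in> (y\<^sub>2, \<dots>, y\<^sub>d)\<^sup>2M\<close>. Iterating with higher
  powers and using Artin-Rees and Krull's intersection theorem for principal ideals yields
  \<open>Y : x = Y + (0 : x)\<close>. If \<open>x\<^sup>kw = 0\<close>, then \<open>y\<^sub>2w = (x\<^sup>k + y\<^sub>2)w\<close> lies in all components for the system
  \<open>x\<^sup>k + y\<^sub>2, y\<^sub>2, \<dots>\<close>, hence in \<open>y\<^sub>2\<^sup>2M\<close>; from this every parameter kills \<open>H\<close>, and \<open>0 : x = H\<close>.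

  Quotients of \<open>M\<close> and localizations of \<open>R\<close> are avoided: everything takes place modulo submodules
  \<open>B + (x\<^sub>1, \<dots>, x\<^sub>k)M\<close> of the fixed module \<open>M\<close>, and with multipliers outside a prime.\<close>

section \<open>Submodules and regular sequences\<close>

text \<open>The chain condition on M is used mainly through one fact:
  \<open>colon N (x [^] n)\<close> becomes stationary. For a single element x this suffices for
  Artin-Rees, for Krull's intersection theorem and for testing regularity; statements about several
  parameters are then obtained one parameter at a time. Dimension theory cannot be avoided: the
  dimension has to be finite, and a parameter must be replaceable by an element that avoids finitely
  many primes. Both rest on the principal ideal theorem, used in the form that a chain of primes
  \<open>P0\<close>, \<open>P1\<close>, \<open>P2\<close> can be rerouted through a prime containing
  a given x in \<open>P2\<close>. The exponent \<open>n = 2\<close> is so effective because exactly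
  one exponent in each component is 2: either x itself is a generator, or the component contains Y.
  All higher exponents come from replacing parameters by powers, which are again parameters. This is
  why (ii) is exploited for every system and never for a fixed one.\<close>

context module
begin

abbreviation smult_M (infixr "\<bullet>" 72) where "a \<bullet> v \<equiv> a \<odot>\<^bsub>M\<^esub> v"
abbreviation add_M (infixl "\<oplus>\<^sub>M" 65) where "u \<oplus>\<^sub>M v \<equiv> u \<oplus>\<^bsub>M\<^esub> v"
abbreviation minus_M (infixl "\<ominus>\<^sub>M" 65) where "u \<ominus>\<^sub>M v \<equiv> u \<ominus>\<^bsub>M\<^esub> v"
abbreviation zero_M ("\<zero>\<^sub>M") where "\<zero>\<^sub>M \<equiv> \<zero>\<^bsub>M\<^esub>"
abbreviation sum_M (infixl "+\<^sub>M" 65) where "A +\<^sub>M B \<equiv> A <+>\<^bsub>M\<^esub> B"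
abbreviation sub where "sub N \<equiv> submodule N R M"
abbreviation \<M> where "\<M> \<equiv> carrier M"

lemma subD:
  assumes "sub N"
  shows sub_subset: "N \<subseteq> \<M>"
    and sub_carr: "\<And>u. u \<in> N \<Longrightarrow> u \<in> \<M>"
    and sub_zero: "\<zero>\<^sub>M \<in> N"
    and sub_neg: "\<And>u. u \<in> N \<Longrightarrow> \<ominus>\<^bsub>M\<^esub> u \<in> N"
    and sub_smult: "\<And>a u. a \<in> carrier R \<Longrightarrow> u \<in> N \<Longrightarrow> a \<bullet> u \<in> N"
    and sub_add: "\<And>u v. u \<in> N \<Longrightarrow> v \<in> N \<Longrightarrow> u \<oplus>\<^sub>M v \<in> N"
    and sub_minus: "\<And>u v. u \<in> N \<Longrightarrow> v \<in> N \<Longrightarrow> u \<ominus>\<^sub>M v \<in> N"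
proof -
  note E = submoduleE[OF assms]
  show N: "N \<subseteq> \<M>" and "\<And>u. u \<in> N \<Longrightarrow> u \<in> \<M>" using E(1) by auto
  show n: "\<And>u. u \<in> N \<Longrightarrow> \<ominus>\<^bsub>M\<^esub> u \<in> N" and "\<And>a u. a \<in> carrier R \<Longrightarrow> u \<in> N \<Longrightarrow> a \<bullet> u \<in> N"
    and a: "\<And>u v. u \<in> N \<Longrightarrow> v \<in> N \<Longrightarrow> u \<oplus>\<^sub>M v \<in> N" using E by auto
  show "\<And>u v. u \<in> N \<Longrightarrow> v \<in> N \<Longrightarrow> u \<ominus>\<^sub>M v \<in> N" using n a unfolding a_minus_def by blast
  obtain u where "u \<in> N" using E(2) by auto
  then have "u \<oplus>\<^sub>M \<ominus>\<^bsub>M\<^esub> u \<in> N" using n a by auto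
  then show "\<zero>\<^sub>M \<in> N" using \<open>u \<in> N\<close> N by (auto simp: M.r_neg)
qed

lemma sub_zero_module: "sub {\<zero>\<^sub>M}"
  by (rule submoduleI) auto

lemma sub_Inter: assumes "\<A> \<noteq> {}" and s: "\<And>N. N \<in> \<A> \<Longrightarrow> sub N" shows "sub (\<Inter>\<A>)"
proof (rule submoduleI)
  show "\<Inter>\<A> \<subseteq> \<M>" using assms sub_subset by blast
qed (use sub_zero[OF s] sub_neg[OF s] sub_add[OF s] sub_smult[OF s] in auto)

lemma sub_Int: "sub N \<Longrightarrow> sub K \<Longrightarrow> sub (N \<inter> K)"
  using sub_Inter[of "{N, K}"] by auto

lemma gen_sub: "S \<subseteq> \<M> \<Longrightarrow> sub (gen_submodule R M S)"
  unfolding gen_submodule_def by (rule sub_Inter) (use carrier_is_submodule in auto)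

lemma gen_least: "sub N \<Longrightarrow> S \<subseteq> N \<Longrightarrow> gen_submodule R M S \<subseteq> N"
  unfolding gen_submodule_def by auto

lemma gen_self: "S \<subseteq> gen_submodule R M S"
  unfolding gen_submodule_def by auto

lemma gen_le_iff: "sub N \<Longrightarrow> gen_submodule R M S \<subseteq> N \<longleftrightarrow> S \<subseteq> N"
  using gen_least gen_self by blast

lemma smult_minus_distr:
  "a \<in> carrier R \<Longrightarrow> u \<in> \<M> \<Longrightarrow> v \<in> \<M> \<Longrightarrow> a \<bullet> (u \<ominus>\<^sub>M v) = a \<bullet> u \<ominus>\<^sub>M a \<bullet> v"
  by (simp add: M.minus_eq smult_r_distr smult_r_minus)

lemma smult_minus_distr_l:
  "a \<in> carrier R \<Longrightarrow> b \<in> carrier R \<Longrightarrow> v \<in> \<M> \<Longrightarrow> (a \<ominus> b) \<bullet> v = a \<bullet> v \<ominus>\<^sub>M b \<bullet> v"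
  by (simp add: M.minus_eq R.minus_eq smult_l_distr smult_l_minus)

lemma smult_comm:
  "a \<in> carrier R \<Longrightarrow> b \<in> carrier R \<Longrightarrow> v \<in> \<M> \<Longrightarrow> a \<bullet> b \<bullet> v = b \<bullet> a \<bullet> v"
  using smult_assoc1[of a b v] smult_assoc1[of b a v] R.m_comm[of a b] by simp

lemma pow_add_smult:
  "a \<in> carrier R \<Longrightarrow> v \<in> \<M> \<Longrightarrow> a [^] (m + n) \<bullet> v = a [^] (m::nat) \<bullet> a [^] (n::nat) \<bullet> v"
  by (simp add: R.nat_pow_mult[symmetric] smult_assoc1)

lemma pow_Suc_smult:
  "a \<in> carrier R \<Longrightarrow> v \<in> \<M> \<Longrightarrow> a [^] (Suc n) \<bullet> v = a \<bullet> a [^] n \<bullet> v"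
  using pow_add_smult[of a v 1 n] by simp

text \<open>Equality in M/N on representatives. Membership in the carrier is part of the relation,
  so that transitivity chains carry their own typing conditions.\<close>

definition congr where "congr N u v \<longleftrightarrow> u \<in> \<M> \<and> v \<in> \<M> \<and> u \<ominus>\<^sub>M v \<in> N"

lemma congr_refl: "sub N \<Longrightarrow> u \<in> \<M> \<Longrightarrow> congr N u u"
  by (simp add: congr_def sub_zero a_minus_def M.r_neg)

lemma congr_sym: assumes "sub N" "congr N u v" shows "congr N v u"
proof -
  have "v \<ominus>\<^sub>M u = \<ominus>\<^bsub>M\<^esub> (u \<ominus>\<^sub>M v)"
    using assms by (simp add: congr_def M.minus_eq M.minus_add M.a_comm)
  then show ?thesis using assms sub_neg by (auto simp: congr_def)
qed

lemma congr_trans: assumes "sub N" "congr N u v" "congr N v w" shows "congr N u w"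
proof -
  have c: "u \<in> \<M>" "v \<in> \<M>" "w \<in> \<M>" using assms by (auto simp: congr_def)
  have "\<ominus>\<^bsub>M\<^esub> v \<oplus>\<^sub>M (v \<oplus>\<^sub>M \<ominus>\<^bsub>M\<^esub> w) = \<ominus>\<^bsub>M\<^esub> w"
    using c by (simp add: M.a_assoc[symmetric] M.l_neg)
  then have "(u \<ominus>\<^sub>M v) \<oplus>\<^sub>M (v \<ominus>\<^sub>M w) = u \<ominus>\<^sub>M w"
    using c by (simp add: M.minus_eq M.a_assoc)
  then show ?thesis using assms sub_add[OF assms(1), of "u \<ominus>\<^sub>M v" "v \<ominus>\<^sub>M w"] by (auto simp: congr_def)
qed

lemma congr_smult: "sub N \<Longrightarrow> a \<in> carrier R \<Longrightarrow> congr N u v \<Longrightarrow> congr N (a \<bullet> u) (a \<bullet> v)"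
  by (auto simp: congr_def smult_minus_distr[symmetric] intro: sub_smult)

lemma congr_mono: "congr N u v \<Longrightarrow> N \<subseteq> K \<Longrightarrow> congr K u v"
  by (auto simp: congr_def)

lemma minus_add_cancel_M: "u \<in> \<M> \<Longrightarrow> v \<in> \<M> \<Longrightarrow> u \<ominus>\<^sub>M v \<oplus>\<^sub>M v = u"
  by (simp add: M.minus_eq M.a_assoc M.l_neg)

lemma add_minus_cancel_M: "u \<in> \<M> \<Longrightarrow> v \<in> \<M> \<Longrightarrow> u \<oplus>\<^sub>M v \<ominus>\<^sub>M v = u"
  by (simp add: M.minus_eq M.a_assoc M.r_neg)

lemma congr_mem: assumes "sub N" "congr N u v" shows "u \<in> N \<longleftrightarrow> v \<in> N"
proof -
  have *: "u \<in> N" if "congr N u v" "v \<in> N" for u v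
  proof -
    have "u \<ominus>\<^sub>M v \<oplus>\<^sub>M v \<in> N" using that assms(1) sub_add by (auto simp: congr_def)
    then show ?thesis using that by (simp add: congr_def minus_add_cancel_M)
  qed
  show ?thesis using *[of u v] *[of v u] assms congr_sym by blast
qed

lemma congr_zero_iff: "sub N \<Longrightarrow> congr N u \<zero>\<^sub>M \<longleftrightarrow> u \<in> N"
proof -
  have "\<ominus>\<^bsub>M\<^esub> \<zero>\<^sub>M = \<zero>\<^sub>M" by (rule M.minus_equality) auto
  then have "u \<ominus>\<^sub>M \<zero>\<^sub>M = u" if "u \<in> \<M>" unfolding M.minus_eq using that by (simp only: M.r_zero)
  then show "sub N \<Longrightarrow> ?thesis" using sub_carr[of N u] by (auto simp: congr_def)
qed

lemma add4: assumes "a \<in> \<M>" "b \<in> \<M>" "c \<in> \<M>" "d \<in> \<M>"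
  shows "(a \<oplus>\<^sub>M b) \<oplus>\<^sub>M (c \<oplus>\<^sub>M d) = (a \<oplus>\<^sub>M c) \<oplus>\<^sub>M (b \<oplus>\<^sub>M d)"
  using assms by (simp add: M.a_assoc M.a_lcomm)

lemma congr_add: assumes "sub N" "congr N u v" "congr N u' v'" shows "congr N (u \<oplus>\<^sub>M u') (v \<oplus>\<^sub>M v')"
proof -
  have c: "u \<in> \<M>" "v \<in> \<M>" "u' \<in> \<M>" "v' \<in> \<M>" using assms by (auto simp: congr_def)
  have "(u \<oplus>\<^sub>M u') \<oplus>\<^sub>M (\<ominus>\<^bsub>M\<^esub> v \<oplus>\<^sub>M \<ominus>\<^bsub>M\<^esub> v') = (u \<oplus>\<^sub>M \<ominus>\<^bsub>M\<^esub> v) \<oplus>\<^sub>M (u' \<oplus>\<^sub>M \<ominus>\<^bsub>M\<^esub> v')"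
    using c by (intro add4) auto
  then have "(u \<oplus>\<^sub>M u') \<ominus>\<^sub>M (v \<oplus>\<^sub>M v') = (u \<ominus>\<^sub>M v) \<oplus>\<^sub>M (u' \<ominus>\<^sub>M v')"
    unfolding a_minus_def M.minus_add[OF c(2,4)] .
  then show ?thesis using assms c sub_add[OF assms(1), of "u \<ominus>\<^sub>M v" "u' \<ominus>\<^sub>M v'"] by (simp add: congr_def)
qed

lemma congr_memI: "sub N \<Longrightarrow> congr N u v \<Longrightarrow> v \<in> N \<Longrightarrow> u \<in> N"
  using congr_mem by blast

text \<open>The submodule B + (X)M. The first argument accumulates what has already been divided
  out, so that inductions over sequences pass from M/B to M/(B + xM) simply by changing B.\<close>

definition ext where
  "ext B X = gen_submodule R M (B \<union> {x \<bullet> v |x v. x \<in> X \<and> v \<in> \<M>})"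

lemma ext_sub: "sub B \<Longrightarrow> X \<subseteq> carrier R \<Longrightarrow> sub (ext B X)"
  unfolding ext_def using sub_subset[of B] by (intro gen_sub) blast

lemma ext_base: "B \<subseteq> ext B X" and ext_prod: "x \<in> X \<Longrightarrow> v \<in> \<M> \<Longrightarrow> x \<bullet> v \<in> ext B X"
  using gen_self[of "B \<union> {x \<bullet> v |x v. x \<in> X \<and> v \<in> \<M>}"] unfolding ext_def by auto

lemma ext_least: "sub C \<Longrightarrow> B \<subseteq> C \<Longrightarrow> (\<And>x v. x \<in> X \<Longrightarrow> v \<in> \<M> \<Longrightarrow> x \<bullet> v \<in> C) \<Longrightarrow> ext B X \<subseteq> C"
  unfolding ext_def by (rule gen_least) auto

lemma ext_mono: "sub B' \<Longrightarrow> X' \<subseteq> carrier R \<Longrightarrow> B \<subseteq> B' \<Longrightarrow> X \<subseteq> X' \<Longrightarrow> ext B X \<subseteq> ext B' X'"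
  using ext_base[of B' X'] by (intro ext_least ext_sub) (auto intro: ext_prod)

lemma ext_empty: "sub B \<Longrightarrow> ext B {} = B"
  using ext_least[of B B "{}"] ext_base[of B "{}"] by auto

lemma ext_ext: assumes "sub B" "X \<subseteq> carrier R" "Y \<subseteq> carrier R"
  shows "ext (ext B X) Y = ext B (X \<union> Y)"
proof
  have s: "sub (ext B (X \<union> Y))" "sub (ext (ext B X) Y)" using assms by (auto intro!: ext_sub)
  show "ext (ext B X) Y \<subseteq> ext B (X \<union> Y)"
    by (intro ext_least s) (auto intro: ext_prod ext_base[THEN subsetD])
  show "ext B (X \<union> Y) \<subseteq> ext (ext B X) Y"
    by (intro ext_least s) (auto intro: ext_prod ext_base[THEN subsetD])
qed

lemma ext_insert_eq:
  "sub B \<Longrightarrow> x \<in> carrier R \<Longrightarrow> X \<subseteq> carrier R \<Longrightarrow> ext B (insert x X) = ext (ext B X) {x}"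
  "sub B \<Longrightarrow> x \<in> carrier R \<Longrightarrow> X \<subseteq> carrier R \<Longrightarrow> ext B (insert x X) = ext (ext B {x}) X"
  using ext_ext[of B X "{x}"] ext_ext[of B "{x}" X] by auto

lemma add_sub: assumes "sub A" "sub B" shows "sub (A +\<^sub>M B)"
proof (rule submodule.intro)
  show "subgroup (A +\<^sub>M B) (add_monoid M)"
    using M.add_additive_subgroups[of A B] assms
    by (simp add: additive_subgroup_def submodule_def)
  show "submodule_axioms (A +\<^sub>M B) R M"
  proof
    fix a x assume a: "a \<in> carrier R" and "x \<in> A +\<^sub>M B"
    then obtain u v where uv: "u \<in> A" "v \<in> B" "x = u \<oplus>\<^sub>M v" by (auto simp: set_add_def')
    then have "a \<bullet> x = a \<bullet> u \<oplus>\<^sub>M a \<bullet> v" using a assms sub_carr smult_r_distr by blast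
    moreover have "a \<bullet> u \<in> A" "a \<bullet> v \<in> B" using uv a assms sub_smult by blast+
    ultimately show "a \<bullet> x \<in> A +\<^sub>M B" by (auto simp: set_add_def')
  qed
qed

lemma add_mem_iff: assumes "sub A" "sub B"
  shows "v \<in> A +\<^sub>M B \<longleftrightarrow> (\<exists>u\<in>B. congr A v u)"
proof
  assume "v \<in> A +\<^sub>M B"
  then obtain a b where "a \<in> A" "b \<in> B" "v = a \<oplus>\<^sub>M b" by (auto simp: set_add_def')
  then show "\<exists>u\<in>B. congr A v u" using assms sub_carr
    by (intro bexI[of _ b]) (auto simp: congr_def add_minus_cancel_M)
next
  assume "\<exists>u\<in>B. congr A v u"
  then obtain u where u: "u \<in> B" "congr A v u" by auto
  then have "v = (v \<ominus>\<^sub>M u) \<oplus>\<^sub>M u" by (simp add: congr_def minus_add_cancel_M)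
  then show "v \<in> A +\<^sub>M B" using u by (auto simp: set_add_def' congr_def)
qed

lemma add_le: assumes "sub A" "sub B" shows "A \<subseteq> A +\<^sub>M B" "B \<subseteq> A +\<^sub>M B"
proof
  fix x assume "x \<in> A"
  then have "congr A x \<zero>\<^sub>M" using assms congr_zero_iff by auto
  then show "x \<in> A +\<^sub>M B" using assms sub_zero by (auto simp: add_mem_iff)
next
  show "B \<subseteq> A +\<^sub>M B" using assms congr_refl[of A] sub_carr[of B] by (meson add_mem_iff subsetI)
qed

lemma add_least: assumes "sub C" "A \<subseteq> C" "B \<subseteq> C" shows "A +\<^sub>M B \<subseteq> C"
  using assms sub_add[OF assms(1)] by (auto simp: set_add_def')

lemma times_sub: assumes "x \<in> carrier R" "sub N" shows "sub ((\<lambda>v. x \<bullet> v) ` N)"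
proof (rule submoduleI)
  show "(\<lambda>v. x \<bullet> v) ` N \<subseteq> \<M>" using assms sub_carr by auto
  show "\<zero>\<^sub>M \<in> (\<lambda>v. x \<bullet> v) ` N"
    using assms sub_zero smult_r_null by (metis imageI)
  show "\<ominus>\<^bsub>M\<^esub> a \<in> (\<lambda>v. x \<bullet> v) ` N" if "a \<in> (\<lambda>v. x \<bullet> v) ` N" for a
    using that assms sub_neg sub_carr by (auto simp: smult_r_minus[symmetric])
  show "a \<oplus>\<^sub>M b \<in> (\<lambda>v. x \<bullet> v) ` N" if "a \<in> (\<lambda>v. x \<bullet> v) ` N" "b \<in> (\<lambda>v. x \<bullet> v) ` N" for a b
    using that assms sub_add sub_carr by (auto simp: smult_r_distr[symmetric])
  show "a \<bullet> b \<in> (\<lambda>v. x \<bullet> v) ` N" if "a \<in> carrier R" "b \<in> (\<lambda>v. x \<bullet> v) ` N" for a b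
    using that assms sub_smult sub_carr by (auto simp: smult_comm[of a x])
qed

lemma ext_single: assumes "sub B" "x \<in> carrier R"
  shows "ext B {x} = B +\<^sub>M ((\<lambda>v. x \<bullet> v) ` \<M>)"
proof
  note s = add_sub[OF assms(1) times_sub[OF assms(2) carrier_is_submodule]]
  note l = add_le[OF assms(1) times_sub[OF assms(2) carrier_is_submodule]]
  show "ext B {x} \<subseteq> B +\<^sub>M ((\<lambda>v. x \<bullet> v) ` \<M>)"
    by (rule ext_least[OF s l(1)]) (use l(2) in auto)
  show "B +\<^sub>M ((\<lambda>v. x \<bullet> v) ` \<M>) \<subseteq> ext B {x}"
    by (rule add_least) (use assms in \<open>auto intro: ext_sub ext_prod ext_base[THEN subsetD]\<close>)
qed

lemma ext_single_iff: assumes "sub B" "x \<in> carrier R"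
  shows "v \<in> ext B {x} \<longleftrightarrow> (\<exists>u\<in>\<M>. congr B v (x \<bullet> u))"
  using assms by (simp add: ext_single add_mem_iff[OF _ times_sub[OF _ carrier_is_submodule]])

lemma ext_singleE: assumes "v \<in> ext B {x}" "sub B" "x \<in> carrier R"
  obtains u where "u \<in> \<M>" "congr B v (x \<bullet> u)"
  using assms ext_single_iff by auto

lemma ext_pow_le: assumes "sub B" "x \<in> carrier R" "m \<le> n"
  shows "ext B {x [^] (n::nat)} \<subseteq> ext B {x [^] (m::nat)}"
proof (rule ext_least)
  fix y v assume "y \<in> {x [^] n}" "v \<in> \<M>"
  then have "y \<bullet> v = x [^] m \<bullet> x [^] (n - m) \<bullet> v"
    using assms pow_add_smult[of x v m "n - m"] by simp
  then show "y \<bullet> v \<in> ext B {x [^] m}" using assms \<open>v \<in> \<M>\<close> by (auto intro: ext_prod)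
qed (use assms in \<open>auto intro: ext_sub ext_base[THEN subsetD]\<close>)

definition colon where "colon N x = {v \<in> \<M>. x \<bullet> v \<in> N}"

lemma colon_sub: assumes "sub N" "x \<in> carrier R" shows "sub (colon N x)"
proof (rule submoduleI)
  show "a \<bullet> b \<in> colon N x" if "a \<in> carrier R" "b \<in> colon N x" for a b
    using that assms sub_smult[OF assms(1)] by (auto simp: colon_def smult_comm[of x a])
qed (use assms in \<open>auto simp: colon_def smult_r_distr smult_r_minus sub_add sub_neg sub_zero\<close>)

lemma colon_pow_mono: assumes "sub N" "x \<in> carrier R" "m \<le> n"
  shows "colon N (x [^] (m::nat)) \<subseteq> colon N (x [^] (n::nat))"
proof
  fix v assume "v \<in> colon N (x [^] m)"
  then have v: "v \<in> \<M>" "x [^] m \<bullet> v \<in> N" by (auto simp: colon_def)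
  have "x [^] n \<bullet> v = x [^] (n - m) \<bullet> x [^] m \<bullet> v"
    using assms v pow_add_smult[of x v "n - m" m] by simp
  then show "v \<in> colon N (x [^] n)" using v assms by (auto simp: colon_def intro: sub_smult)
qed

definition reg where "reg B x \<longleftrightarrow> (\<forall>v\<in>\<M>. x \<bullet> v \<in> B \<longrightarrow> v \<in> B)"

lemma reg_pow: "reg B x \<Longrightarrow> x \<in> carrier R \<Longrightarrow> v \<in> \<M> \<Longrightarrow> x [^] (n::nat) \<bullet> v \<in> B \<Longrightarrow> v \<in> B"
proof (induction n)
  case (Suc n)
  then have "x \<bullet> x [^] n \<bullet> v \<in> B" using pow_Suc_smult by simp
  then have "x [^] n \<bullet> v \<in> B" using Suc.prems by (simp add: reg_def)
  then show ?case using Suc by blast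
qed auto

text \<open>Each factor w is traded for a factor z at the price of a new vector u in place of v;
  hence the induction runs over all v.\<close>

lemma pow_multiple: assumes "sub B" "z \<in> carrier R" "w \<in> carrier R"
    "\<And>v. v \<in> \<M> \<Longrightarrow> w \<bullet> v \<in> ext B {z}"
  shows "v \<in> \<M> \<Longrightarrow> w [^] (n::nat) \<bullet> v \<in> ext B {z [^] n}"
proof (induction n arbitrary: v)
  case 0 then show ?case using ext_prod[of \<one> "{\<one>}" v B] by auto
next
  case (Suc n)
  obtain u where u: "u \<in> \<M>" "congr B (w \<bullet> v) (z \<bullet> u)"
    using assms Suc.prems by (meson ext_single_iff)
  obtain u' where u': "u' \<in> \<M>" "congr B (w [^] n \<bullet> u) (z [^] n \<bullet> u')"
    using Suc.IH[OF u(1)] assms by (auto simp: ext_single_iff)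
  note [trans] = congr_trans[OF assms(1)]
  have "w [^] Suc n \<bullet> v = w [^] n \<bullet> w \<bullet> v" using Suc.prems assms pow_add_smult[of w v n 1] by simp
  then have "congr B (w [^] Suc n \<bullet> v) (w [^] n \<bullet> z \<bullet> u)"
    using u assms(1,3) by (auto intro: congr_smult simp del: R.nat_pow_Suc)
  also have "w [^] n \<bullet> z \<bullet> u = z \<bullet> w [^] n \<bullet> u" using u assms(2,3) by (simp add: smult_comm)
  also have "congr B \<dots> (z \<bullet> z [^] n \<bullet> u')" using u' assms(1,2) by (auto intro: congr_smult)
  also have "z \<bullet> z [^] n \<bullet> u' = z [^] Suc n \<bullet> u'" using u' assms(2) pow_Suc_smult by simp
  finally show ?case using u' assms(1,2)
    by (auto simp: ext_single_iff simp del: R.nat_pow_Suc)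
qed

text \<open>Regularity on M/B in the weak sense: the last quotient may vanish. Properness is added
  only where \<open>regular_seq\<close> and depth are translated.\<close>

primrec rseq where
  "rseq B [] \<longleftrightarrow> True"
| "rseq B (x # xs) \<longleftrightarrow> reg B x \<and> rseq (ext B {x}) xs"

lemma rseq_append: "sub B \<Longrightarrow> set xs \<subseteq> carrier R \<Longrightarrow>
  rseq B (xs @ ys) \<longleftrightarrow> rseq B xs \<and> rseq (ext B (set xs)) ys"
proof (induction xs arbitrary: B)
  case (Cons x xs)
  then have "ext B (set (x # xs)) = ext (ext B {x}) (set xs)" using ext_insert_eq(2)[of B x "set xs"] by simp
  then show ?case using Cons.IH[of "ext B {x}"] Cons.prems ext_sub[of B "{x}"] by auto
qed (auto simp: ext_empty)

definition cyc where "cyc v = (\<lambda>r. r \<bullet> v) ` carrier R"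

lemma cyc_sub: assumes "v \<in> \<M>" shows "sub (cyc v)"
proof (rule submoduleI)
  show "\<zero>\<^sub>M \<in> cyc v" using assms smult_l_null unfolding cyc_def by (metis R.zero_closed imageI)
  show "\<ominus>\<^bsub>M\<^esub> a \<in> cyc v" if "a \<in> cyc v" for a
    using that assms by (auto simp: cyc_def smult_l_minus[symmetric])
  show "a \<oplus>\<^sub>M b \<in> cyc v" if "a \<in> cyc v" "b \<in> cyc v" for a b
    using that assms by (auto simp: cyc_def smult_l_distr[symmetric])
  show "a \<bullet> b \<in> cyc v" if "a \<in> carrier R" "b \<in> cyc v" for a b
    using that assms by (auto simp: cyc_def smult_assoc1[symmetric])
qed (use assms in \<open>auto simp: cyc_def\<close>)

lemma cyc_self: "v \<in> \<M> \<Longrightarrow> v \<in> cyc v"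
  unfolding cyc_def using smult_one[of v] by (metis R.one_closed imageI)

lemma cyc_least: "sub N \<Longrightarrow> v \<in> N \<Longrightarrow> cyc v \<subseteq> N"
  using sub_smult unfolding cyc_def by auto

lemma gen_insert: assumes "v \<in> \<M>" "S \<subseteq> \<M>"
  shows "gen_submodule R M (insert v S) = gen_submodule R M S +\<^sub>M cyc v"
proof
  note g = gen_sub[OF assms(2)] and c = cyc_sub[OF assms(1)]
  show "gen_submodule R M (insert v S) \<subseteq> gen_submodule R M S +\<^sub>M cyc v"
    using add_le[OF g c] cyc_self[OF assms(1)] gen_self[of S] by (intro gen_least add_sub g c) blast
  have "sub (gen_submodule R M (insert v S))" using assms by (intro gen_sub) auto
  then show "gen_submodule R M S +\<^sub>M cyc v \<subseteq> gen_submodule R M (insert v S)"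
    using gen_self[of "insert v S"] by (intro add_least gen_least cyc_least) auto
qed

end

section \<open>Noetherian modules, Artin-Rees and Krull's intersection theorem\<close>

lemma (in noetherian_ring) ideal_chain_stabilizes:
  fixes I :: "nat \<Rightarrow> 'a set"
  assumes "\<And>n. ideal (I n) R" "\<And>n. I n \<subseteq> I (Suc n)"
  shows "\<exists>c. \<forall>n\<ge>c. I n = I c"
proof -
  have m: "I i \<subseteq> I j" if "i \<le> j" for i j using lift_Suc_mono_le[of I i j] assms(2) that by auto
  have "subset.chain {J. ideal J R} (range I)"
    unfolding subset_chain_def
  proof (intro conjI ballI)
    fix A B assume "A \<in> range I" "B \<in> range I"
    then obtain i j where "A = I i" "B = I j" by auto
    then show "A \<subseteq> B \<or> B \<subseteq> A" using m[of i j] m[of j i] nat_le_linear[of i j] by blast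
  qed (use assms(1) in auto)
  then obtain c where "\<Union>(range I) = I c" using ideal_chain_is_trivial[of "range I"] by auto
  then have "I n = I c" if "n \<ge> c" for n using m[OF that] by auto
  then show ?thesis by blast
qed

lemma (in noetherian_ring) ideal_maximal_element:
  assumes "\<A> \<noteq> {}" "\<And>I. I \<in> \<A> \<Longrightarrow> ideal I R"
  obtains I where "I \<in> \<A>" "\<And>J. J \<in> \<A> \<Longrightarrow> I \<subseteq> J \<Longrightarrow> J = I"
proof -
  have "\<exists>I\<in>\<A>. \<forall>J\<in>\<A>. I \<subseteq> J \<longrightarrow> J = I"
  proof (rule subset_Zorn_nonempty)
    fix C assume "C \<noteq> {}" and C: "subset.chain \<A> C"
    then have "subset.chain {J. ideal J R} C" using assms(2) unfolding pred_on.chain_def by auto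
    then have "\<Union>C \<in> C" using ideal_chain_is_trivial \<open>C \<noteq> {}\<close> by auto
    then show "\<Union>C \<in> \<A>" using C unfolding pred_on.chain_def by auto
  qed (rule assms(1))
  then show ?thesis using that by blast
qed

locale fg_noetherian_module = module R M + noetherian_ring R
  for R (structure) and M (structure) +
  assumes fin_gen: "fin_gen_module R M"
begin

text \<open>Induction on the generators. With K generated by all but v, the module
  \<open>N n\<close> is controlled by \<open>N n \<inter> K\<close> and by the ideal of those r for
  which rv is congruent modulo K to an element of \<open>N n\<close>. Once both are stationary, two
  elements with the same coefficient differ by an element of
  \<open>N n \<inter> K = N c \<inter> K\<close>.\<close>

lemma submodule_chain_stabilizes_gen:
  assumes "finite A" "A \<subseteq> \<M>" "\<And>n::nat. sub (N n)" "\<And>n. N n \<subseteq> N (Suc n)" "\<And>n. N n \<subseteq> gen_submodule R M A"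
  shows "\<exists>c. \<forall>n\<ge>c. N n = N c"
  using assms
proof (induction A arbitrary: N rule: finite_induct)
  case empty
  have "gen_submodule R M {} \<subseteq> {\<zero>\<^sub>M}" by (rule gen_least[OF sub_zero_module]) auto
  then have "N n = {\<zero>\<^sub>M}" for n using empty sub_zero[of "N n"] by blast
  then show ?case by auto
next
  case (insert v A)
  define K where "K = gen_submodule R M A"
  define I where "I n = {r \<in> carrier R. \<exists>u\<in>N n. congr K u (r \<bullet> v)}" for n
  have v: "v \<in> \<M>" and A: "A \<subseteq> \<M>" using insert by auto
  have K: "sub K" unfolding K_def by (rule gen_sub[OF A])
  have gK: "gen_submodule R M (insert v A) = K +\<^sub>M cyc v" unfolding K_def by (rule gen_insert[OF v A])
  have "ideal (I n) R" for n
  proof (rule idealI[OF R.ring_axioms])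
    show "subgroup (I n) (add_monoid R)"
    proof (rule R.add.subgroupI)
      show "I n \<subseteq> carrier R" by (auto simp: I_def)
      have "\<zero> \<in> I n" using sub_zero[OF insert.prems(2)] congr_refl[OF K, of "\<zero>\<^sub>M"] v by (auto simp: I_def)
      then show "I n \<noteq> {}" by auto
      fix a assume "a \<in> I n"
      then obtain u where u: "a \<in> carrier R" "u \<in> N n" "congr K u (a \<bullet> v)" by (auto simp: I_def)
      have "congr K ((\<ominus> \<one>) \<bullet> u) ((\<ominus> \<one>) \<bullet> (a \<bullet> v))" using K u by (intro congr_smult) auto
      moreover have "(\<ominus> \<one>) \<bullet> (a \<bullet> v) = (\<ominus> a) \<bullet> v"
        using u v by (simp add: smult_assoc1[symmetric] R.l_minus)
      moreover have "(\<ominus> \<one>) \<bullet> u \<in> N n" using u sub_smult[OF insert.prems(2)] by auto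
      ultimately show "\<ominus> a \<in> I n" using u by (auto simp: I_def)
      fix b assume "b \<in> I n"
      then obtain w where w: "b \<in> carrier R" "w \<in> N n" "congr K w (b \<bullet> v)" by (auto simp: I_def)
      have "congr K (u \<oplus>\<^sub>M w) ((a \<oplus> b) \<bullet> v)" using congr_add[OF K u(3) w(3)] u w v by (simp add: smult_l_distr)
      then show "a \<oplus> b \<in> I n" using u w sub_add[OF insert.prems(2)] by (auto simp: I_def)
    qed
    fix a x assume "a \<in> I n" and x: "x \<in> carrier R"
    then obtain u where u: "a \<in> carrier R" "u \<in> N n" "congr K u (a \<bullet> v)" by (auto simp: I_def)
    have "congr K (x \<bullet> u) ((x \<otimes> a) \<bullet> v)" using congr_smult[OF K x u(3)] u x v by (simp add: smult_assoc1)
    then show "x \<otimes> a \<in> I n" using u x sub_smult[OF insert.prems(2)] by (auto simp: I_def)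
    then show "a \<otimes> x \<in> I n" using R.m_comm u x by simp
  qed
  moreover have "I n \<subseteq> I (Suc n)" for n using insert.prems(3) by (auto simp: I_def)
  ultimately obtain c1 where c1: "\<And>n. n \<ge> c1 \<Longrightarrow> I n = I c1" using ideal_chain_stabilizes[of I] by blast
  have "\<exists>c. \<forall>n\<ge>c. N n \<inter> K = N c \<inter> K"
    using insert.prems(2,3) K by (intro insert.IH[OF A]) (auto intro: sub_Int simp: K_def)
  then obtain c2 where c2: "\<And>n. n \<ge> c2 \<Longrightarrow> N n \<inter> K = N c2 \<inter> K" by blast
  have m: "N i \<subseteq> N j" if "i \<le> j" for i j using lift_Suc_mono_le[of N i j] insert.prems(3) that by auto
  define c where "c = max c1 c2"
  have "N n \<subseteq> N c" if n: "n \<ge> c" for n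
  proof
    fix u assume u: "u \<in> N n"
    then have "u \<in> K +\<^sub>M cyc v" using insert.prems(4) gK by blast
    then obtain r where r: "r \<in> carrier R" "congr K u (r \<bullet> v)"
      using add_mem_iff[OF K cyc_sub[OF v]] by (auto simp: cyc_def)
    then have "r \<in> I n" using u by (auto simp: I_def)
    then have "r \<in> I c" using n c1[of n] c1[of c] by (auto simp: c_def)
    then obtain w where w: "w \<in> N c" "congr K w (r \<bullet> v)" by (auto simp: I_def)
    have "congr K u w" using congr_trans[OF K r(2)] congr_sym[OF K w(2)] by blast
    moreover have "w \<in> N n" using w m[OF n] by auto
    ultimately have "u \<ominus>\<^sub>M w \<in> N n \<inter> K" using u sub_minus[OF insert.prems(2)] by (auto simp: congr_def)
    then have "u \<ominus>\<^sub>M w \<in> N c" using c2[of n] c2[of c] n by (auto simp: c_def)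
    then have "congr (N c) u w" using u w sub_carr[OF insert.prems(2)] by (auto simp: congr_def)
    then show "u \<in> N c" using congr_memI[OF insert.prems(2)] w by blast
  qed
  then show ?case using m by blast
qed

lemma submodule_chain_stabilizes:
  assumes "\<And>n::nat. sub (N n)" "\<And>n. N n \<subseteq> N (Suc n)"
  obtains c where "\<And>n. n \<ge> c \<Longrightarrow> N n = N c"
proof -
  obtain A where A: "finite A" "A \<subseteq> \<M>" "gen_submodule R M A = \<M>"
    using fin_gen unfolding fin_gen_module_def by blast
  have "\<exists>c. \<forall>n\<ge>c. N n = N c"
    using A assms sub_subset by (intro submodule_chain_stabilizes_gen[OF A(1,2)]) auto
  then show ?thesis using that by blast
qed

lemma colon_stable:
  assumes "sub A" "y \<in> carrier R"
  obtains c where "\<And>n::nat. n \<ge> c \<Longrightarrow> colon A (y [^] n) = colon A (y [^] (c::nat))"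
proof (rule submodule_chain_stabilizes[of "\<lambda>n. colon A (y [^] n)"])
  show "sub (colon A (y [^] n))" for n :: nat using assms by (intro colon_sub) auto
  show "colon A (y [^] n) \<subseteq> colon A (y [^] (Suc n))" for n :: nat using assms by (intro colon_pow_mono) auto
qed (use that in blast)

text \<open>Artin-Rees for powers of one element, in terms of colons. If xw = y^(c+k) v modulo B,
  then y^(c+k) v lies in B + xM. With c a stationary index for the colons of B + xM by powers of y,
  already y^c v = xv' modulo B, so x takes w - y^k v' into B.\<close>

lemma artin_rees:
  assumes B: "sub B" and x: "x \<in> carrier R" and y: "y \<in> carrier R"
  obtains c :: nat where "\<And>k. colon (ext B {y [^] (c + k)}) x \<subseteq> ext (colon B x) {y [^] (k::nat)}"
proof -
  have E: "sub (ext B {x})" using B x by (intro ext_sub) auto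
  obtain c :: nat where c: "\<And>n. n \<ge> c \<Longrightarrow> colon (ext B {x}) (y [^] n) = colon (ext B {x}) (y [^] c)"
    using colon_stable[OF E y] by blast
  note [trans] = congr_trans[OF B]
  show ?thesis
  proof (rule that[of c], rule subsetI)
    fix k w assume "w \<in> colon (ext B {y [^] (c + k)}) x"
    then have w: "w \<in> \<M>" "x \<bullet> w \<in> ext B {y [^] (c + k)}" by (auto simp: colon_def)
    then obtain v where v: "v \<in> \<M>" "congr B (x \<bullet> w) (y [^] (c + k) \<bullet> v)"
      using ext_single_iff[OF B] y by blast
    have "y [^] (c + k) \<bullet> v \<in> ext B {x}" using congr_sym[OF B v(2)] w x B by (auto simp: ext_single_iff)
    then have "v \<in> colon (ext B {x}) (y [^] c)" using c[of "c + k"] v by (auto simp: colon_def)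
    then obtain v' where v': "v' \<in> \<M>" "congr B (y [^] c \<bullet> v) (x \<bullet> v')"
      using ext_single_iff[OF B x] by (auto simp: colon_def)
    have "congr B (x \<bullet> w) (y [^] (c + k) \<bullet> v)" by (rule v(2))
    also have "y [^] (c + k) \<bullet> v = y [^] k \<bullet> y [^] c \<bullet> v" using pow_add_smult[OF y v(1), of k c] by (simp add: add.commute)
    also have "congr B \<dots> (y [^] k \<bullet> x \<bullet> v')" using v' y by (intro congr_smult[OF B]) auto
    also have "y [^] k \<bullet> x \<bullet> v' = x \<bullet> y [^] k \<bullet> v'" using v' x y by (intro smult_comm) auto
    finally have "x \<bullet> (w \<ominus>\<^sub>M y [^] k \<bullet> v') \<in> B" using w v' x y by (simp add: congr_def smult_minus_distr)
    then have "congr (colon B x) w (y [^] k \<bullet> v')" using w v' y by (auto simp: congr_def colon_def)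
    then show "w \<in> ext (colon B x) {y [^] k}" using v' y x B by (auto simp: ext_single_iff colon_sub)
  qed
qed

text \<open>Let zu = 0 modulo B. By \<open>pow_multiple\<close> a power W of w satisfies Wu = z^c
  u', with c a stationary index for the colons by z. As Wzu = 0, z^(c+1) kills u', hence z^c does,
  so Wu = 0 and regularity of w gives u = 0.\<close>

lemma reg_of_pow_multiple:
  assumes B: "sub B" and z: "z \<in> carrier R" and w: "w \<in> carrier R" and r: "reg B w"
    and m: "\<And>v. v \<in> \<M> \<Longrightarrow> w [^] (t::nat) \<bullet> v \<in> ext B {z}"
  shows "reg B z"
  unfolding reg_def
proof (intro ballI impI)
  fix u assume u: "u \<in> \<M>" "z \<bullet> u \<in> B"
  obtain c :: nat where c: "\<And>n. n \<ge> c \<Longrightarrow> colon B (z [^] n) = colon B (z [^] c)" using colon_stable[OF B z] by blast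
  let ?W = "(w [^] t) [^] c"
  have W: "?W \<in> carrier R" using w by auto
  have "?W \<bullet> u \<in> ext B {z [^] c}" using w u m by (intro pow_multiple[OF B z]) auto
  then obtain u' where u': "u' \<in> \<M>" "congr B (?W \<bullet> u) (z [^] c \<bullet> u')" using ext_single_iff[OF B] z by auto
  have "z \<bullet> ?W \<bullet> u \<in> B" using u W z sub_smult[OF B] by (simp add: smult_comm[of z])
  then have "z \<bullet> z [^] c \<bullet> u' \<in> B" using congr_mem[OF B congr_smult[OF B z u'(2)]] by simp
  then have "u' \<in> colon B (z [^] Suc c)" using u' z pow_Suc_smult by (simp add: colon_def)
  then have "u' \<in> colon B (z [^] c)" using c[of "Suc c"] by (simp del: R.nat_pow_Suc)
  then have "z [^] c \<bullet> u' \<in> B" by (simp add: colon_def)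
  then have "?W \<bullet> u \<in> B" using congr_mem[OF B u'(2)] by simp
  then have "w [^] (t * c) \<bullet> u \<in> B" using w by (simp add: R.nat_pow_pow)
  then show "u \<in> B" using reg_pow[OF r w u(1)] by blast
qed

text \<open>Krull's intersection theorem in the localization at P, for powers of a single y in P and
  with multipliers outside P instead of fractions. The vectors \<open>u k\<close> play the role of v
  / y^k; the chain condition makes one of them a multiple of its predecessor, up to a
  multiplier.\<close>

lemma krull_saturated:
  assumes P: "primeideal P R" and y: "y \<in> P" and A: "sub A" and v: "v \<in> \<M>"
    and h: "\<And>k::nat. \<exists>s\<in>carrier R - P. s \<bullet> v \<in> ext A {y [^] k}"
  shows "\<exists>s\<in>carrier R - P. s \<bullet> v \<in> A"
proof -
  interpret P: primeideal P R by fact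
  have yR: "y \<in> carrier R" using y P.Icarr by auto
  have SS: "a \<otimes> b \<in> carrier R - P" if "a \<in> carrier R - P" "b \<in> carrier R - P" for a b
    using that P.I_prime by auto
  have "\<forall>k::nat. \<exists>s u. s \<in> carrier R - P \<and> u \<in> \<M> \<and> congr A (s \<bullet> v) (y [^] k \<bullet> u)"
    using h ext_single_iff[OF A] yR by (meson R.nat_pow_closed)
  then obtain s u where s: "\<And>k::nat. s k \<in> carrier R - P" and u: "\<And>k. u k \<in> \<M>"
    and su: "\<And>k. congr A (s k \<bullet> v) (y [^] k \<bullet> u k)" by metis
  have sR: "s k \<in> carrier R" for k using s by auto
  obtain c :: nat where c: "\<And>n. n \<ge> c \<Longrightarrow> colon A (y [^] n) = colon A (y [^] c)" using colon_stable[OF A yR] by blast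
  \<comment> \<open>Modulo C the factor y^k can be cancelled for k >= c, because the colons by all
    higher powers coincide with C.\<close>
  define C where "C = colon A (y [^] c)"
  have C: "sub C" unfolding C_def using A yR by (intro colon_sub) auto
  have step: "congr C (s (Suc k) \<bullet> u k) (s k \<bullet> y \<bullet> u (Suc k))" if k: "k \<ge> c" for k
  proof -
    note [trans] = congr_trans[OF A]
    have "y [^] k \<bullet> s (Suc k) \<bullet> u k = s (Suc k) \<bullet> y [^] k \<bullet> u k" using sR u yR by (intro smult_comm) auto
    also have "congr A \<dots> (s (Suc k) \<bullet> s k \<bullet> v)" using sR by (intro congr_smult[OF A] congr_sym[OF A su]) auto
    also have "s (Suc k) \<bullet> s k \<bullet> v = s k \<bullet> s (Suc k) \<bullet> v" using sR v by (intro smult_comm) auto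
    also have "congr A \<dots> (s k \<bullet> y [^] Suc k \<bullet> u (Suc k))" using sR by (intro congr_smult[OF A] su) auto
    also have "s k \<bullet> y [^] Suc k \<bullet> u (Suc k) = s k \<bullet> y [^] k \<bullet> y \<bullet> u (Suc k)"
      using pow_add_smult[OF yR u, of k 1] yR by simp
    also have "\<dots> = y [^] k \<bullet> s k \<bullet> y \<bullet> u (Suc k)" using sR u yR by (intro smult_comm) auto
    finally have "y [^] k \<bullet> (s (Suc k) \<bullet> u k \<ominus>\<^sub>M s k \<bullet> y \<bullet> u (Suc k)) \<in> A"
      using sR u yR by (simp add: congr_def smult_minus_distr)
    then have "s (Suc k) \<bullet> u k \<ominus>\<^sub>M s k \<bullet> y \<bullet> u (Suc k) \<in> colon A (y [^] k)"
      using sR u yR by (simp add: colon_def)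
    then show ?thesis using c[OF k] sR u yR by (simp add: congr_def C_def)
  qed
  \<comment> \<open>The saturation of the submodule generated by \<open>u k\<close> and C. By
    \<open>step\<close> the vector \<open>u k\<close> is, up to a multiplier, a multiple of
    \<open>u (Suc k)\<close>, so these modules ascend.\<close>
  define D where "D k = {w \<in> \<M>. \<exists>t\<in>carrier R - P. \<exists>r\<in>carrier R. congr C (t \<bullet> w) (r \<bullet> u k)}" for k
  have oneS: "\<one> \<in> carrier R - P" using P.one_imp_carrier P.I_notcarr by auto
  have D: "sub (D k)" for k
  proof (rule submoduleI)
    show "\<zero>\<^sub>M \<in> D k" using oneS congr_refl[OF C, of "\<zero>\<^sub>M"] u[of k] unfolding D_def
      by (auto intro!: bexI[of _ \<one>] bexI[of _ \<zero>])
    show "a \<bullet> w \<in> D k" if aw: "a \<in> carrier R" "w \<in> D k" for a w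
    proof -
      obtain t r where t: "t \<in> carrier R - P" "r \<in> carrier R" "congr C (t \<bullet> w) (r \<bullet> u k)" "w \<in> \<M>"
        using aw by (auto simp: D_def)
      then have "congr C (t \<bullet> a \<bullet> w) ((a \<otimes> r) \<bullet> u k)"
        using congr_smult[OF C aw(1) t(3)] aw u[of k] by (simp add: smult_assoc1 smult_comm[of t a])
      then show ?thesis using t aw by (auto simp: D_def)
    qed
    from this[of "\<ominus> \<one>"] show "\<ominus>\<^bsub>M\<^esub> a \<in> D k" if "a \<in> D k" for a
      using that by (auto simp: smult_l_minus D_def)
    show "a \<oplus>\<^sub>M b \<in> D k" if ab: "a \<in> D k" "b \<in> D k" for a b
    proof -
      obtain t r where t: "t \<in> carrier R - P" "r \<in> carrier R" "congr C (t \<bullet> a) (r \<bullet> u k)" "a \<in> \<M>"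
        using ab by (auto simp: D_def)
      obtain t' r' where t': "t' \<in> carrier R - P" "r' \<in> carrier R" "congr C (t' \<bullet> b) (r' \<bullet> u k)" "b \<in> \<M>"
        using ab by (auto simp: D_def)
      have "congr C (t' \<bullet> t \<bullet> a \<oplus>\<^sub>M t \<bullet> t' \<bullet> b) (t' \<bullet> r \<bullet> u k \<oplus>\<^sub>M t \<bullet> r' \<bullet> u k)"
        using t t' by (intro congr_add[OF C] congr_smult[OF C]) auto
      moreover have "t' \<bullet> t \<bullet> a \<oplus>\<^sub>M t \<bullet> t' \<bullet> b = (t \<otimes> t') \<bullet> (a \<oplus>\<^sub>M b)"
        using t t' by (simp add: smult_r_distr smult_assoc1 smult_comm[of t' t a])
      moreover have "t' \<bullet> r \<bullet> u k \<oplus>\<^sub>M t \<bullet> r' \<bullet> u k = (t' \<otimes> r \<oplus> t \<otimes> r') \<bullet> u k"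
        using t t' u[of k] by (simp add: smult_l_distr smult_assoc1)
      ultimately have "congr C ((t \<otimes> t') \<bullet> (a \<oplus>\<^sub>M b)) ((t' \<otimes> r \<oplus> t \<otimes> r') \<bullet> u k)" by simp
      then show ?thesis using t t' SS[OF t(1) t'(1)] unfolding D_def
        by (intro CollectI conjI bexI[of _ "t \<otimes> t'"] bexI[of _ "t' \<otimes> r \<oplus> t \<otimes> r'"]) auto
    qed
  qed (auto simp: D_def)
  have Dm: "D k \<subseteq> D (Suc k)" if k: "k \<ge> c" for k
  proof
    fix w assume "w \<in> D k"
    then obtain t r where t: "t \<in> carrier R - P" "r \<in> carrier R" "congr C (t \<bullet> w) (r \<bullet> u k)" "w \<in> \<M>"
      by (auto simp: D_def)
    note [trans] = congr_trans[OF C]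
    have "(s (Suc k) \<otimes> t) \<bullet> w = s (Suc k) \<bullet> t \<bullet> w" using t sR by (simp add: smult_assoc1)
    also have "congr C \<dots> (s (Suc k) \<bullet> r \<bullet> u k)" using t sR by (intro congr_smult[OF C]) auto
    also have "s (Suc k) \<bullet> r \<bullet> u k = r \<bullet> s (Suc k) \<bullet> u k" using t sR u by (intro smult_comm) auto
    also have "congr C \<dots> (r \<bullet> s k \<bullet> y \<bullet> u (Suc k))" using t by (intro congr_smult[OF C] step k) auto
    also have "r \<bullet> s k \<bullet> y \<bullet> u (Suc k) = (r \<otimes> (s k \<otimes> y)) \<bullet> u (Suc k)"
      using t sR u yR by (simp add: smult_assoc1)
    finally show "w \<in> D (Suc k)" using t SS[OF s t(1)] sR yR unfolding D_def
      by (intro CollectI conjI bexI[of _ "s (Suc k) \<otimes> t"] bexI[of _ "r \<otimes> (s k \<otimes> y)"]) auto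
  qed
  obtain d where d: "\<And>n. n \<ge> d \<Longrightarrow> D (c + n) = D (c + d)"
    using submodule_chain_stabilizes[of "\<lambda>n. D (c + n)"] D Dm by (metis add_Suc_right le_add1)
  define k where "k = c + d"
  have "u (Suc k) \<in> D (Suc k)" unfolding D_def using u oneS congr_refl[OF C u]
    by (intro CollectI conjI bexI[of _ \<one>]) auto
  then have "u (Suc k) \<in> D k" using d[of "Suc d"] by (simp add: k_def)
  then obtain t r where t: "t \<in> carrier R - P" "r \<in> carrier R" "congr C (t \<bullet> u (Suc k)) (r \<bullet> u k)"
    by (auto simp: D_def)
  \<comment> \<open>Substituting t u_(k+1) = r u_k into \<open>step\<close> shows that q takes
    u_(k+1) into C. As y is in P, q differs from a product of multipliers by an element of P and so
    lies outside P: the determinant trick for one generator.\<close>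
  define q where "q = s (Suc k) \<otimes> t \<ominus> r \<otimes> (s k \<otimes> y)"
  have kc: "k \<ge> c" by (simp add: k_def)
  have "congr C ((s (Suc k) \<otimes> t) \<bullet> u (Suc k)) ((r \<otimes> (s k \<otimes> y)) \<bullet> u (Suc k))"
  proof -
    note [trans] = congr_trans[OF C]
    have "(s (Suc k) \<otimes> t) \<bullet> u (Suc k) = s (Suc k) \<bullet> t \<bullet> u (Suc k)" using t sR u by (simp add: smult_assoc1)
    also have "congr C \<dots> (s (Suc k) \<bullet> r \<bullet> u k)" using t sR by (intro congr_smult[OF C]) auto
    also have "s (Suc k) \<bullet> r \<bullet> u k = r \<bullet> s (Suc k) \<bullet> u k" using t sR u by (intro smult_comm) auto
    also have "congr C \<dots> (r \<bullet> s k \<bullet> y \<bullet> u (Suc k))" using t by (intro congr_smult[OF C] step kc) auto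
    also have "r \<bullet> s k \<bullet> y \<bullet> u (Suc k) = (r \<otimes> (s k \<otimes> y)) \<bullet> u (Suc k)"
      using t sR u yR by (simp add: smult_assoc1)
    finally show ?thesis .
  qed
  then have qC: "q \<bullet> u (Suc k) \<in> C" using t sR u yR by (simp add: q_def smult_minus_distr_l congr_def)
  have "r \<otimes> (s k \<otimes> y) \<in> P" using t sR y by (auto intro!: P.I_l_closed)
  moreover have "q \<oplus> r \<otimes> (s k \<otimes> y) = s (Suc k) \<otimes> t" unfolding q_def
    using t sR yR by (simp add: R.minus_eq R.a_assoc R.l_neg)
  ultimately have "q \<notin> P" using SS[OF s t(1), of "Suc k"] P.a_closed[of q "r \<otimes> (s k \<otimes> y)"] by auto
  then have q: "q \<in> carrier R - P" using t sR yR by (auto simp: q_def)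
  have "q \<bullet> u (Suc k) \<in> colon A (y [^] Suc k)" using qC c[of "Suc k"] kc by (simp add: C_def)
  then have "y [^] Suc k \<bullet> q \<bullet> u (Suc k) \<in> A" by (simp add: colon_def)
  moreover have "y [^] Suc k \<bullet> q \<bullet> u (Suc k) = q \<bullet> y [^] Suc k \<bullet> u (Suc k)"
    using q u yR by (intro smult_comm) auto
  ultimately have "q \<bullet> s (Suc k) \<bullet> v \<in> A"
    using congr_mem[OF A congr_smult[OF A _ su[of "Suc k"]], of q] q by simp
  then have "(q \<otimes> s (Suc k)) \<bullet> v \<in> A" using q sR v by (simp add: smult_assoc1)
  then show ?thesis using SS[OF q s] by blast
qed

end

section \<open>Regular sequences over a local ring\<close>

locale local_fg_module = fg_noetherian_module R M + local_ring \<mm> R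
  for R (structure) and M (structure) and \<mm>
begin

lemma m_carr: "a \<in> \<mm> \<Longrightarrow> a \<in> carrier R"
  by (rule Icarr)

lemma prime_m: "primeideal \<mm> R"
  using maximalideal_prime is_maximalideal by blast

text \<open>Otherwise an ideal maximal among the proper ones over (s) would be a maximal ideal,
  hence \<mm>, although it contains s.\<close>

lemma unit_outside:
  assumes "s \<in> carrier R - \<mm>"
  obtains t where "t \<in> carrier R" "t \<otimes> s = \<one>"
proof (cases "\<one> \<in> PIdl s")
  case True
  then show ?thesis using that by (auto simp: cgenideal_def)
next
  case False
  let ?A = "{J. ideal J R \<and> PIdl s \<subseteq> J \<and> \<one> \<notin> J}"
  have "PIdl s \<in> ?A" using False assms cgenideal_ideal by auto
  then obtain I where I: "I \<in> ?A" "\<And>J. J \<in> ?A \<Longrightarrow> I \<subseteq> J \<Longrightarrow> J = I"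
    using ideal_maximal_element[of ?A] by blast
  have "maximalideal I R"
  proof (rule maximalidealI)
    fix J assume "ideal J R" "I \<subseteq> J" "J \<subseteq> carrier R"
    then show "J = I \<or> J = carrier R" using I ideal.one_imp_carrier[of J R] by blast
  qed (use I in auto)
  then have "I = \<mm>" by (rule maximalideal_unique)
  moreover have "s \<in> PIdl s" using assms cgenideal_self by auto
  ultimately show ?thesis using I assms by blast
qed

lemma proper_ideal_le_m:
  assumes "ideal I R" "I \<noteq> carrier R" shows "I \<subseteq> \<mm>"
proof
  fix x assume x: "x \<in> I"
  show "x \<in> \<mm>"
  proof (rule ccontr)
    assume "x \<notin> \<mm>"
    then obtain t where "t \<in> carrier R" "t \<otimes> x = \<one>"
      using unit_outside[of x] x ideal.Icarr[OF assms(1)] by auto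
    then have "\<one> \<in> I" using ideal.I_l_closed[OF assms(1) x] by metis
    then show False using assms ideal.one_imp_carrier by blast
  qed
qed

lemma prime_le_m: "primeideal P R \<Longrightarrow> P \<subseteq> \<mm>"
  using proper_ideal_le_m primeideal.I_notcarr primeideal.axioms(1) by metis

lemma mem_of_smult_unit:
  assumes "sub N" "s \<in> carrier R - \<mm>" "v \<in> \<M>" "s \<bullet> v \<in> N" shows "v \<in> N"
proof -
  obtain t where t: "t \<in> carrier R" "t \<otimes> s = \<one>" using unit_outside assms by blast
  then have "t \<bullet> s \<bullet> v \<in> N" using assms sub_smult by auto
  then show ?thesis using t assms by (simp add: smult_assoc1[symmetric])
qed

lemma krull_intersection:
  assumes "sub A" "a \<in> \<mm>" "v \<in> \<M>" "\<And>k::nat. v \<in> ext A {a [^] k}" shows "v \<in> A"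
proof -
  have "\<exists>s\<in>carrier R - \<mm>. s \<bullet> v \<in> A"
  proof (rule krull_saturated[OF prime_m])
    have "\<one> \<in> carrier R - \<mm>" using one_imp_carrier I_notcarr by auto
    then show "\<exists>s\<in>carrier R - \<mm>. s \<bullet> v \<in> ext A {a [^] k}" for k :: nat
      using assms(3) assms(4)[of k] by (intro bexI[of _ \<one>]) auto
  qed (use assms in auto)
  then show ?thesis using mem_of_smult_unit[OF assms(1)] assms(3) by blast
qed

text \<open>If bv = 0 modulo B, regularity of b modulo a gives v = au, and regularity of a gives bu
  = 0. Repetition puts v into B + a^k M for all k, and Krull's theorem into B; this is where a must
  lie in \<mm>. The second claim is a direct cancellation.\<close>

lemma reg_swap:
  assumes B: "sub B" and a: "a \<in> \<mm>" and b: "b \<in> carrier R" and ra: "reg B a" and rb: "reg (ext B {a}) b"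
  shows "reg B b" "reg (ext B {b}) a"
proof -
  note [trans] = congr_trans[OF B]
  have aR: "a \<in> carrier R" using a m_carr by auto
  have *: "v \<in> ext B {a [^] (k::nat)}" if "v \<in> \<M>" "b \<bullet> v \<in> B" for k v
    using that
  proof (induction k arbitrary: v)
    case 0
    then show ?case using ext_prod[of \<one> "{\<one>}" v B] by auto
  next
    case (Suc k)
    then have "v \<in> ext B {a}" using rb ext_base[of B "{a}"] by (auto simp: reg_def)
    then obtain u where u: "u \<in> \<M>" "congr B v (a \<bullet> u)" using ext_single_iff[OF B aR] by auto
    have "b \<bullet> a \<bullet> u \<in> B" using congr_mem[OF B congr_smult[OF B b u(2)]] Suc by simp
    then have "b \<bullet> u \<in> B" using ra u b aR by (simp add: reg_def smult_comm[of b a])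
    then obtain w where w: "w \<in> \<M>" "congr B u (a [^] k \<bullet> w)"
      using Suc.IH[OF u(1)] ext_single_iff[OF B] aR by auto
    have "congr B v (a \<bullet> u)" by (rule u(2))
    also have "congr B (a \<bullet> u) (a \<bullet> a [^] k \<bullet> w)" by (rule congr_smult[OF B aR w(2)])
    also have "a \<bullet> a [^] k \<bullet> w = a [^] Suc k \<bullet> w" using pow_Suc_smult aR w by simp
    finally show ?case using w aR B by (auto simp: ext_single_iff simp del: R.nat_pow_Suc)
  qed
  show "reg B b" unfolding reg_def using * krull_intersection[OF B a] by blast
  show "reg (ext B {b}) a" unfolding reg_def
  proof (intro ballI impI)
    fix v assume v: "v \<in> \<M>" "a \<bullet> v \<in> ext B {b}"
    then obtain u where u: "u \<in> \<M>" "congr B (a \<bullet> v) (b \<bullet> u)" using ext_single_iff[OF B b] by auto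
    then have "b \<bullet> u \<in> ext B {a}" using congr_sym[OF B] v ext_single_iff[OF B aR] by blast
    then have "u \<in> ext B {a}" using rb u by (auto simp: reg_def)
    then obtain w where w: "w \<in> \<M>" "congr B u (a \<bullet> w)" using ext_single_iff[OF B aR] by auto
    have "congr B (a \<bullet> v) (b \<bullet> u)" by (rule u(2))
    also have "congr B \<dots> (b \<bullet> a \<bullet> w)" by (rule congr_smult[OF B b w(2)])
    also have "b \<bullet> a \<bullet> w = a \<bullet> b \<bullet> w" using w aR b by (intro smult_comm) auto
    finally have "a \<bullet> (v \<ominus>\<^sub>M b \<bullet> w) \<in> B" using v w aR b by (simp add: congr_def smult_minus_distr)
    then have "v \<ominus>\<^sub>M b \<bullet> w \<in> B" using ra v w b by (auto simp: reg_def)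
    then show "v \<in> ext B {b}" using v w b B by (auto simp: ext_single_iff congr_def)
  qed
qed

lemma rseq_swap:
  assumes "sub B" "a \<in> \<mm>" "b \<in> \<mm>" "rseq B (a # b # xs)" shows "rseq B (b # a # xs)"
proof -
  have "ext (ext B {a}) {b} = ext (ext B {b}) {a}"
    using assms m_carr by (simp add: ext_ext Un_commute insert_commute)
  then show ?thesis using reg_swap[of B a b] assms m_carr by auto
qed

lemma rseq_rotate:
  "sub B \<Longrightarrow> z \<in> \<mm> \<Longrightarrow> set ys \<subseteq> \<mm> \<Longrightarrow> rseq B (z # ys) \<longleftrightarrow> rseq B (ys @ [z])"
proof (induction ys arbitrary: B)
  case (Cons y ys)
  have "rseq B (z # y # ys) \<longleftrightarrow> rseq B (y # z # ys)"
    using rseq_swap[OF Cons.prems(1,2), of y ys] rseq_swap[OF Cons.prems(1) _ Cons.prems(2), of y ys] Cons.prems(3)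
    by (meson list.set_intros(1) subsetD)
  moreover have "sub (ext B {y})" using Cons.prems m_carr by (intro ext_sub) auto
  ultimately show ?case using Cons.IH[of "ext B {y}"] Cons.prems by auto
qed auto

end

section \<open>Length after localization, measured by chains\<close>

context module
begin

text \<open>A step from \<open>A\<close> to \<open>B\<close> counts only if it stays strict after inverting \<open>S\<close>: the chains below
  compute lengths over the localization at \<open>S\<close>.\<close>

definition sstep where "sstep S A B \<longleftrightarrow> A \<subseteq> B \<and> (\<exists>b\<in>B. \<forall>s\<in>S. s \<bullet> b \<notin> A)"

text \<open>The base case only asks for \<open>A \<subseteq> C\<close>: k counts strict steps, and
  the upper end is reached with slack. This makes it immediate to shorten a chain or to lower its
  bottom.\<close>

primrec schain where
  "schain S 0 A C \<longleftrightarrow> sub A \<and> sub C \<and> A \<subseteq> C"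
| "schain S (Suc k) A C \<longleftrightarrow> sub A \<and> (\<exists>B. sstep S A B \<and> schain S k B C)"

lemma schain_sub: "schain S k A C \<Longrightarrow> sub A \<and> sub C \<and> A \<subseteq> C"
  by (induction k arbitrary: A) (auto simp: sstep_def)

lemma schain_mono: "schain S k A C \<Longrightarrow> sub A' \<Longrightarrow> A' \<subseteq> A \<Longrightarrow> schain S k A' C"
proof (cases k)
  case (Suc j)
  assume "schain S k A C" "sub A'" "A' \<subseteq> A"
  then show ?thesis unfolding Suc schain.simps sstep_def by (meson subset_eq)
qed auto

lemma schain_append: "schain S i A B \<Longrightarrow> schain S j B C \<Longrightarrow> schain S (i + j) A C"
  by (induction i arbitrary: A) (auto intro: schain_mono)

lemma schain_Suc_imp: "schain S (Suc k) A C \<Longrightarrow> schain S k A C"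
  by (auto simp: sstep_def intro: schain_mono)

lemma schain_le: "schain S k A C \<Longrightarrow> j \<le> k \<Longrightarrow> schain S j A C"
  by (induction k) (use schain_Suc_imp le_Suc_eq in \<open>metis le_zero_eq\<close>)+

text \<open>Subadditivity of length: intersecting with B and adding B turn every strict step into a
  strict step of at least one of the two new chains.\<close>

lemma schain_split:
  assumes B: "sub B" "B \<subseteq> C" and S: "S \<subseteq> carrier R" "\<And>s t. s \<in> S \<Longrightarrow> t \<in> S \<Longrightarrow> s \<otimes> t \<in> S"
  shows "schain S k A C \<Longrightarrow> \<exists>i j. i + j = k \<and> schain S i (A \<inter> B) B \<and> schain S j (A +\<^sub>M B) C"
proof (induction k arbitrary: A)
  case 0
  then have "A +\<^sub>M B \<subseteq> C" using B by (intro add_least) auto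
  then show ?case using 0 B by (intro exI[of _ 0]) (auto intro: sub_Int add_sub)
next
  case (Suc k)
  then obtain D where D: "sub A" "sstep S A D" "schain S k D C" by auto
  then have sD: "sub D" "A \<subseteq> D" using schain_sub by (auto simp: sstep_def)
  obtain i j where ij: "i + j = k" "schain S i (D \<inter> B) B" "schain S j (D +\<^sub>M B) C" using Suc.IH[OF D(3)] by blast
  have le: "A +\<^sub>M B \<subseteq> D +\<^sub>M B"
    using add_le[OF sD(1) B(1)] sD by (intro add_least add_sub B) auto
  show ?case
  proof (cases "\<exists>b\<in>D \<inter> B. \<forall>s\<in>S. s \<bullet> b \<notin> A")
    case True
    then have "sstep S (A \<inter> B) (D \<inter> B)" using sD by (auto simp: sstep_def)
    then have "schain S (Suc i) (A \<inter> B) B" using ij D B sub_Int by auto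
    moreover have "schain S j (A +\<^sub>M B) C" using ij le D B by (auto intro: schain_mono add_sub)
    ultimately show ?thesis using ij by (intro exI[of _ "Suc i"] exI[of _ j]) auto
  next
    case False
    obtain b where b: "b \<in> D" "\<And>s. s \<in> S \<Longrightarrow> s \<bullet> b \<notin> A" using D(2) by (auto simp: sstep_def)
    \<comment> \<open>Modular law with multipliers: if sb = u modulo A with u in B, then u is in
      \<open>D \<inter> B\<close>, so some t in S takes u into A, and ts takes b into A.\<close>
    have "s \<bullet> b \<notin> A +\<^sub>M B" if s: "s \<in> S" for s
    proof
      assume "s \<bullet> b \<in> A +\<^sub>M B"
      then obtain u where u: "u \<in> B" "congr A (s \<bullet> b) u" using add_mem_iff[OF D(1) B(1)] by auto
      have "s \<bullet> b \<in> D" using s S b sub_smult[OF sD(1)] by auto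
      then have "u \<in> D" using congr_mem[OF sD(1) congr_mono[OF u(2) sD(2)]] by simp
      then obtain t where t: "t \<in> S" "t \<bullet> u \<in> A" using False u by auto
      then have "t \<bullet> s \<bullet> b \<in> A" using congr_mem[OF D(1) congr_smult[OF D(1) _ u(2)]] S by auto
      then have "(t \<otimes> s) \<bullet> b \<in> A" using t s S b sub_carr[OF sD(1)] by (simp add: smult_assoc1 subset_iff)
      then show False using b S t s by auto
    qed
    then have "sstep S (A +\<^sub>M B) (D +\<^sub>M B)"
      using le b add_le[OF sD(1) B(1)] unfolding sstep_def by (intro conjI bexI[of _ b]) auto
    then have "schain S (Suc j) (A +\<^sub>M B) C" using ij D B add_sub by auto
    moreover have "schain S i (A \<inter> B) B" using ij(2) by (rule schain_mono) (use sD D B sub_Int in auto)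
    ultimately show ?thesis using ij by (intro exI[of _ i] exI[of _ "Suc j"]) auto
  qed
qed

definition bounded_schain where "bounded_schain S A C \<longleftrightarrow> (\<exists>n. \<forall>k. schain S k A C \<longrightarrow> k \<le> n)"

definition mult_set where "mult_set S \<longleftrightarrow> S \<subseteq> carrier R \<and> \<one> \<in> S \<and> (\<forall>s\<in>S. \<forall>t\<in>S. s \<otimes> t \<in> S)"

lemma mult_set_prime: "primeideal P R \<Longrightarrow> mult_set (carrier R - P)"
  unfolding mult_set_def using primeideal.I_prime[of P R] ideal.one_imp_carrier[of P R]
    primeideal.axioms(1)[of P R] primeideal.I_notcarr[of P R] by auto

lemma bounded_schain_trans:
  assumes "mult_set S" "sub B" "A \<subseteq> B" "B \<subseteq> C" "bounded_schain S A B" "bounded_schain S B C"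
  shows "bounded_schain S A C"
proof -
  obtain n m where n: "\<And>k. schain S k A B \<Longrightarrow> k \<le> n" and m: "\<And>k. schain S k B C \<Longrightarrow> k \<le> m"
    using assms by (auto simp: bounded_schain_def)
  have "k \<le> n + m" if k: "schain S k A C" for k
  proof -
    have A: "sub A" using schain_sub k by auto
    obtain i j where ij: "i + j = k" "schain S i (A \<inter> B) B" "schain S j (A +\<^sub>M B) C"
      using schain_split[OF assms(2,4) _ _ k] assms(1) by (auto simp: mult_set_def)
    have "A \<inter> B = A" using assms by auto
    moreover have "A +\<^sub>M B = B"
      using add_least[OF assms(2,3), of B] add_le[OF A assms(2)] by auto
    ultimately show ?thesis using ij n[of i] m[of j] by auto
  qed
  then show ?thesis unfolding bounded_schain_def by blast
qed

lemma bounded_schain_torsion: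
  assumes "\<And>v. v \<in> A \<Longrightarrow> \<exists>s\<in>S. s \<bullet> v \<in> N"
  shows "bounded_schain S N A"
proof -
  have "k \<le> 0" if k: "schain S k N A" for k
  proof (cases k)
    case (Suc j)
    then obtain B where "sstep S N B" "schain S j B A" using k by auto
    then show ?thesis using schain_sub[of S j B A] assms by (auto simp: sstep_def)
  qed auto
  then show ?thesis unfolding bounded_schain_def by blast
qed

text \<open>Modulo A the module Rv is killed by P, so its localization has dimension at most 1 over
  the residue field of P. In elements: a strict first step yields r outside P with rv in J1, and
  this r takes all of J2 into J1.\<close>

lemma bounded_schain_cyc:
  assumes P: "primeideal P R" and A: "sub A" and v: "v \<in> \<M>" and Pv: "\<And>p. p \<in> P \<Longrightarrow> p \<bullet> v \<in> A"
  shows "bounded_schain (carrier R - P) A (A +\<^sub>M cyc v)"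
proof -
  have "k \<le> 1" if k: "schain (carrier R - P) k A (A +\<^sub>M cyc v)" for k
  proof (rule ccontr)
    assume "\<not> k \<le> 1"
    then have "schain (carrier R - P) (Suc (Suc 0)) A (A +\<^sub>M cyc v)" by (intro schain_le[OF k]) auto
    then obtain J1 J2 where J: "sstep (carrier R - P) A J1" "sstep (carrier R - P) J1 J2"
      "J2 \<subseteq> A +\<^sub>M cyc v" "sub J1" "sub J2" by auto
    then obtain b where b: "b \<in> J1" "\<And>s. s \<in> carrier R - P \<Longrightarrow> s \<bullet> b \<notin> A" by (auto simp: sstep_def)
    have le: "A \<subseteq> J1" "J1 \<subseteq> J2" using J by (auto simp: sstep_def)
    have ex: "\<exists>r\<in>carrier R. congr A x (r \<bullet> v)" if "x \<in> J2" for x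
      using that J(3) add_mem_iff[OF A cyc_sub[OF v]] by (auto simp: cyc_def)
    obtain r where r: "r \<in> carrier R" "congr A b (r \<bullet> v)" using ex[of b] b le by auto
    have one: "\<one> \<in> carrier R - P" using mult_set_prime[OF P] by (auto simp: mult_set_def)
    have "r \<notin> P"
    proof
      assume "r \<in> P"
      then have "b \<in> A" using congr_memI[OF A r(2)] Pv by auto
      then show False using b(2)[OF one] b(1) sub_carr[OF J(4)] by simp
    qed
    have "r \<bullet> v \<in> J1" using congr_mem[OF J(4) congr_mono[OF r(2) le(1)]] b by simp
    obtain c where c: "c \<in> J2" "\<And>s. s \<in> carrier R - P \<Longrightarrow> s \<bullet> c \<notin> J1" using J(2) by (auto simp: sstep_def)
    obtain q where q: "q \<in> carrier R" "congr A c (q \<bullet> v)" using ex c by auto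
    have "congr J1 (r \<bullet> c) (r \<bullet> q \<bullet> v)" using congr_mono[OF congr_smult[OF A r(1) q(2)] le(1)] .
    moreover have "r \<bullet> q \<bullet> v = q \<bullet> r \<bullet> v" using r q v by (intro smult_comm) auto
    moreover have "q \<bullet> r \<bullet> v \<in> J1" using \<open>r \<bullet> v \<in> J1\<close> q sub_smult[OF J(4)] by auto
    ultimately have "r \<bullet> c \<in> J1" using congr_memI[OF J(4)] by metis
    then show False using c(2)[of r] r \<open>r \<notin> P\<close> by auto
  qed
  then show ?thesis unfolding bounded_schain_def by blast
qed

lemma bounded_schain_refl: "mult_set S \<Longrightarrow> sub A \<Longrightarrow> bounded_schain S A A"
  by (rule bounded_schain_torsion) (auto simp: mult_set_def sub_carr intro!: bexI[of _ \<one>])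

lemma bounded_schain_gen:
  assumes P: "primeideal P R" and A: "sub A" and X: "finite X" "X \<subseteq> \<M>"
    and PM: "\<And>p v. p \<in> P \<Longrightarrow> v \<in> \<M> \<Longrightarrow> p \<bullet> v \<in> A"
  shows "bounded_schain (carrier R - P) A (A +\<^sub>M gen_submodule R M X)"
  using X
proof (induction X rule: finite_induct)
  case empty
  have "gen_submodule R M {} \<subseteq> {\<zero>\<^sub>M}" by (rule gen_least[OF sub_zero_module]) auto
  then have "gen_submodule R M {} \<subseteq> A" using sub_zero[OF A] by auto
  then have "A +\<^sub>M gen_submodule R M {} = A"
    using add_least[OF A, of A "gen_submodule R M {}"] add_le[OF A gen_sub[of "{}"]] by auto
  then show ?case using bounded_schain_refl[OF mult_set_prime[OF P] A] by simp
next
  case (insert v X)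
  let ?G = "gen_submodule R M X"
  have v: "v \<in> \<M>" and X: "X \<subseteq> \<M>" using insert by auto
  note G = gen_sub[OF X] and c = cyc_sub[OF v]
  note AG = add_sub[OF A G]
  note L = add_le[OF A G] add_le[OF AG c] add_le[OF G c] add_le[OF A add_sub[OF G c]]
  have "A +\<^sub>M (?G +\<^sub>M cyc v) = (A +\<^sub>M ?G) +\<^sub>M cyc v"
  proof (intro subset_antisym)
    show "A +\<^sub>M (?G +\<^sub>M cyc v) \<subseteq> (A +\<^sub>M ?G) +\<^sub>M cyc v"
      using L by (intro add_least add_sub A G c) auto
    show "(A +\<^sub>M ?G) +\<^sub>M cyc v \<subseteq> A +\<^sub>M (?G +\<^sub>M cyc v)"
      using L by (intro add_least add_sub A G c) auto
  qed
  moreover have "bounded_schain (carrier R - P) (A +\<^sub>M ?G) ((A +\<^sub>M ?G) +\<^sub>M cyc v)"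
    using PM v L by (intro bounded_schain_cyc[OF P AG v]) auto
  ultimately show ?case
    using bounded_schain_trans[OF mult_set_prime[OF P] AG L(1) L(3)] insert.IH[OF X] gen_insert[OF v X] by simp
qed

text \<open>Multiplication by g maps M onto (B + gM)/B, and preimages under a surjection keep steps
  strict, also after localization.\<close>

lemma schain_pullback:
  assumes B: "sub B" and g: "g \<in> carrier R"
  shows "schain S k A (ext B {g}) \<Longrightarrow> S \<subseteq> carrier R \<Longrightarrow> B \<subseteq> A \<Longrightarrow> schain S k (colon A g) \<M>"
proof (induction k arbitrary: A)
  case 0
  then show ?case using g colon_sub carrier_is_submodule by (auto simp: colon_def)
next
  case (Suc k)
  then obtain J where J: "sub A" "sstep S A J" "schain S k J (ext B {g})" by auto
  have J2: "sub J" "J \<subseteq> ext B {g}" "A \<subseteq> J" using schain_sub[OF J(3)] J by (auto simp: sstep_def)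
  obtain b where b: "b \<in> J" "\<And>s. s \<in> S \<Longrightarrow> s \<bullet> b \<notin> A" using J(2) by (auto simp: sstep_def)
  have "b \<in> ext B {g}" using b J2 by auto
  then obtain u where u: "u \<in> \<M>" "congr B b (g \<bullet> u)" using ext_singleE[OF _ B g] by blast
  have "u \<in> colon J g" using congr_mem[OF J2(1) congr_mono[OF u(2)], of] b u J2 Suc.prems by (auto simp: colon_def)
  moreover have "s \<bullet> u \<notin> colon A g" if s: "s \<in> S" for s
  proof
    assume "s \<bullet> u \<in> colon A g"
    then have "s \<bullet> g \<bullet> u \<in> A" using s g u Suc.prems(2) by (auto simp: colon_def smult_comm[of s g])
    then have "s \<bullet> b \<in> A"
      using congr_memI[OF J(1) congr_mono[OF congr_smult[OF B _ u(2)] Suc.prems(3)], of s] s Suc.prems(2) by auto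
    then show False using b(2)[OF s] by auto
  qed
  ultimately have "sstep S (colon A g) (colon J g)" using J2 by (auto simp: sstep_def colon_def)
  moreover have "schain S k (colon J g) \<M>" using Suc.IH[OF J(3)] Suc.prems J2 by auto
  ultimately show ?case using J g by (auto intro: colon_sub)
qed

text \<open>Each factor of the filtration by B + g^t M is an image of M/(B + gM) under
  multiplication by g^t.\<close>

lemma bounded_schain_pow:
  assumes S: "mult_set S" and B: "sub B" and g: "g \<in> carrier R" and b: "bounded_schain S (ext B {g}) \<M>"
  shows "bounded_schain S (ext B {g [^] (t::nat)}) \<M>"
proof (induction t)
  case 0
  have "ext B {\<one>} = \<M>" using ext_prod[of \<one> "{\<one>}"] sub_subset[OF ext_sub[OF B, of "{\<one>}"]] by force
  then show ?case using bounded_schain_refl[OF S carrier_is_submodule] by simp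
next
  case (Suc t)
  have gt: "g [^] t \<in> carrier R" using g by auto
  have e: "sub (ext B {g [^] Suc t})" "sub (ext B {g [^] t})" "sub (ext B {g})"
    using g B by (auto intro!: ext_sub)
  have "ext B {g} \<subseteq> colon (ext B {g [^] Suc t}) (g [^] t)"
  proof (rule ext_least)
    show "sub (colon (ext B {g [^] Suc t}) (g [^] t))" using e gt by (intro colon_sub) auto
    show "B \<subseteq> colon (ext B {g [^] Suc t}) (g [^] t)"
      using sub_carr[OF B] sub_smult[OF B gt] ext_base[of B "{g [^] Suc t}"] by (auto simp: colon_def)
    fix x v assume "x \<in> {g}" "v \<in> \<M>"
    then show "x \<bullet> v \<in> colon (ext B {g [^] Suc t}) (g [^] t)"
      using g pow_add_smult[of g v t 1] ext_prod[of "g [^] Suc t" "{g [^] Suc t}" v B]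
      by (auto simp: colon_def)
  qed
  moreover obtain n where n: "\<And>k. schain S k (ext B {g}) \<M> \<Longrightarrow> k \<le> n" using b by (auto simp: bounded_schain_def)
  ultimately have "k \<le> n" if "schain S k (ext B {g [^] Suc t}) (ext B {g [^] t})" for k
    using schain_mono[OF schain_pullback[OF B gt that _ ext_base] e(3)] S by (auto simp: mult_set_def)
  then have "bounded_schain S (ext B {g [^] Suc t}) (ext B {g [^] t})" unfolding bounded_schain_def by blast
  moreover have "ext B {g [^] Suc t} \<subseteq> ext B {g [^] t}" using B g by (intro ext_pow_le) auto
  ultimately show ?case using bounded_schain_trans[OF S e(2)] Suc sub_subset[OF e(2)] by blast
qed

lemma colon_elem_ideal: assumes "sub K" "v \<in> \<M>" shows "ideal {r \<in> carrier R. r \<bullet> v \<in> K} R"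
proof (rule idealI[OF R.ring_axioms])
  show "subgroup {r \<in> carrier R. r \<bullet> v \<in> K} (add_monoid R)"
    using assms sub_zero[OF assms(1)] sub_neg[OF assms(1)] sub_add[OF assms(1)]
    by (intro R.add.subgroupI) (auto simp: smult_l_minus smult_l_distr intro!: exI[of _ \<zero>])
  fix a x assume a: "a \<in> {r \<in> carrier R. r \<bullet> v \<in> K}" "x \<in> carrier R"
  then show "x \<otimes> a \<in> {r \<in> carrier R. r \<bullet> v \<in> K}"
    using assms sub_smult[OF assms(1)] by (auto simp: smult_assoc1)
  then show "a \<otimes> x \<in> {r \<in> carrier R. r \<bullet> v \<in> K}" using a R.m_comm by auto
qed

lemma Idl_smult_mem:
  assumes "sub K" "v \<in> \<M>" "G \<subseteq> carrier R" "\<And>g. g \<in> G \<Longrightarrow> g \<bullet> v \<in> K" "p \<in> Idl G"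
  shows "p \<bullet> v \<in> K"
  using R.genideal_minimal[OF colon_elem_ideal[OF assms(1,2)], of G] assms by auto

lemma ext_Idl: assumes "sub B" "G \<subseteq> carrier R" shows "ext B (Idl G) = ext B G"
proof
  have c: "Idl G \<subseteq> carrier R" using R.genideal_ideal[OF assms(2)] ideal.Icarr by fastforce
  show "ext B (Idl G) \<subseteq> ext B G"
  proof (rule ext_least)
    fix x v assume "x \<in> Idl G" "v \<in> \<M>"
    then show "x \<bullet> v \<in> ext B G" using assms by (intro Idl_smult_mem[of "ext B G" v G x] ext_sub ext_prod)
  qed (use assms in \<open>auto intro: ext_sub ext_base[THEN subsetD]\<close>)
  show "ext B G \<subseteq> ext B (Idl G)" using assms c R.genideal_self[OF assms(2)] by (intro ext_mono) auto
qed

text \<open>Finite length survives replacing a generator g by \<open>g [^] t\<close>; this power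
  acts as zero modulo N after localization and can then be dropped.\<close>

lemma bounded_schain_of_torsion:
  assumes S: "mult_set S" and G: "finite G"
  shows "G \<subseteq> carrier R \<Longrightarrow> sub N \<Longrightarrow> bounded_schain S (ext N G) \<M> \<Longrightarrow>
    (\<And>g. g \<in> G \<Longrightarrow> \<exists>t::nat. \<exists>s\<in>S. \<forall>v\<in>\<M>. s \<bullet> g [^] t \<bullet> v \<in> N) \<Longrightarrow> bounded_schain S N \<M>"
  using G
proof (induction G rule: finite_induct)
  case empty
  then show ?case by (simp add: ext_empty)
next
  case (insert g X)
  let ?E = "ext N X"
  have g: "g \<in> carrier R" and X: "X \<subseteq> carrier R" and E: "sub ?E" using insert.prems by (auto intro!: ext_sub)
  obtain t :: nat and s where st: "s \<in> S" "\<And>v. v \<in> \<M> \<Longrightarrow> s \<bullet> g [^] t \<bullet> v \<in> N" using insert.prems(4)[of g] by auto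
  have sR: "s \<in> carrier R" using S st by (auto simp: mult_set_def)
  have gt: "g [^] t \<in> carrier R" using g by auto
  have Et: "sub (ext ?E {g [^] t})" using ext_sub[OF E] gt by auto
  have "bounded_schain S (ext ?E {g}) \<M>" using insert.prems g X by (simp add: ext_insert_eq(1))
  then have b: "bounded_schain S (ext ?E {g [^] t}) \<M>" by (rule bounded_schain_pow[OF S E g])
  have "bounded_schain S ?E (ext ?E {g [^] t})"
  proof (rule bounded_schain_torsion)
    fix v assume "v \<in> ext ?E {g [^] t}"
    then obtain u where u: "u \<in> \<M>" "congr ?E v (g [^] t \<bullet> u)" using ext_single_iff[OF E gt] by auto
    have "s \<bullet> v \<in> ?E" using congr_memI[OF E congr_smult[OF E sR u(2)]] st(2)[OF u(1)] ext_base[of N X] by auto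
    then show "\<exists>s\<in>S. s \<bullet> v \<in> ?E" using st by auto
  qed
  then have "bounded_schain S ?E \<M>" by (rule bounded_schain_trans[OF S Et ext_base sub_subset[OF Et] _ b])
  then show ?case using insert by auto
qed

end

context fg_noetherian_module
begin

text \<open>A power of each element of P kills M/N locally at P, so by the preceding reduction only
  M/(N + PM) has to be bounded. After localization this is a finite-dimensional space over the
  residue field.\<close>

lemma bounded_schain_prime:
  assumes P: "primeideal P R" and N: "sub N"
    and t: "\<And>g. g \<in> P \<Longrightarrow> \<exists>t::nat. \<exists>s\<in>carrier R - P. \<forall>v\<in>\<M>. s \<bullet> g [^] t \<bullet> v \<in> N"
  shows "bounded_schain (carrier R - P) N \<M>"
proof -
  obtain G where G: "G \<subseteq> carrier R" "finite G" "P = Idl G"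
    using finetely_gen[of P] primeideal.axioms(1)[OF P] by auto
  have "G \<subseteq> P" using G R.genideal_self by auto
  obtain X where X: "finite X" "X \<subseteq> \<M>" "gen_submodule R M X = \<M>"
    using fin_gen unfolding fin_gen_module_def by blast
  have E: "sub (ext N G)" using N G by (intro ext_sub) auto
  have "bounded_schain (carrier R - P) (ext N G) (ext N G +\<^sub>M \<M>)"
    using bounded_schain_gen[OF P E X(1,2)] X(3) Idl_smult_mem[OF E _ G(1)] G(3) ext_prod by auto
  moreover have "ext N G +\<^sub>M \<M> = \<M>"
    using add_le[OF E carrier_is_submodule] sub_subset[OF add_sub[OF E carrier_is_submodule]] by auto
  ultimately show ?thesis
    using bounded_schain_of_torsion[OF mult_set_prime[OF P] G(2,1) N] t \<open>G \<subseteq> P\<close> by auto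
qed

end

section \<open>Prime avoidance and the principal ideal theorem\<close>

locale noetherian_cring = cring R + noetherian_ring R for R (structure)
begin

text \<open>An ideal maximal among those over I that are disjoint from S is prime: enlarging it by a
  or by b meets S, and the product of the two elements found in S lies in the ideal if ab
  does.\<close>

lemma prime_disjoint:
  assumes I: "ideal I R" and S: "S \<subseteq> carrier R" "\<one> \<in> S" "\<And>s t. s \<in> S \<Longrightarrow> t \<in> S \<Longrightarrow> s \<otimes> t \<in> S"
    and IS: "I \<inter> S = {}"
  obtains P where "primeideal P R" "I \<subseteq> P" "P \<inter> S = {}"
proof -
  let ?A = "{J. ideal J R \<and> I \<subseteq> J \<and> J \<inter> S = {}}"
  obtain P where P: "P \<in> ?A" "\<And>J. J \<in> ?A \<Longrightarrow> P \<subseteq> J \<Longrightarrow> J = P"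
    using ideal_maximal_element[of ?A] I IS by blast
  interpret P: ideal P R using P by auto
  have *: "\<exists>s\<in>S. \<exists>p\<in>P. \<exists>r\<in>carrier R. s = p \<oplus> r \<otimes> a" if a: "a \<in> carrier R" "a \<notin> P" for a
  proof -
    note pa = cgenideal_ideal[OF a(1)]
    have "ideal (P <+>\<^bsub>R\<^esub> PIdl a) R" using add_ideals[OF P.is_ideal pa] .
    moreover have "P \<subseteq> P <+>\<^bsub>R\<^esub> PIdl a"
    proof
      fix p assume "p \<in> P"
      moreover have "\<zero> \<in> PIdl a" using additive_subgroup.zero_closed ideal.axioms(1) pa by blast
      ultimately have "p \<oplus> \<zero> \<in> P <+>\<^bsub>R\<^esub> PIdl a" unfolding set_add_def' by blast
      then show "p \<in> P <+>\<^bsub>R\<^esub> PIdl a" using \<open>p \<in> P\<close> P.Icarr by simp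
    qed
    moreover have "a \<in> P <+>\<^bsub>R\<^esub> PIdl a"
    proof -
      have "\<zero> \<oplus> a \<in> P <+>\<^bsub>R\<^esub> PIdl a" using P.zero_closed cgenideal_self[OF a(1)] unfolding set_add_def' by blast
      then show ?thesis using a by simp
    qed
    ultimately have "(P <+>\<^bsub>R\<^esub> PIdl a) \<inter> S \<noteq> {}"
      using P(1) P(2)[of "P <+>\<^bsub>R\<^esub> PIdl a"] a(2) by auto
    then obtain s p r where "s \<in> S" "p \<in> P" "r \<in> carrier R" "s = p \<oplus> r \<otimes> a"
      unfolding set_add_def' cgenideal_def by blast
    then show ?thesis by blast
  qed
  have "primeideal P R"
  proof (rule primeidealI)
    show "carrier R \<noteq> P" using P S by auto
    fix a b assume ab: "a \<in> carrier R" "b \<in> carrier R" "a \<otimes> b \<in> P"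
    show "a \<in> P \<or> b \<in> P"
    proof (rule ccontr)
      assume "\<not> (a \<in> P \<or> b \<in> P)"
      then obtain s p r t q r' where st: "s \<in> S" "p \<in> P" "r \<in> carrier R" "s = p \<oplus> r \<otimes> a"
        "t \<in> S" "q \<in> P" "r' \<in> carrier R" "t = q \<oplus> r' \<otimes> b" using *[of a] *[of b] ab by blast
      have c: "p \<in> carrier R" "q \<in> carrier R" using st P.Icarr by auto
      have "s \<otimes> t = p \<otimes> t \<oplus> ((r \<otimes> a) \<otimes> q \<oplus> (r \<otimes> r') \<otimes> (a \<otimes> b))"
        unfolding st(4,8) using st(3,7) ab(1,2) c by algebra
      moreover have "p \<otimes> t \<in> P" using st(2,5) S(1) P.I_r_closed by auto
      moreover have "(r \<otimes> a) \<otimes> q \<in> P" "(r \<otimes> r') \<otimes> (a \<otimes> b) \<in> P"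
        using st(3,6,7) ab P.I_l_closed by auto
      ultimately have "s \<otimes> t \<in> P" by simp
      then show False using S(3)[OF st(1,5)] P by auto
    qed
  qed (auto intro: is_cring P.is_ideal)
  then show ?thesis using that P by blast
qed

lemma Idl_insert_le_prime:
  assumes "primeideal Q R" "a \<in> carrier R" "I \<subseteq> Q" "a \<in> Q" "ideal I R"
  shows "Idl (insert a I) \<subseteq> Q"
  using assms by (intro genideal_minimal) (auto dest: primeideal.axioms)

text \<open>Such a set contains all minimal primes over I but may contain others; thus covers can be
  combined by plain unions.\<close>

definition prime_cover where
  "prime_cover I F \<longleftrightarrow> finite F \<and> (\<forall>P\<in>F. primeideal P R \<and> I \<subseteq> P) \<and>
    (\<forall>Q. primeideal Q R \<and> I \<subseteq> Q \<longrightarrow> (\<exists>P\<in>F. P \<subseteq> Q))"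

lemma prime_coverD:
  assumes "prime_cover I F"
  shows "finite F" "\<And>P. P \<in> F \<Longrightarrow> primeideal P R" "\<And>P. P \<in> F \<Longrightarrow> I \<subseteq> P"
    "\<And>Q. primeideal Q R \<Longrightarrow> I \<subseteq> Q \<Longrightarrow> \<exists>P\<in>F. P \<subseteq> Q"
  using assms unfolding prime_cover_def by auto

text \<open>Noetherian induction: a maximal counterexample I is not prime, so ab lies in I for some
  a, b outside I, and each prime over I contains I + (a) or I + (b).\<close>

lemma finite_prime_cover:
  assumes "ideal I R"
  obtains F where "prime_cover I F"
proof -
  let ?ok = "\<lambda>I. \<exists>F. prime_cover I F"
  have "?ok I"
  proof (rule ccontr)
    assume "\<not> ?ok I"
    then have ne: "{I. ideal I R \<and> \<not> ?ok I} \<noteq> {}" using assms by blast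
    obtain I where I: "I \<in> {I. ideal I R \<and> \<not> ?ok I}"
      and max: "\<And>J. J \<in> {I. ideal I R \<and> \<not> ?ok I} \<Longrightarrow> I \<subseteq> J \<Longrightarrow> J = I"
      by (rule ideal_maximal_element[OF ne]) auto
    have id: "ideal I R" and nok: "\<not> ?ok I" using I by auto
    have "carrier R \<noteq> I"
    proof
      assume "carrier R = I"
      then have "\<not> (primeideal Q R \<and> I \<subseteq> Q)" for Q
        using primeideal.I_notcarr[of Q R] ideal.Icarr[of Q R] primeideal.axioms(1)[of Q R] by blast
      then have "?ok I" unfolding prime_cover_def by (intro exI[of _ "{}"]) auto
      then show False using nok by simp
    qed
    have "\<not> primeideal I R"
    proof
      assume "primeideal I R"
      then have "?ok I" unfolding prime_cover_def by (intro exI[of _ "{I}"]) auto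
      then show False using nok by simp
    qed
    then obtain a b where ab: "a \<in> carrier R" "b \<in> carrier R" "a \<otimes> b \<in> I" "a \<notin> I" "b \<notin> I"
      using primeidealI[OF id is_cring \<open>carrier R \<noteq> I\<close>] by blast
    have Ic: "I \<subseteq> carrier R" using ideal.Icarr[OF id] by auto
    have ok: "?ok (Idl (insert c I)) \<and> I \<subseteq> Idl (insert c I)" if c: "c \<in> carrier R" "c \<notin> I" for c
    proof -
      have "insert c I \<subseteq> Idl (insert c I)" using c Ic by (intro genideal_self) auto
      moreover have "ideal (Idl (insert c I)) R" using c Ic by (intro genideal_ideal) auto
      ultimately show ?thesis using max[of "Idl (insert c I)"] c by blast
    qed
    obtain F G where FG: "prime_cover (Idl (insert a I)) F" "prime_cover (Idl (insert b I)) G"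
      using ok[OF ab(1,4)] ok[OF ab(2,5)] by auto
    note F = prime_coverD[OF FG(1)] and G = prime_coverD[OF FG(2)]
    have "prime_cover I (F \<union> G)"
      unfolding prime_cover_def
    proof (intro conjI ballI allI impI)
      fix P assume "P \<in> F \<union> G"
      then show "primeideal P R" "I \<subseteq> P" using F(2,3)[of P] G(2,3)[of P] ok[OF ab(1,4)] ok[OF ab(2,5)] by auto
    next
      fix Q assume Q: "primeideal Q R \<and> I \<subseteq> Q"
      then have "a \<in> Q \<or> b \<in> Q" using primeideal.I_prime[of Q R a b] ab by auto
      then show "\<exists>P\<in>F \<union> G. P \<subseteq> Q"
      proof
        assume "a \<in> Q"
        then have "Idl (insert a I) \<subseteq> Q" using Idl_insert_le_prime[of Q a I] Q ab(1) id by simp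
        then show ?thesis using F(4)[of Q] Q by blast
      next
        assume "b \<in> Q"
        then have "Idl (insert b I) \<subseteq> Q" using Idl_insert_le_prime[of Q b I] Q ab(2) id by simp
        then show ?thesis using G(4)[of Q] Q by blast
      qed
    qed (use F G in auto)
    then show False using nok by blast
  qed
  then show ?thesis using that by blast
qed

lemma exists_mem_Inter_notin_prime:
  assumes "finite F" "primeideal P R" "\<And>Q. Q \<in> F \<Longrightarrow> ideal Q R \<and> \<not> Q \<subseteq> P"
  shows "\<exists>a\<in>carrier R. a \<notin> P \<and> (\<forall>Q\<in>F. a \<in> Q)"
  using assms(1,3)
proof (induction F rule: finite_induct)
  case empty
  have "\<one> \<notin> P" using ideal.one_imp_carrier[of P R] primeideal.axioms(1)[OF assms(2)] primeideal.I_notcarr[OF assms(2)] by blast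
  then show ?case by auto
next
  case (insert Q F)
  then obtain a where a: "a \<in> carrier R" "a \<notin> P" "\<forall>Q\<in>F. a \<in> Q" by auto
  obtain q where q: "q \<in> Q" "q \<notin> P" using insert.prems[of Q] by auto
  have qR: "q \<in> carrier R" using q insert.prems[of Q] ideal.Icarr[of Q R q] by auto
  have "a \<otimes> q \<notin> P" using primeideal.I_prime[OF assms(2) a(1) qR] a q by auto
  moreover have "a \<otimes> q \<in> Q" using ideal.I_l_closed[of Q R q a] insert.prems[of Q] q a by auto
  moreover have "a \<otimes> q \<in> Q'" if "Q' \<in> F" for Q'
    using ideal.I_r_closed[of Q' R a q] insert.prems[of Q'] that a qR by auto
  ultimately show ?case using a qR by (intro bexI[of _ "a \<otimes> q"]) auto
qed

lemma prime_avoidance: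
  assumes J: "ideal J R"
  shows "finite F \<Longrightarrow> (\<And>P. P \<in> F \<Longrightarrow> primeideal P R \<and> \<not> J \<subseteq> P) \<Longrightarrow> \<exists>z\<in>J. \<forall>P\<in>F. z \<notin> P"
proof (induction F rule: finite_psubset_induct)
  case (psubset F)
  have id: "ideal P R" if "P \<in> F" for P using psubset.prems[OF that] primeideal.axioms(1) by blast
  consider "F = {}" | P Q where "P \<in> F" "Q \<in> F" "P \<noteq> Q" "P \<subseteq> Q"
    | P where "P \<in> F" "\<And>Q. Q \<in> F \<Longrightarrow> Q \<noteq> P \<Longrightarrow> \<not> Q \<subseteq> P" by blast
  then show ?case
  proof cases
    case 1
    then show ?thesis using additive_subgroup.zero_closed[OF ideal.axioms(1)[OF J]] by auto
  next
    case 2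
    then obtain z where "z \<in> J" "\<forall>P\<in>F - {P}. z \<notin> P" using psubset.IH[of "F - {P}"] psubset.prems by blast
    then show ?thesis using 2 by (intro bexI[of _ z]) auto
  next
    case 3
    then have P: "primeideal P R" "\<not> J \<subseteq> P" using psubset.prems by auto
    obtain z where z: "z \<in> J" "\<And>Q. Q \<in> F - {P} \<Longrightarrow> z \<notin> Q" using psubset.IH[of "F - {P}"] psubset.prems 3 by blast
    show ?thesis
    proof (cases "z \<in> P")
      case True
      obtain a where a: "a \<in> carrier R" "a \<notin> P" "\<And>Q. Q \<in> F - {P} \<Longrightarrow> a \<in> Q"
        using exists_mem_Inter_notin_prime[of "F - {P}" P] psubset.hyps P 3 id by auto
      obtain j where j: "j \<in> J" "j \<notin> P" using P by auto
      interpret J: ideal J R by fact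
      have jR: "j \<in> carrier R" and zR: "z \<in> carrier R" using j z J.Icarr by auto
      have w: "j \<otimes> a \<in> J" "j \<otimes> a \<notin> P" using j a J.I_r_closed primeideal.I_prime[OF P(1) jR a(1)] by auto
      have cancel: "p \<in> Q" if "ideal Q R" "p \<oplus> q \<in> Q" "q \<in> Q" "p \<in> carrier R" for p q Q
      proof -
        interpret Q: ideal Q R by fact
        have "(p \<oplus> q) \<oplus> \<ominus> q \<in> Q" using that by auto
        then show ?thesis using that Q.Icarr by (simp add: a_assoc r_neg)
      qed
      have "z \<oplus> j \<otimes> a \<in> J" using w z by auto
      moreover have "z \<oplus> j \<otimes> a \<notin> P"
        using cancel[OF id[OF 3(1)], of "j \<otimes> a" z] w True jR zR a a_comm[of z "j \<otimes> a"] by auto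
      moreover have "z \<oplus> j \<otimes> a \<notin> Q" if Q: "Q \<in> F - {P}" for Q
        using cancel[of Q z "j \<otimes> a"] id[of Q] z(2)[OF Q] zR Q ideal.I_l_closed[of Q R a j] a(3)[OF Q] jR by auto
      ultimately show ?thesis by blast
    qed (use z in blast)
  qed
qed

end

section \<open>The ring as a module over itself\<close>

definition ring_module :: "('a, 'r) ring_scheme \<Rightarrow> ('a, 'a) module" where
  "ring_module R = \<lparr>carrier = carrier R, mult = mult R, one = one R, zero = zero R, add = add R, smult = mult R\<rparr>"

lemma ring_module_simps [simp]:
  "carrier (ring_module R) = carrier R" "zero (ring_module R) = zero R" "add (ring_module R) = add R"
  "smult (ring_module R) = mult R"
  by (simp_all add: ring_module_def)

lemma (in cring) ring_module_module: "module R (ring_module R)"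
proof (rule moduleI)
  show "abelian_group (ring_module R)"
    by (rule abelian_groupI) (auto simp: a_ac intro: bexI[of _ "\<ominus> _"] l_neg)
qed (auto simp: is_cring l_distr r_distr m_assoc)

text \<open>Ideals become submodules, so that colons, chains and Artin-Rees are available for ideals
  over a fixed prime.\<close>

lemma (in cring) submodule_ring_module_iff: "submodule I R (ring_module R) \<longleftrightarrow> ideal I R"
proof -
  interpret RM: module R "ring_module R" by (rule ring_module_module)
  have n: "\<ominus>\<^bsub>ring_module R\<^esub> a = \<ominus> a" if "a \<in> carrier R" for a
    using that RM.M.minus_equality[of "\<ominus> a" a] by (auto simp: l_neg)
  show ?thesis
  proof
    assume I: "submodule I R (ring_module R)"
    note D = RM.subD[OF I]
    show "ideal I R"
    proof (rule idealI[OF ring_axioms])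
      show "subgroup I (add_monoid R)" using D n by (intro add.subgroupI) auto
      fix a x assume a: "a \<in> I" "x \<in> carrier R"
      then show "x \<otimes> a \<in> I" using D by auto
      then show "a \<otimes> x \<in> I" using a D m_comm by auto
    qed
  next
    assume "ideal I R"
    then interpret I: ideal I R .
    show "submodule I R (ring_module R)"
      using I.a_subset n I.I_l_closed by (intro RM.submoduleI) auto
  qed
qed

context module
begin

text \<open>Multiplication by u embeds M/(B : u) into M/B, so chains above \<open>colon B u\<close>
  are carried to chains above B without losing strictness.\<close>

lemma schain_push:
  assumes B: "sub B" and u: "u \<in> carrier R" and S: "S \<subseteq> carrier R"
  shows "schain S k A \<M> \<Longrightarrow> colon B u \<subseteq> A \<Longrightarrow> schain S k (B +\<^sub>M ((\<lambda>v. u \<bullet> v) ` A)) (ext B {u})"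
proof (induction k arbitrary: A)
  case 0
  then have A: "sub A" by auto
  have "B +\<^sub>M ((\<lambda>v. u \<bullet> v) ` A) \<subseteq> ext B {u}"
    using B u sub_carr[OF A] ext_prod[of u "{u}" _ B] by (intro add_least ext_sub ext_base) auto
  then show ?case using A B u by (auto intro: add_sub times_sub ext_sub)
next
  case (Suc k)
  then obtain J where J: "sub A" "sstep S A J" "schain S k J \<M>" by auto
  have J2: "sub J" "A \<subseteq> J" using J schain_sub by (auto simp: sstep_def)
  obtain b where b: "b \<in> J" "\<And>s. s \<in> S \<Longrightarrow> s \<bullet> b \<notin> A" using J by (auto simp: sstep_def)
  note tA = times_sub[OF u J(1)] and tJ = times_sub[OF u J2(1)]
  have "s \<bullet> u \<bullet> b \<notin> B +\<^sub>M ((\<lambda>v. u \<bullet> v) ` A)" if s: "s \<in> S" for s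
  proof
    assume "s \<bullet> u \<bullet> b \<in> B +\<^sub>M ((\<lambda>v. u \<bullet> v) ` A)"
    then obtain a where a: "a \<in> A" "congr B (s \<bullet> u \<bullet> b) (u \<bullet> a)" using add_mem_iff[OF B tA] by auto
    have c: "s \<in> carrier R" "b \<in> \<M>" "a \<in> \<M>" using s S b a sub_carr J J2 by auto
    then have "s \<bullet> u \<bullet> b = u \<bullet> s \<bullet> b" using u by (intro smult_comm) auto
    then have "u \<bullet> (s \<bullet> b \<ominus>\<^sub>M a) \<in> B" using a(2) c u by (simp add: congr_def smult_minus_distr)
    then have "congr A (s \<bullet> b) a" using Suc.prems(2) c by (auto simp: congr_def colon_def)
    then show False using congr_memI[OF J(1)] a b(2)[OF s] by blast
  qed
  moreover have "u \<bullet> b \<in> B +\<^sub>M ((\<lambda>v. u \<bullet> v) ` J)" using add_le(2)[OF B tJ] b by auto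
  moreover have "B +\<^sub>M ((\<lambda>v. u \<bullet> v) ` A) \<subseteq> B +\<^sub>M ((\<lambda>v. u \<bullet> v) ` J)"
    using add_le[OF B tJ] J2 by (intro add_least add_sub B tJ) auto
  ultimately have "sstep S (B +\<^sub>M ((\<lambda>v. u \<bullet> v) ` A)) (B +\<^sub>M ((\<lambda>v. u \<bullet> v) ` J))"
    unfolding sstep_def by (intro conjI bexI[of _ "u \<bullet> b"]) auto
  moreover have "schain S k (B +\<^sub>M ((\<lambda>v. u \<bullet> v) ` J)) (ext B {u})" using Suc.IH[OF J(3)] Suc.prems J2 by auto
  ultimately show ?case using add_sub[OF B tA] by auto
qed

end

context noetherian_cring
begin

lemma ring_module_fg: "fg_noetherian_module R (ring_module R)"
proof -
  interpret RM: module R "ring_module R" by (rule ring_module_module)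
  have "gen_submodule R (ring_module R) {\<one>} = carrier R"
  proof
    have s: "submodule (gen_submodule R (ring_module R) {\<one>}) R (ring_module R)" by (intro RM.gen_sub) auto
    show "gen_submodule R (ring_module R) {\<one>} \<subseteq> carrier R" using RM.sub_subset[OF s] by simp
    show "carrier R \<subseteq> gen_submodule R (ring_module R) {\<one>}"
      using RM.sub_smult[OF s, of _ \<one>] RM.gen_self[of "{\<one>}"] by auto
  qed
  then have "fin_gen_module R (ring_module R)" unfolding fin_gen_module_def by (intro exI[of _ "{\<one>}"]) auto
  then show ?thesis
    by (intro fg_noetherian_module.intro fg_noetherian_module_axioms.intro ring_module_module noetherian_ring_axioms)
qed

text \<open>With \<open>D = R/P\<^sub>0\<close> localized at \<open>P\<^sub>2\<close> and \<open>f n\<close> the length of \<open>D/x\<^sup>nD\<close>, a failure would make \<open>f\<close> finite.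
  Then \<open>f (c + n) \<le> f c + f n\<close>, whereas multiplication by \<open>u \<in> P\<^sub>1 - P\<^sub>0\<close> and Artin-Rees give
  \<open>f (c + n) \<ge> f n + (c + n)\<close>, as \<open>x\<close> is not nilpotent modulo \<open>u\<close>.\<close>

lemma prime_between:
  assumes P0: "primeideal P0 R" and P1: "primeideal P1 R" and P2: "primeideal P2 R"
    and lt: "P0 \<subset> P1" "P1 \<subset> P2" and x: "x \<in> P2"
  shows "\<exists>P. primeideal P R \<and> P0 \<subset> P \<and> P \<subset> P2 \<and> x \<in> P"
proof (rule ccontr)
  assume none: "\<not> ?thesis"
  interpret P0: primeideal P0 R by fact
  interpret P1: primeideal P1 R by fact
  interpret P2: primeideal P2 R by fact
  interpret RM: fg_noetherian_module R "ring_module R" by (rule ring_module_fg)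
  have xR: "x \<in> carrier R" using x P2.Icarr by auto
  have x1: "x \<notin> P1" using none P1 lt by blast
  obtain u where u: "u \<in> P1" "u \<notin> P0" using lt by auto
  have uR: "u \<in> carrier R" using u P1.Icarr by auto
  define S where "S = carrier R - P2"
  have "RM.mult_set S" unfolding S_def by (rule RM.mult_set_prime[OF P2])
  then have S: "S \<subseteq> carrier R" "\<one> \<in> S" "\<And>s t. s \<in> S \<Longrightarrow> t \<in> S \<Longrightarrow> s \<otimes> t \<in> S" by (auto simp: RM.mult_set_def)
  have Spow: "s [^] (n::nat) \<in> S" if "s \<in> S" for s n using that S by (induction n) auto
  have sP0: "RM.sub P0" using submodule_ring_module_iff P0.is_ideal by auto
  define I where "I n = RM.ext P0 {x [^] (n::nat)}" for n
  have I: "RM.sub (I n)" for n unfolding I_def using xR by (intro RM.ext_sub sP0) auto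
  have Iid: "ideal (I n) R" for n using I submodule_ring_module_iff by auto
  \<comment> \<open>Otherwise some prime over P0 + (x) inside P2 avoids g and would be the excluded
    intermediate prime; it differs from P0 because x is not in P1.\<close>
  have m_torsion: "\<exists>t::nat. \<exists>s\<in>S. s \<otimes> g [^] t \<in> I 1" if g: "g \<in> P2" for g
  proof (rule ccontr)
    assume c: "\<not> ?thesis"
    have gR: "g \<in> carrier R" using g P2.Icarr by auto
    let ?T = "{s \<otimes> g [^] (t::nat) |s t. s \<in> S}"
    have T1: "s \<in> ?T" if "s \<in> S" for s
    proof -
      have "s = s \<otimes> g [^] (0::nat)" using that S by auto
      then show ?thesis using that by blast
    qed
    have gT: "g \<in> ?T"
    proof -
      have "g = \<one> \<otimes> g [^] (1::nat)" using gR by auto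
      then show ?thesis using S by blast
    qed
    obtain P where P: "primeideal P R" "I 1 \<subseteq> P" "P \<inter> ?T = {}"
    proof (rule prime_disjoint[OF Iid[of 1], of ?T])
      show "?T \<subseteq> carrier R" using S gR by auto
      show "\<one> \<in> ?T" using T1 S by auto
      fix a b assume "a \<in> ?T" "b \<in> ?T"
      then obtain s t s' t' where ab: "a = s \<otimes> g [^] (t::nat)" "s \<in> S" "b = s' \<otimes> g [^] (t'::nat)" "s' \<in> S" by blast
      have c: "s \<in> carrier R" "s' \<in> carrier R" "g [^] t \<in> carrier R" "g [^] t' \<in> carrier R" using ab S gR by auto
      have "a \<otimes> b = (s \<otimes> s') \<otimes> g [^] (t + t')"
        unfolding ab(1,3) nat_pow_mult[OF gR, symmetric] using c by (simp add: m_ac)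
      then show "a \<otimes> b \<in> ?T" using S(3)[OF ab(2,4)] by blast
    next
      show "I 1 \<inter> ?T = {}" using c by blast
    qed
    have "P \<subseteq> P2" using P(3) T1 ideal.Icarr[OF primeideal.axioms(1)[OF P(1)]] unfolding S_def by blast
    moreover have "g \<notin> P" using P(3) gT by blast
    moreover have "P0 \<subseteq> P" using P(2) RM.ext_base unfolding I_def by blast
    moreover have "x \<in> P" using P(2) RM.ext_prod[of x "{x}" \<one> P0] xR unfolding I_def by auto
    moreover have "x \<notin> P0" using x1 lt by auto
    ultimately show False using none P(1) g by blast
  qed
  have bd: "RM.bounded_schain S (I n) (carrier R)" for n
  proof -
    have "RM.bounded_schain (carrier R - P2) (I n) (carrier (ring_module R))"
    proof (rule RM.bounded_schain_prime[OF P2 I])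
      fix g assume g: "g \<in> P2"
      then obtain t :: nat and s where s: "s \<in> S" "s \<otimes> g [^] t \<in> I 1" using m_torsion by blast
      have c: "s \<in> carrier R" "g \<in> carrier R" using s S g P2.Icarr by auto
      have *: "(s \<otimes> g [^] t) [^] n \<otimes> v \<in> I n" if v: "v \<in> carrier R" for v
        unfolding I_def
        using RM.pow_multiple[OF sP0 xR, of "s \<otimes> g [^] t" v n] ideal.I_r_closed[OF Iid[of 1] s(2)] c v xR
        by (simp add: I_def)
      have "(s \<otimes> g [^] t) [^] n = s [^] n \<otimes> g [^] (t * n)" using c by (simp add: nat_pow_distrib nat_pow_pow)
      then have "s [^] n \<otimes> (g [^] (t * n) \<otimes> v) \<in> I n" if "v \<in> carrier R" for v
        using *[OF that] c that by (simp add: m_assoc)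
      moreover have "s [^] n \<in> carrier R - P2" using Spow[OF s(1)] unfolding S_def .
      ultimately show "\<exists>t::nat. \<exists>s\<in>carrier R - P2. \<forall>v\<in>carrier (ring_module R).
        s \<odot>\<^bsub>ring_module R\<^esub> (g [^] t \<odot>\<^bsub>ring_module R\<^esub> v) \<in> I n"
        by (intro exI[of _ "t * n"] bexI[of _ "s [^] n"]) auto
    qed
    then show ?thesis by (simp add: S_def)
  qed
  \<comment> \<open>As P0 is prime, u is a nonzerodivisor modulo P0; Artin-Rees therefore puts
    (x^(c+k)) : u into (x^k) there.\<close>
  have col: "RM.colon P0 u = P0"
  proof
    show "RM.colon P0 u \<subseteq> P0" using P0.I_prime[OF uR] u(2) unfolding RM.colon_def by auto
    show "P0 \<subseteq> RM.colon P0 u" using uR P0.I_l_closed P0.Icarr by (auto simp: RM.colon_def)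
  qed
  obtain c :: nat where c: "\<And>k. RM.colon (RM.ext P0 {x [^] (c + k)}) u \<subseteq> RM.ext (RM.colon P0 u) {x [^] (k::nat)}"
    using RM.artin_rees[OF sP0 uR xR] by blast
  have col2: "RM.colon (I (c + k)) u \<subseteq> I k" for k using c[of k] col by (simp add: I_def)
  obtain b where b: "\<And>k. RM.schain S k (I c) (carrier R) \<Longrightarrow> k \<le> b" using bd[of c] by (auto simp: RM.bounded_schain_def)
  \<comment> \<open>One more than the length bound b above \<open>I c\<close>, so that N + (c + n)
    cannot be at most b + N.\<close>
  define n where "n = Suc b"
  obtain bn where bn: "\<And>k. RM.schain S k (I n) (carrier R) \<Longrightarrow> k \<le> bn" using bd[of n] by (auto simp: RM.bounded_schain_def)
  have I_carr: "I k \<subseteq> carrier R" for k using RM.sub_subset[OF I] by simp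
  have carr: "RM.sub (carrier R)" using RM.carrier_is_submodule by simp
  have ch0: "RM.schain S 0 (I n) (carrier R)" using I I_carr carr by auto
  define N where "N = Max {k. RM.schain S k (I n) (carrier R)}"
  have fin: "finite {k. RM.schain S k (I n) (carrier R)}" unfolding finite_nat_set_iff_bounded_le using bn by blast
  have N: "RM.schain S N (I n) (carrier R)" 
  proof -
    have "N \<in> {k. RM.schain S k (I n) (carrier R)}" unfolding N_def by (rule Max_in[OF fin]) (use ch0 in blast)
    then show ?thesis by blast
  qed
  have Nmax: "k \<le> N" if "RM.schain S k (I n) (carrier R)" for k using Max_ge[OF fin, of k] that unfolding N_def by auto
  have eu: "RM.ext (I k) {u} = RM.ext (RM.ext P0 {u}) {x [^] k}" for k
    unfolding I_def using sP0 xR uR by (simp add: RM.ext_ext Un_commute insert_commute)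
  have sPu: "RM.sub (RM.ext P0 {u})" using uR sP0 by (intro RM.ext_sub) auto
  have Pu: "RM.ext P0 {u} \<subseteq> P1"
    using lt u P1.is_ideal submodule_ring_module_iff P1.I_r_closed by (intro RM.ext_least) auto
  \<comment> \<open>The ideals P0 + (u, x^k) descend strictly: if s x^k = x^(k+1) r modulo P1, then
    s - xr is in P1 because x^k is not, and s would lie in P2.\<close>
  have up: "RM.schain S k (RM.ext (I k) {u}) (carrier R)" for k
    unfolding eu
  proof (induction k)
    case 0
    have "RM.sub (RM.ext (RM.ext P0 {u}) {\<one>})" by (intro RM.ext_sub sPu) auto
    then show ?case using carr RM.sub_subset by auto
  next
    case (Suc k)
    let ?A = "\<lambda>k::nat. RM.ext (RM.ext P0 {u}) {x [^] k}"
    have s: "RM.sub (?A (Suc k))" using xR by (intro RM.ext_sub sPu) auto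
    have xk: "x [^] k \<in> ?A k" using RM.ext_prod[of "x [^] k" "{x [^] k}" \<one> "RM.ext P0 {u}"] xR by auto
    have "s \<otimes> x [^] k \<notin> ?A (Suc k)" if sS: "s \<in> S" for s
    proof
      assume "s \<otimes> x [^] k \<in> ?A (Suc k)"
      then obtain r where r: "r \<in> carrier R" "RM.congr (RM.ext P0 {u}) (s \<otimes> x [^] k) (x [^] Suc k \<otimes> r)"
        using RM.ext_single_iff[OF sPu] xR by (auto simp del: nat_pow_Suc)
      have sR: "s \<in> carrier R" using sS S by auto
      have "RM.congr P1 (x [^] k \<otimes> s) (x [^] k \<otimes> (x \<otimes> r))"
        using RM.congr_mono[OF r(2) Pu] sR xR r(1) by (simp add: m_comm[of s] m_assoc)
      then have "x [^] k \<otimes> (s \<ominus>\<^bsub>ring_module R\<^esub> x \<otimes> r) \<in> P1"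
        using RM.smult_minus_distr[of "x [^] k" s "x \<otimes> r"] sR xR r by (simp add: RM.congr_def)
      moreover have "s \<ominus>\<^bsub>ring_module R\<^esub> x \<otimes> r \<in> carrier R" using RM.M.minus_closed[of s "x \<otimes> r"] sR xR r by simp
      moreover have "x [^] k \<notin> P1" using x1 xR
      proof (induction k)
        case 0 then show ?case using P1.one_imp_carrier P1.I_notcarr by auto
      next
        case (Suc k) then show ?case using P1.I_prime[of "x [^] k" x] by auto
      qed
      ultimately have "s \<ominus>\<^bsub>ring_module R\<^esub> x \<otimes> r \<in> P1" using P1.I_prime[of "x [^] k" "s \<ominus>\<^bsub>ring_module R\<^esub> x \<otimes> r"] nat_pow_closed[OF xR, of k] by blast
      then have "RM.congr P2 s (x \<otimes> r)" using lt sR xR r by (auto simp: RM.congr_def)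
      moreover have "x \<otimes> r \<in> P2" using x r P2.I_r_closed by auto
      ultimately have "s \<in> P2" using RM.congr_memI[of P2 s] submodule_ring_module_iff P2.is_ideal by blast
      then show False using sS by (auto simp: S_def)
    qed
    moreover have "?A (Suc k) \<subseteq> ?A k" using xR by (intro RM.ext_pow_le sPu) auto
    ultimately have "RM.sstep S (?A (Suc k)) (?A k)" unfolding RM.sstep_def using xk by (intro conjI bexI[of _ "x [^] k"]) auto
    then show ?case using Suc s by auto
  qed
  \<comment> \<open>A longest chain above \<open>I n\<close>, multiplied by u, fits between
    \<open>I (c + n)\<close> and its sum with (u); \<open>up\<close> adds another c + n steps
    above.\<close>
  have "RM.schain S N (I (c + n)) (RM.ext (I (c + n)) {u})"
  proof (rule RM.schain_mono)
    show "RM.schain S N (I (c + n) <+>\<^bsub>ring_module R\<^esub> ((\<lambda>v. u \<odot>\<^bsub>ring_module R\<^esub> v) ` I n)) (RM.ext (I (c + n)) {u})"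
      using RM.schain_push[OF I uR S(1) _ col2] N by simp
    show "I (c + n) \<subseteq> I (c + n) <+>\<^bsub>ring_module R\<^esub> ((\<lambda>v. u \<odot>\<^bsub>ring_module R\<^esub> v) ` I n)"
      by (rule RM.add_le[OF I RM.times_sub[OF uR I]])
  qed (rule I)
  then have big: "RM.schain S (N + (c + n)) (I (c + n)) (carrier R)" by (rule RM.schain_append[OF _ up])
  have le: "I (c + n) \<subseteq> I n" unfolding I_def using xR by (intro RM.ext_pow_le sP0) auto
  obtain i j where ij: "i + j = N + (c + n)" "RM.schain S i (I (c + n) \<inter> I n) (I n)"
    "RM.schain S j (I (c + n) <+>\<^bsub>ring_module R\<^esub> I n) (carrier R)"
    using RM.schain_split[OF I I_carr S(1,3) big] by blast
  have "j \<le> N" using RM.schain_mono[OF ij(3) I RM.add_le(2)[OF I I]] by (rule Nmax)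
  moreover have "i \<le> b"
  proof -
    have e: "I (c + n) \<inter> I n = I (c + n)" using le by auto
    \<comment> \<open>Multiplication by x^n maps R/I(c) onto I(n)/I(c+n), so the bound b for the
      former also bounds i.\<close>
    have "RM.schain S i (RM.colon (I (c + n)) (x [^] n)) (carrier R)"
      using RM.schain_pullback[OF sP0, of "x [^] n" S i "I (c + n)"] ij(2) e S(1) xR RM.ext_base unfolding I_def by auto
    moreover have "I c \<subseteq> RM.colon (I (c + n)) (x [^] n)"
      unfolding I_def
    proof (rule RM.ext_least)
      show "RM.sub (RM.colon (RM.ext P0 {x [^] (c + n)}) (x [^] n))" using I xR unfolding I_def by (intro RM.colon_sub) auto
      show "P0 \<subseteq> RM.colon (RM.ext P0 {x [^] (c + n)}) (x [^] n)"
        using P0.Icarr P0.I_l_closed[of _ "x [^] n"] xR RM.ext_base[of P0] by (auto simp: RM.colon_def)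
      fix y v assume y: "y \<in> {x [^] c}" "v \<in> carrier (ring_module R)"
      have "x [^] n \<otimes> (x [^] c \<otimes> v) = x [^] (c + n) \<otimes> v"
        using y xR RM.pow_add_smult[of x v n c] by (simp add: add.commute)
      then show "y \<odot>\<^bsub>ring_module R\<^esub> v \<in> RM.colon (RM.ext P0 {x [^] (c + n)}) (x [^] n)"
        using y xR RM.ext_prod[of "x [^] (c + n)" "{x [^] (c + n)}" v P0] by (auto simp: RM.colon_def)
    qed
    ultimately show ?thesis using RM.schain_mono[OF _ I] b by blast
  qed
  ultimately show False using ij(1) by (simp add: n_def)
qed

section \<open>Chains of primes and Krull's height theorem\<close>

primrec prime_chain where
  "prime_chain 0 P Q \<longleftrightarrow> primeideal P R \<and> P = Q"
| "prime_chain (Suc k) P Q \<longleftrightarrow> primeideal P R \<and> (\<exists>P'. P \<subset> P' \<and> prime_chain k P' Q)"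

lemma prime_chain_prime: "prime_chain k P Q \<Longrightarrow> primeideal P R \<and> primeideal Q R \<and> P \<subseteq> Q"
proof (induction k arbitrary: P)
  case (Suc k)
  then obtain P' where "primeideal P R" "P \<subset> P'" "prime_chain k P' Q" by auto
  then show ?case using Suc.IH[of P'] by blast
qed simp

lemma prime_chain_snoc: "prime_chain k P Q \<Longrightarrow> Q \<subset> Q' \<Longrightarrow> primeideal Q' R \<Longrightarrow> prime_chain (Suc k) P Q'"
proof (induction k arbitrary: P)
  case (Suc k)
  then obtain P' where "primeideal P R" "P \<subset> P'" "prime_chain k P' Q" by auto
  then show ?case using Suc.IH[of P'] Suc.prems unfolding prime_chain.simps(2)[of "Suc k"] by blast
qed auto

text \<open>\<open>prime_between\<close> pushes x down the chain from Q, one prime at a time. Only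
  the bottom P may be left without x, which costs one step.\<close>

lemma prime_chain_lower: "prime_chain (Suc k) P Q \<Longrightarrow> x \<in> Q \<Longrightarrow> \<exists>P'. P \<subset> P' \<and> x \<in> P' \<and> prime_chain k P' Q"
proof (induction k arbitrary: P)
  case 0
  then show ?case by auto
next
  case (Suc k)
  then obtain P1 where P1: "primeideal P R" "P \<subset> P1" "prime_chain (Suc k) P1 Q" by auto
  obtain P2 where P2: "P1 \<subset> P2" "x \<in> P2" "prime_chain k P2 Q" using Suc.IH[OF P1(3) Suc.prems(2)] by blast
  obtain P' where "primeideal P' R" "P \<subset> P'" "P' \<subset> P2" "x \<in> P'"
    using prime_between[OF P1(1) _ _ P1(2) P2(1,2)] prime_chain_prime[OF P1(3)] prime_chain_prime[OF P2(3)] by blast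
  then have "prime_chain (Suc k) P' Q" using P2(3) by auto
  then show ?case using \<open>P \<subset> P'\<close> \<open>x \<in> P'\<close> by blast
qed

text \<open>Krull's height theorem: by \<open>prime_chain_lower\<close> each generator costs at most
  one step. G0 collects the generators already absorbed by the bottom prime, while minimality of Q
  refers to all generators together.\<close>

lemma height_bound:
  "prime_chain k P Q \<Longrightarrow> G0 \<subseteq> P \<Longrightarrow> set gs \<subseteq> Q \<Longrightarrow>
    (\<And>P'. primeideal P' R \<Longrightarrow> G0 \<union> set gs \<subseteq> P' \<Longrightarrow> P' \<subseteq> Q \<Longrightarrow> P' = Q) \<Longrightarrow> k \<le> length gs"
proof (induction gs arbitrary: k P G0)
  case Nil
  have "P = Q" using prime_chain_prime[OF Nil(1)] Nil by auto
  then have "k = 0" using Nil(1) by (cases k) (auto dest: prime_chain_prime)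
  then show ?case by simp
next
  case (Cons g gs)
  show ?case
  proof (cases k)
    case (Suc j)
    obtain P' where P': "P \<subset> P'" "g \<in> P'" "prime_chain j P' Q"
      using prime_chain_lower[of j P Q g] Cons.prems(1,3) Suc by auto
    have "j \<le> length gs"
      using P' Cons.prems by (intro Cons.IH[OF P'(3), of "insert g G0"]) auto
    then show ?thesis using Suc by simp
  qed auto
qed

end

sublocale fg_noetherian_module \<subseteq> noetherian_cring R ..

section \<open>Supports, exchange of parameters and finite length\<close>

context module
begin

text \<open>Ann(M/N). For finitely generated M the primes containing it form the support of M/N,
  through which dimension and finite length are expressed.\<close>

definition ann_quot where "ann_quot N = {a \<in> carrier R. \<forall>v\<in>\<M>. a \<bullet> v \<in> N}"

lemma ann_quot_ideal: assumes N: "sub N" shows "ideal (ann_quot N) R"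
proof (rule idealI[OF R.ring_axioms])
  show "subgroup (ann_quot N) (add_monoid R)"
    using N sub_zero[OF N] sub_neg[OF N] sub_add[OF N]
    by (intro R.add.subgroupI) (auto simp: ann_quot_def smult_l_minus smult_l_distr intro!: exI[of _ \<zero>])
  fix a x assume a: "a \<in> ann_quot N" "x \<in> carrier R"
  then show "x \<otimes> a \<in> ann_quot N" using sub_smult[OF N] by (auto simp: ann_quot_def smult_assoc1)
  then show "a \<otimes> x \<in> ann_quot N" using a R.m_comm by (auto simp: ann_quot_def)
qed

lemma ann_quot_mono: "N \<subseteq> K \<Longrightarrow> ann_quot N \<subseteq> ann_quot K"
  by (auto simp: ann_quot_def)

lemma ann_quot_ext_mem: "x \<in> X \<Longrightarrow> x \<in> carrier R \<Longrightarrow> x \<in> ann_quot (ext B X)"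
  by (auto simp: ann_quot_def ext_prod)

end

context fg_noetherian_module
begin

text \<open>The product of the multipliers belonging to finitely many generators of M serves for all
  of M.\<close>

lemma uniform_torsion:
  assumes P: "primeideal P R" and N: "sub N" and t: "\<And>v. v \<in> \<M> \<Longrightarrow> \<exists>s\<in>carrier R - P. s \<bullet> v \<in> N"
  shows "\<exists>s\<in>carrier R - P. \<forall>v\<in>\<M>. s \<bullet> v \<in> N"
proof -
  note S = mult_set_prime[OF P]
  obtain X where X: "finite X" "X \<subseteq> \<M>" "gen_submodule R M X = \<M>"
    using fin_gen unfolding fin_gen_module_def by blast
  have "\<exists>s\<in>carrier R - P. \<forall>x\<in>X. s \<bullet> x \<in> N"
    using X(1,2)
  proof (induction X rule: finite_induct)
    case empty
    then show ?case using S unfolding mult_set_def by auto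
  next
    case (insert x X)
    obtain s where s: "s \<in> carrier R - P" "\<And>x. x \<in> X \<Longrightarrow> s \<bullet> x \<in> N" using insert by auto
    obtain q where q: "q \<in> carrier R - P" "q \<bullet> x \<in> N" using t[of x] insert.prems by auto
    have "(s \<otimes> q) \<bullet> y \<in> N" if "y \<in> insert x X" for y
    proof (cases "y = x")
      case True
      then show ?thesis using s q insert.prems sub_smult[OF N] by (auto simp: smult_assoc1)
    next
      case False
      then have "q \<bullet> s \<bullet> y \<in> N" using s q that sub_smult[OF N] by auto
      then show ?thesis using s q insert.prems that by (auto simp: smult_assoc1 smult_comm[of s q])
    qed
    then show ?case using S s(1) q(1) unfolding mult_set_def by blast
  qed
  then obtain s where s: "s \<in> carrier R - P" "\<And>x. x \<in> X \<Longrightarrow> s \<bullet> x \<in> N" by auto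
  have "\<M> \<subseteq> colon N s" unfolding X(3)[symmetric]
    using s X(2) N by (intro gen_least colon_sub) (auto simp: colon_def)
  then show ?thesis using s(1) unfolding colon_def by blast
qed

text \<open>Nakayama's lemma at P: if a outside P maps M into N + yM, then a^k maps M into N + y^k M
  for all k, and Krull's theorem makes M/N vanish at P.\<close>

lemma ann_quot_ext_le_prime:
  assumes P: "primeideal P R" and N: "sub N" and le: "ann_quot N \<subseteq> P" and y: "y \<in> P"
  shows "ann_quot (ext N {y}) \<subseteq> P"
proof
  fix a assume a: "a \<in> ann_quot (ext N {y})"
  have aR: "a \<in> carrier R" and av: "\<And>v. v \<in> \<M> \<Longrightarrow> a \<bullet> v \<in> ext N {y}" using a by (auto simp: ann_quot_def)
  have yR: "y \<in> carrier R" using y ideal.Icarr[OF primeideal.axioms(1)[OF P]] by auto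
  show "a \<in> P"
  proof (rule ccontr)
    assume na: "a \<notin> P"
    have powers: "a [^] (k::nat) \<in> carrier R - P" for k
    proof (induction k)
      case 0 then show ?case using mult_set_prime[OF P] by (auto simp: mult_set_def)
    next
      case (Suc k) then show ?case using mult_set_prime[OF P] na aR by (auto simp: mult_set_def)
    qed
    have "\<exists>s\<in>carrier R - P. s \<bullet> v \<in> N" if v: "v \<in> \<M>" for v
      using pow_multiple[OF N yR aR av v] powers by (intro krull_saturated[OF P y N v]) blast
    then obtain s where "s \<in> carrier R - P" "\<forall>v\<in>\<M>. s \<bullet> v \<in> N" using uniform_torsion[OF P N] by blast
    then show False using le unfolding ann_quot_def by blast
  qed
qed

end

context local_fg_module
begin

text \<open>Equivalent to \<open>M/N\<close> having finite length.\<close>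

definition m_primary where "m_primary N \<longleftrightarrow> (\<forall>a\<in>\<mm>. \<exists>t::nat. \<forall>v\<in>\<M>. a [^] t \<bullet> v \<in> N)"

lemma m_primary_mono: "m_primary N \<Longrightarrow> N \<subseteq> K \<Longrightarrow> m_primary K"
  unfolding m_primary_def by (meson subsetD)

lemma prime_pow_mem: "primeideal P R \<Longrightarrow> a \<in> carrier R \<Longrightarrow> a [^] (t::nat) \<in> P \<Longrightarrow> a \<in> P"
proof (induction t)
  case 0
  then show ?case using ideal.one_imp_carrier[of P R] primeideal.axioms(1)[of P R] primeideal.I_notcarr[of P R] by auto
next
  case (Suc t)
  then show ?case using primeideal.I_prime[of P R "a [^] t" a] by auto
qed

text \<open>If no power of a kills M/N, some prime over Ann(M/N) avoids them all and so differs from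
  \<mm>. For N = M no prime contains the annihilator and both sides hold.\<close>

lemma m_primary_iff:
  assumes N: "sub N"
  shows "m_primary N \<longleftrightarrow> (\<forall>P. primeideal P R \<longrightarrow> ann_quot N \<subseteq> P \<longrightarrow> P = \<mm>)"
proof (intro iffI allI impI)
  fix P assume m: "m_primary N" and P: "primeideal P R" "ann_quot N \<subseteq> P"
  have "a \<in> P" if a: "a \<in> \<mm>" for a
  proof -
    obtain t :: nat where "\<forall>v\<in>\<M>. a [^] t \<bullet> v \<in> N" using m a by (auto simp: m_primary_def)
    then have "a [^] t \<in> P" using P a m_carr by (auto simp: ann_quot_def)
    then show ?thesis using prime_pow_mem[OF P(1)] a m_carr by blast
  qed
  then show "P = \<mm>" using prime_le_m[OF P(1)] by blast
next
  assume h: "\<forall>P. primeideal P R \<longrightarrow> ann_quot N \<subseteq> P \<longrightarrow> P = \<mm>"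
  show "m_primary N"
    unfolding m_primary_def
  proof (rule ballI, rule ccontr)
    fix a assume a: "a \<in> \<mm>" and c: "\<not> (\<exists>t::nat. \<forall>v\<in>\<M>. a [^] t \<bullet> v \<in> N)"
    have aR: "a \<in> carrier R" using a m_carr by auto
    let ?S = "range (\<lambda>t::nat. a [^] t)"
    obtain P where P: "primeideal P R" "ann_quot N \<subseteq> P" "P \<inter> ?S = {}"
    proof (rule prime_disjoint[OF ann_quot_ideal[OF N], of ?S])
      show "?S \<subseteq> carrier R" using aR by auto
      have "a [^] (0::nat) \<in> ?S" by blast
      then show "\<one> \<in> ?S" by simp
      show "ann_quot N \<inter> ?S = {}" using c by (auto simp: ann_quot_def)
      show "s \<otimes> t \<in> ?S" if st: "s \<in> ?S" "t \<in> ?S" for s t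
        using st aR by (auto simp: R.nat_pow_mult)
    qed
    have "a [^] (1::nat) \<in> ?S" by blast
    then have "a \<in> ?S" using aR by simp
    then show False using h P a by blast
  qed
qed

text \<open>A nonmaximal prime P in the support of M/(N + zM) strictly contains a member P' of the
  cover, since z is not in P'. Then \<open>prime_between\<close> finds a prime strictly between P'
  and \<mm> containing y, against the hypothesis on y.\<close>

lemma m_primary_replace:
  assumes N: "sub N" and y: "y \<in> \<mm>" and my: "m_primary (ext N {y})" and z: "z \<in> \<mm>"
    and F: "prime_cover (ann_quot N) F" and zF: "\<And>P. P \<in> F \<Longrightarrow> P \<noteq> \<mm> \<Longrightarrow> z \<notin> P"
  shows "m_primary (ext N {z})"
proof -
  have c: "y \<in> carrier R" "z \<in> carrier R" using y z m_carr by auto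
  have e: "sub (ext N {y})" "sub (ext N {z})" using c N by (auto intro!: ext_sub)
  note F = prime_coverD[OF F]
  show ?thesis unfolding m_primary_iff[OF e(2)]
  proof (intro allI impI, rule ccontr)
    fix P assume P: "primeideal P R" "ann_quot (ext N {z}) \<subseteq> P" "P \<noteq> \<mm>"
    have NP: "ann_quot N \<subseteq> P" using ann_quot_mono[OF ext_base[of N "{z}"]] P by auto
    have zP: "z \<in> P" using ann_quot_ext_mem[of z "{z}" N] P c by auto
    obtain P' where P': "P' \<in> F" "P' \<subseteq> P" using F(4)[OF P(1) NP] by blast
    have "P' \<noteq> \<mm>" using P' P prime_le_m[OF P(1)] by blast
    then have "P' \<subset> P" using zF[OF P'(1)] zP P' by blast
    moreover have "P \<subset> \<mm>" using P prime_le_m by blast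
    ultimately obtain Q where Q: "primeideal Q R" "P' \<subset> Q" "Q \<subset> \<mm>" "y \<in> Q"
      using prime_between[OF F(2)[OF P'(1)] P(1) prime_m _ _ y] by blast
    have "ann_quot (ext N {y}) \<subseteq> Q" using ann_quot_ext_le_prime[OF Q(1) N _ Q(4)] F(3)[OF P'(1)] Q by blast
    then show False using my Q unfolding m_primary_iff[OF e(1)] by blast
  qed
qed

lemma m_primary_notin_prime:
  assumes N: "sub N" and y: "y \<in> \<mm>" and my: "m_primary (ext N {y})"
    and P: "primeideal P R" "ann_quot N \<subseteq> P" "P \<noteq> \<mm>"
  shows "y \<notin> P"
proof
  assume "y \<in> P"
  then have "ann_quot (ext N {y}) \<subseteq> P" by (rule ann_quot_ext_le_prime[OF P(1) N P(2)])
  moreover have "sub (ext N {y})" using y m_carr N by (intro ext_sub) auto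
  ultimately show False using my P m_primary_iff by blast
qed

lemma exists_notin_primes:
  assumes "finite F" "\<And>P. P \<in> F \<Longrightarrow> primeideal P R"
  obtains z where "z \<in> \<mm>" "\<And>P. P \<in> F \<Longrightarrow> P \<noteq> \<mm> \<Longrightarrow> z \<notin> P"
proof -
  have "\<exists>z\<in>\<mm>. \<forall>P\<in>F - {\<mm>}. z \<notin> P"
  proof (rule prime_avoidance[OF is_ideal])
    fix P assume "P \<in> F - {\<mm>}"
    then show "primeideal P R \<and> \<not> \<mm> \<subseteq> P" using assms(2)[of P] prime_le_m[of P] by blast
  qed (use assms in auto)
  then show ?thesis using that by blast
qed

text \<open>Prime avoidance for the union of two covers; the common z links two sequences in the
  exchange argument.\<close>

lemma exists_m_primary_replacement:
  assumes "sub N1" "y1 \<in> \<mm>" "m_primary (ext N1 {y1})" "sub N2" "y2 \<in> \<mm>" "m_primary (ext N2 {y2})"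
  obtains z where "z \<in> \<mm>" "m_primary (ext N1 {z})" "m_primary (ext N2 {z})"
proof -
  obtain F1 F2 where F: "prime_cover (ann_quot N1) F1" "prime_cover (ann_quot N2) F2"
    using finite_prime_cover ann_quot_ideal assms by metis
  note D = prime_coverD[OF F(1)] prime_coverD[OF F(2)]
  obtain z where z: "z \<in> \<mm>" "\<And>P. P \<in> F1 \<union> F2 \<Longrightarrow> P \<noteq> \<mm> \<Longrightarrow> z \<notin> P"
    using exists_notin_primes[of "F1 \<union> F2"] D(1,2,5,6) by blast
  show ?thesis
    using that[OF z(1) m_primary_replace[OF assms(1-3) z(1) F(1)] m_primary_replace[OF assms(4-6) z(1) F(2)]] z(2) by blast
qed

text \<open>The inequality depth <= dim in terms of chains. The last element y is regular modulo the
  earlier ones, so a product of a power of y with an element s outside P cannot annihilate that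
  quotient: s alone would, and hence lie in P.\<close>

lemma rseq_prime_chain:
  assumes B: "sub B"
  shows "rseq B ys \<Longrightarrow> set ys \<subseteq> \<mm> \<Longrightarrow> primeideal P R \<Longrightarrow> ann_quot (ext B (set ys)) \<subseteq> P \<Longrightarrow>
    \<exists>P0. ann_quot B \<subseteq> P0 \<and> prime_chain (length ys) P0 P"
proof (induction ys arbitrary: P rule: rev_induct)
  case Nil
  then show ?case using B by (auto simp: ext_empty)
next
  case (snoc y ys)
  let ?N = "ext B (set ys)"
  have c: "set ys \<subseteq> carrier R" "y \<in> carrier R" using snoc.prems m_carr by auto
  have N: "sub ?N" using B c by (intro ext_sub) auto
  have e: "ext B (set (ys @ [y])) = ext ?N {y}" using ext_insert_eq(1)[OF B c(2,1)] by simp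
  have r: "rseq B ys" "reg ?N y" using snoc.prems(1) rseq_append[OF B c(1)] by auto
  have yP: "y \<in> P" using ann_quot_ext_mem[of y "{y}" ?N] snoc.prems(4) c e by auto
  interpret P: primeideal P R by fact
  \<comment> \<open>Avoiding this set forces Q to lie in P and to omit y, hence to be strictly
    smaller than P.\<close>
  let ?S = "{s \<otimes> y [^] (t::nat) |s t. s \<in> carrier R - P}"
  have mS: "mult_set (carrier R - P)" by (rule mult_set_prime[OF P.primeideal])
  have S1: "s \<in> ?S" if "s \<in> carrier R - P" for s
  proof -
    have "s = s \<otimes> y [^] (0::nat)" using that by auto
    then show ?thesis using that by blast
  qed
  have yS: "y \<in> ?S"
  proof -
    have "y = \<one> \<otimes> y [^] (1::nat)" using c by auto
    then show ?thesis using mS unfolding mult_set_def by blast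
  qed
  obtain Q where Q: "primeideal Q R" "ann_quot ?N \<subseteq> Q" "Q \<inter> ?S = {}"
  proof (rule prime_disjoint[OF ann_quot_ideal[OF N], of ?S])
    show "?S \<subseteq> carrier R" using c by auto
    show "\<one> \<in> ?S" using S1 mS unfolding mult_set_def by blast
    fix a b assume "a \<in> ?S" "b \<in> ?S"
    then obtain s t s' t' where ab: "a = s \<otimes> y [^] (t::nat)" "s \<in> carrier R - P" "b = s' \<otimes> y [^] (t'::nat)" "s' \<in> carrier R - P"
      by blast
    have cc: "s \<in> carrier R" "s' \<in> carrier R" "y [^] t \<in> carrier R" "y [^] t' \<in> carrier R" using ab c by auto
    have "a \<otimes> b = (s \<otimes> s') \<otimes> y [^] (t + t')"
      unfolding ab(1,3) R.nat_pow_mult[OF c(2), symmetric] using cc by (simp add: R.m_ac)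
    moreover have "s \<otimes> s' \<in> carrier R - P" using mS ab unfolding mult_set_def by blast
    ultimately show "a \<otimes> b \<in> ?S" by blast
  next
    show "ann_quot ?N \<inter> ?S = {}"
    proof (rule ccontr)
      assume "ann_quot ?N \<inter> ?S \<noteq> {}"
      then obtain s t where st: "s \<in> carrier R - P" "s \<otimes> y [^] (t::nat) \<in> ann_quot ?N" by blast
      have "s \<bullet> v \<in> ?N" if v: "v \<in> \<M>" for v
      proof -
        have "(s \<otimes> y [^] t) \<bullet> v \<in> ?N" using st v by (auto simp: ann_quot_def)
        then have "y [^] t \<bullet> s \<bullet> v \<in> ?N" using st v c by (simp add: smult_assoc1 smult_comm[of s])
        then show ?thesis using reg_pow[OF r(2) c(2), of "s \<bullet> v" t] st v by auto
      qed
      then have "s \<in> ann_quot ?N" using st by (auto simp: ann_quot_def)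
      moreover have "ann_quot ?N \<subseteq> P" using ann_quot_mono[OF ext_base[of ?N "{y}"]] snoc.prems(4) e by auto
      ultimately show False using st by blast
    qed
  qed
  have "Q \<subseteq> P" using Q(3) S1 ideal.Icarr[OF primeideal.axioms(1)[OF Q(1)]] by blast
  moreover have "y \<notin> Q" using Q(3) yS by blast
  ultimately have "Q \<subset> P" using yP by blast
  obtain P0 where "ann_quot B \<subseteq> P0" "prime_chain (length ys) P0 Q" using snoc.IH[OF r(1) _ Q(1,2)] snoc.prems by auto
  then show ?case using prime_chain_snoc[OF _ \<open>Q \<subset> P\<close> P.primeideal] by auto
qed

text \<open>Every chain can be prolonged up to \<mm>, whose height is at most the number of its
  generators.\<close>

lemma prime_chain_bounded:
  obtains d where "\<And>k P Q. prime_chain k P Q \<Longrightarrow> k \<le> d"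
proof -
  obtain G where G: "G \<subseteq> carrier R" "finite G" "\<mm> = Idl G" using finetely_gen[OF is_ideal] by auto
  obtain gs where gs: "set gs = G" using finite_list[OF G(2)] by auto
  have Gm: "set gs \<subseteq> \<mm>" using G R.genideal_self gs by auto
  have top: "k \<le> length gs" if "prime_chain k P \<mm>" for k P
  proof (rule height_bound[OF that, of "{}"])
    fix P' assume "primeideal P' R" "{} \<union> set gs \<subseteq> P'" "P' \<subseteq> \<mm>"
    then show "P' = \<mm>" using G(3) gs R.genideal_minimal[of P' G] primeideal.axioms(1)[of P' R] by auto
  qed (use Gm in auto)
  have "k \<le> length gs" if "prime_chain k P Q" for k P Q
  proof (cases "Q = \<mm>")
    case False
    then have "Q \<subset> \<mm>" using prime_le_m prime_chain_prime[OF that] by blast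
    then have "prime_chain (Suc k) P \<mm>" using prime_chain_snoc[OF that _ prime_m] by blast
    from top[OF this] show ?thesis by simp
  qed (use top that in auto)
  then show ?thesis using that by blast
qed

lemma exists_parameters:
  assumes B: "sub B" and d: "\<And>k P Q. prime_chain k P Q \<Longrightarrow> ann_quot B \<subseteq> P \<Longrightarrow> k \<le> d"
  obtains zs where "length zs = d" "set zs \<subseteq> \<mm>" "m_primary (ext B (set zs))"
proof -
  \<comment> \<open>Invariant: every nonmaximal prime over Ann(M/B) and the chosen elements has i
    steps below it within the support. A new element avoids the nonmaximal primes of a cover and
    thereby adds a step.\<close>
  have "\<exists>zs. length zs = i \<and> set zs \<subseteq> \<mm> \<and> (\<forall>P. primeideal P R \<longrightarrow> ann_quot B \<union> set zs \<subseteq> P \<longrightarrow>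
    P = \<mm> \<or> (\<exists>P0. ann_quot B \<subseteq> P0 \<and> prime_chain i P0 P))" for i
  proof (induction i)
    case 0
    then show ?case by auto
  next
    case (Suc i)
    then obtain zs where zs: "length zs = i" "set zs \<subseteq> \<mm>"
      and schain: "\<And>P. primeideal P R \<Longrightarrow> ann_quot B \<union> set zs \<subseteq> P \<Longrightarrow> P = \<mm> \<or> (\<exists>P0. ann_quot B \<subseteq> P0 \<and> prime_chain i P0 P)" by blast
    let ?I = "Idl (ann_quot B \<union> set zs)"
    have c: "ann_quot B \<union> set zs \<subseteq> carrier R" using zs m_carr by (auto simp: ann_quot_def)
    obtain F where F: "prime_cover ?I F" using finite_prime_cover[OF R.genideal_ideal[OF c]] by blast
    note D = prime_coverD[OF F]
    obtain z where z: "z \<in> \<mm>" "\<And>P. P \<in> F \<Longrightarrow> P \<noteq> \<mm> \<Longrightarrow> z \<notin> P" using exists_notin_primes[of F] D by blast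
    have "P = \<mm> \<or> (\<exists>P0. ann_quot B \<subseteq> P0 \<and> prime_chain (Suc i) P0 P)"
      if P: "primeideal P R" "ann_quot B \<union> set (z # zs) \<subseteq> P" for P
    proof -
      have "?I \<subseteq> P" using P primeideal.axioms(1) by (intro R.genideal_minimal) auto
      then obtain Q where Q: "Q \<in> F" "Q \<subseteq> P" using D(4)[OF P(1)] by blast
      show ?thesis
      proof (cases "Q = \<mm>")
        case True
        then show ?thesis using Q prime_le_m[OF P(1)] by auto
      next
        case False
        then have "Q \<subset> P" using z(2)[OF Q(1)] Q P by auto
        moreover obtain P0 where "ann_quot B \<subseteq> P0" "prime_chain i P0 Q"
          using schain[OF D(2)[OF Q(1)]] D(3)[OF Q(1)] R.genideal_self[OF c] False by blast
        ultimately show ?thesis using prime_chain_snoc P(1) by blast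
      qed
    qed
    then show ?case using zs z by (intro exI[of _ "z # zs"]) auto
  qed
  then obtain zs where zs: "length zs = d" "set zs \<subseteq> \<mm>"
    and schain: "\<And>P. primeideal P R \<Longrightarrow> ann_quot B \<union> set zs \<subseteq> P \<Longrightarrow> P = \<mm> \<or> (\<exists>P0. ann_quot B \<subseteq> P0 \<and> prime_chain d P0 P)" by blast
  have s: "sub (ext B (set zs))" using B zs m_carr by (intro ext_sub) auto
  have "m_primary (ext B (set zs))"
    unfolding m_primary_iff[OF s]
  proof (intro allI impI, rule ccontr)
    fix P assume P: "primeideal P R" "ann_quot (ext B (set zs)) \<subseteq> P" "P \<noteq> \<mm>"
    have "ann_quot B \<union> set zs \<subseteq> ann_quot (ext B (set zs))"
      using ann_quot_mono[OF ext_base] ann_quot_ext_mem zs m_carr by auto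
    then obtain P0 where P0: "ann_quot B \<subseteq> P0" "prime_chain d P0 P" using schain[OF P(1)] P by blast
    have "P \<subset> \<mm>" using prime_le_m[OF P(1)] P by blast
    then have "prime_chain (Suc d) P0 \<mm>" using prime_chain_snoc[OF P0(2) _ prime_m] by blast
    from d[OF this P0(1)] show False by simp
  qed
  then show ?thesis using that zs by blast
qed

lemma m_primary_imp_bounded: assumes "sub N" "m_primary N" shows "bounded_schain (carrier R - \<mm>) N \<M>"
proof (rule bounded_schain_prime[OF prime_m assms(1)])
  fix g assume "g \<in> \<mm>"
  then obtain t :: nat where t: "\<forall>v\<in>\<M>. g [^] t \<bullet> v \<in> N" using assms by (auto simp: m_primary_def)
  have "\<one> \<in> carrier R - \<mm>" using mult_set_prime[OF prime_m] by (auto simp: mult_set_def)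
  then show "\<exists>t::nat. \<exists>s\<in>carrier R - \<mm>. \<forall>v\<in>\<M>. s \<bullet> g [^] t \<bullet> v \<in> N"
    using t sub_carr[OF assms(1)] by (intro exI[of _ t] bexI[of _ \<one>]) auto
qed

text \<open>Elements outside \<mm> are units, so at \<mm> the localized chains are ordinary strict
  chains, and \<open>bounded_schain\<close> means finite length.\<close>

lemma sstep_iff: "sub A \<Longrightarrow> sub B \<Longrightarrow> sstep (carrier R - \<mm>) A B \<longleftrightarrow> A \<subset> B"
proof
  assume s: "sub A" "sub B" "sstep (carrier R - \<mm>) A B"
  then obtain b where b: "b \<in> B" "\<forall>s\<in>carrier R - \<mm>. s \<bullet> b \<notin> A" "A \<subseteq> B" by (auto simp: sstep_def)
  have "\<one> \<in> carrier R - \<mm>" using mult_set_prime[OF prime_m] by (auto simp: mult_set_def)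
  then have "b \<notin> A" using b sub_carr[OF s(2)] by force
  then show "A \<subset> B" using b by blast
next
  assume s: "sub A" "sub B" "A \<subset> B"
  then obtain b where "b \<in> B" "b \<notin> A" by auto
  then show "sstep (carrier R - \<mm>) A B"
    unfolding sstep_def using mem_of_smult_unit[OF s(1)] sub_carr[OF s(2)] s by blast
qed

text \<open>The submodules N + a^k M descend, so boundedness makes two consecutive ones equal. From
  there on they are constant, and Krull's theorem puts a^t M into N.\<close>

lemma bounded_imp_m_primary: assumes N: "sub N" and b: "bounded_schain (carrier R - \<mm>) N \<M>" shows "m_primary N"
  unfolding m_primary_def
proof
  fix a assume a: "a \<in> \<mm>"
  have aR: "a \<in> carrier R" using a m_carr by auto
  let ?A = "\<lambda>k::nat. ext N {a [^] k}"
  have s: "sub (?A k)" for k using N aR by (intro ext_sub) auto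
  have le: "?A (Suc k) \<subseteq> ?A k" for k using N aR by (intro ext_pow_le) auto
  have "\<exists>t. ?A (Suc t) = ?A t"
  proof (rule ccontr)
    assume "\<not> ?thesis"
    then have lt: "?A (Suc t) \<subset> ?A t" for t using le by blast
    have "schain (carrier R - \<mm>) k (?A k) \<M>" for k
    proof (induction k)
      case 0 then show ?case using s[of 0] carrier_is_submodule sub_subset by auto
    next
      case (Suc k) then show ?case using lt[of k] sstep_iff[OF s s, of "Suc k" k] s[of "Suc k"] by auto
    qed
    then have "schain (carrier R - \<mm>) k N \<M>" for k using schain_mono[OF _ N ext_base] by blast
    then show False using b unfolding bounded_schain_def using Suc_n_not_le_n by blast
  qed
  then obtain t where t: "?A (Suc t) = ?A t" by blast
  have st: "?A (t + j) \<subseteq> ?A (Suc (t + j))" for j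
  proof (rule ext_least[OF s ext_base])
    fix y v assume y: "y \<in> {a [^] (t + j)}" "v \<in> \<M>"
    have "a [^] t \<bullet> v \<in> ?A (Suc t)" unfolding t using ext_prod[of "a [^] t" "{a [^] t}" v N] y by auto
    then obtain u where u: "u \<in> \<M>" "congr N (a [^] t \<bullet> v) (a [^] Suc t \<bullet> u)"
      using ext_singleE[OF _ N, of _ "a [^] Suc t"] aR by (metis R.nat_pow_closed)
    have "congr N (a [^] j \<bullet> a [^] t \<bullet> v) (a [^] j \<bullet> a [^] Suc t \<bullet> u)" using aR by (intro congr_smult[OF N _ u(2)]) auto
    moreover have "a [^] j \<bullet> a [^] t \<bullet> v = a [^] (t + j) \<bullet> v"
      using pow_add_smult[OF aR, of v j t] y by (simp add: add.commute)
    moreover have "a [^] j \<bullet> a [^] Suc t \<bullet> u = a [^] Suc (t + j) \<bullet> u"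
      using pow_add_smult[OF aR u(1), of j "Suc t"] by (simp add: add.commute)
    ultimately show "y \<bullet> v \<in> ?A (Suc (t + j))"
      using y u(1) aR N by (auto simp: ext_single_iff simp del: R.nat_pow_Suc)
  qed
  have "?A t \<subseteq> ?A (t + j)" for j
  proof (induction j)
    case (Suc j) then show ?case using st[of j] by simp
  qed auto
  then have all: "?A t \<subseteq> ?A k" for k
  proof (cases "t \<le> k")
    case False
    then show ?thesis using N aR by (intro ext_pow_le) auto
  qed (metis le_add_diff_inverse)
  have "a [^] t \<bullet> v \<in> N" if v: "v \<in> \<M>" for v
  proof (rule krull_intersection[OF N a])
    show "a [^] t \<bullet> v \<in> ext N {a [^] k}" for k :: nat
      using all[of k] ext_prod[of "a [^] t" "{a [^] t}" v N] v by auto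
  qed (use v aR in auto)
  then show "\<exists>t::nat. \<forall>v\<in>\<M>. a [^] t \<bullet> v \<in> N" by blast
qed

end

section \<open>Quotient modules and dimension\<close>

lemma sup_chain_length_mono:
  assumes "\<And>A. A \<in> \<A> \<Longrightarrow> f A \<in> \<B>" "\<And>A B. A \<in> \<A> \<Longrightarrow> B \<in> \<A> \<Longrightarrow> A \<subset> B \<Longrightarrow> f A \<subset> f B"
  shows "sup_chain_length \<A> \<le> sup_chain_length \<B>"
  unfolding sup_chain_length_def
proof (rule Sup_subset_mono, rule subsetI)
  fix k assume "k \<in> {enat (length As - 1) |As. As \<noteq> [] \<and> set As \<subseteq> \<A> \<and> sorted_wrt (\<subset>) As}"
  then obtain As where As: "k = enat (length As - 1)" "As \<noteq> []" "set As \<subseteq> \<A>" "sorted_wrt (\<subset>) As" by auto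
  have "sorted_wrt (\<subset>) (map f As)"
    unfolding sorted_wrt_map
  proof (rule sorted_wrt_mono_rel[OF _ As(4)])
    show "f A \<subset> f B" if "A \<in> set As" "B \<in> set As" "A \<subset> B" for A B
      using that As(3) by (intro assms(2)) auto
  qed
  then show "k \<in> {enat (length As - 1) |As. As \<noteq> [] \<and> set As \<subseteq> \<B> \<and> sorted_wrt (\<subset>) As}"
    using As assms by (intro CollectI exI[of _ "map f As"]) auto
qed

lemma sup_chain_length_ge:
  "As \<noteq> [] \<Longrightarrow> set As \<subseteq> \<A> \<Longrightarrow> sorted_wrt (\<subset>) As \<Longrightarrow> enat (length As - 1) \<le> sup_chain_length \<A>"
  unfolding sup_chain_length_def by (rule Sup_upper) auto

lemma sup_chain_length_least:
  assumes "\<And>As. As \<noteq> [] \<Longrightarrow> set As \<subseteq> \<A> \<Longrightarrow> sorted_wrt (\<subset>) As \<Longrightarrow> enat (length As - 1) \<le> b"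
  shows "sup_chain_length \<A> \<le> b"
  unfolding sup_chain_length_def by (rule Sup_least) (use assms in auto)

context module
begin

abbreviation mcoset where "mcoset N v \<equiv> N +>\<^bsub>M\<^esub> v"
abbreviation mquot where "mquot N \<equiv> quot_module M N"

lemma sub_abelian_subgroup: assumes "sub N" shows "abelian_subgroup N M"
  using assms M.abelian_group_axioms
  by (intro abelian_subgroupI3 additive_subgroup.intro) (auto simp: submodule_def)

lemma mcoset_eq_iff: assumes "sub N" "u \<in> \<M>" "v \<in> \<M>" shows "mcoset N u = mcoset N v \<longleftrightarrow> congr N u v"
proof -
  interpret N: abelian_subgroup N M by (rule sub_abelian_subgroup[OF assms(1)])
  have "mcoset N u = mcoset N v \<longleftrightarrow> u \<in> mcoset N v"
    using N.a_repr_independence'[of u v] N.a_rcos_self assms by auto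
  also have "\<dots> \<longleftrightarrow> congr N u v"
    using N.a_rcos_module[of v u] assms by (auto simp: congr_def a_minus_def)
  finally show ?thesis .
qed

lemma mquot_carrier: "carrier (mquot N) = mcoset N ` \<M>"
  by (auto simp: quot_module_def A_RCOSETS_def')

lemma mcoset_mem: assumes "sub N" "v \<in> \<M>" shows "u \<in> mcoset N v \<longleftrightarrow> congr N u v"
proof -
  interpret N: abelian_subgroup N M by (rule sub_abelian_subgroup[OF assms(1)])
  show ?thesis
  proof
    assume u: "u \<in> mcoset N v"
    then have "u \<in> \<M>" using N.a_elemrcos_carrier assms by auto
    then show "congr N u v" using N.a_rcos_module[of v u] u assms by (auto simp: congr_def a_minus_def)
  next
    assume "congr N u v"
    then show "u \<in> mcoset N v" using N.a_rcos_module[of v u] by (auto simp: congr_def a_minus_def)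
  qed
qed

lemma mcoset_zero_iff: assumes "sub N" "v \<in> \<M>" shows "mcoset N v = N \<longleftrightarrow> v \<in> N"
proof -
  interpret N: abelian_subgroup N M by (rule sub_abelian_subgroup[OF assms(1)])
  show ?thesis using N.a_rcos_const[of v] N.a_rcos_self[OF assms(2)] by auto
qed

lemma mquot_add: assumes "sub N" "u \<in> \<M>" "v \<in> \<M>" shows "mcoset N u \<oplus>\<^bsub>mquot N\<^esub> mcoset N v = mcoset N (u \<oplus>\<^sub>M v)"
proof -
  interpret N: abelian_subgroup N M by (rule sub_abelian_subgroup[OF assms(1)])
  show ?thesis using N.a_rcos_sum[OF assms(2,3)] by (simp add: quot_module_def)
qed

lemma mquot_smult: assumes N: "sub N" and a: "a \<in> carrier R" and v: "v \<in> \<M>"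
  shows "a \<odot>\<^bsub>mquot N\<^esub> mcoset N v = mcoset N (a \<bullet> v)"
proof -
  have "mcoset N (a \<bullet> u) = mcoset N (a \<bullet> v)" if "u \<in> mcoset N v" for u
  proof -
    have c: "congr N u v" using mcoset_mem[OF N v] that by auto
    then have "u \<in> \<M>" by (simp add: congr_def)
    then show ?thesis using mcoset_eq_iff[OF N] congr_smult[OF N a c] a v by simp
  qed
  moreover have "v \<in> mcoset N v" using mcoset_mem[OF N v] congr_refl[OF N v] by auto
  ultimately have "(\<Union>x\<in>mcoset N v. mcoset N (a \<bullet> x)) = mcoset N (a \<bullet> v)" by blast
  then show ?thesis by (simp add: quot_module_def)
qed

lemma mquot_zero: "\<zero>\<^bsub>mquot N\<^esub> = N"
  by (simp add: quot_module_def)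

lemma mquot_module: assumes N: "sub N" shows "module R (mquot N)"
proof (rule moduleI)
  have z: "mcoset N \<zero>\<^sub>M = N" using mcoset_zero_iff[OF N] sub_zero[OF N] by auto
  show "abelian_group (mquot N)"
  proof (rule abelian_groupI)
    show "\<zero>\<^bsub>mquot N\<^esub> \<in> carrier (mquot N)" unfolding mquot_zero mquot_carrier using z by (metis M.zero_closed imageI)
    show "\<zero>\<^bsub>mquot N\<^esub> \<oplus>\<^bsub>mquot N\<^esub> x = x" if x: "x \<in> carrier (mquot N)" for x
    proof -
      obtain v where v: "v \<in> \<M>" "x = mcoset N v" using x by (auto simp: mquot_carrier)
      then have "mcoset N \<zero>\<^sub>M \<oplus>\<^bsub>mquot N\<^esub> mcoset N v = mcoset N v" using mquot_add[OF N] by simp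
      then show ?thesis using z v by (simp add: mquot_zero)
    qed
    show "\<exists>y\<in>carrier (mquot N). y \<oplus>\<^bsub>mquot N\<^esub> x = \<zero>\<^bsub>mquot N\<^esub>" if x: "x \<in> carrier (mquot N)" for x
    proof -
      obtain v where v: "v \<in> \<M>" "x = mcoset N v" using x by (auto simp: mquot_carrier)
      then have "mcoset N (\<ominus>\<^bsub>M\<^esub> v) \<oplus>\<^bsub>mquot N\<^esub> x = N" using mquot_add[OF N, of "\<ominus>\<^bsub>M\<^esub> v" v] z by (simp add: M.l_neg)
      then show ?thesis using v by (auto simp: mquot_zero mquot_carrier)
    qed
  qed (auto simp: mquot_carrier mquot_add[OF N] M.a_ac)
qed (auto simp: mquot_carrier mquot_add[OF N] mquot_smult[OF N] R.is_cring smult_l_distr smult_r_distr smult_assoc1)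

lemma mcoset_image_mem: assumes N: "sub N" and C: "sub C" "N \<subseteq> C" and v: "v \<in> \<M>"
  shows "mcoset N v \<in> mcoset N ` C \<longleftrightarrow> v \<in> C"
proof
  assume "mcoset N v \<in> mcoset N ` C"
  then obtain u where u: "u \<in> C" "mcoset N v = mcoset N u" by auto
  then have "congr N v u" using mcoset_eq_iff[OF N v] sub_carr[OF C(1)] by auto
  then show "v \<in> C" using congr_memI[OF C(1) congr_mono[OF _ C(2)]] u by blast
qed auto

lemma mquot_image_sub: assumes N: "sub N" and C: "sub C" shows "submodule (mcoset N ` C) R (mquot N)"
proof -
  interpret Q: module R "mquot N" by (rule mquot_module[OF N])
  note c = sub_carr[OF C]
  have sm: "a \<odot>\<^bsub>mquot N\<^esub> x \<in> mcoset N ` C" if "a \<in> carrier R" "x \<in> mcoset N ` C" for a x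
    using that c mquot_smult[OF N] sub_smult[OF C] by auto
  show ?thesis
  proof (rule Q.submoduleI)
    show "mcoset N ` C \<subseteq> carrier (mquot N)" using c by (auto simp: mquot_carrier)
    show "\<zero>\<^bsub>mquot N\<^esub> \<in> mcoset N ` C"
      using mcoset_zero_iff[OF N] sub_zero[OF N] sub_zero[OF C] by (metis M.zero_closed imageI mquot_zero)
    show "\<ominus>\<^bsub>mquot N\<^esub> x \<in> mcoset N ` C" if "x \<in> mcoset N ` C" for x
    proof -
      have "x \<in> carrier (mquot N)" using that c by (auto simp: mquot_carrier)
      then have "\<ominus>\<^bsub>mquot N\<^esub> x = (\<ominus> \<one>) \<odot>\<^bsub>mquot N\<^esub> x" by (simp add: Q.smult_l_minus)
      then show ?thesis using sm that by simp
    qed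
    show "a \<oplus>\<^bsub>mquot N\<^esub> b \<in> mcoset N ` C" if "a \<in> mcoset N ` C" "b \<in> mcoset N ` C" for a b
      using that c mquot_add[OF N] sub_add[OF C] by auto
  qed (use sm in auto)
qed

lemma mquot_preimage_sub: assumes N: "sub N" and D: "submodule D R (mquot N)"
  shows "sub {v \<in> \<M>. mcoset N v \<in> D}" "N \<subseteq> {v \<in> \<M>. mcoset N v \<in> D}"
proof -
  interpret Q: module R "mquot N" by (rule mquot_module[OF N])
  note c = sub_carr[OF N]
  have z: "N \<in> D" using Q.sub_zero[OF D] by (simp add: mquot_zero)
  have sm: "a \<bullet> v \<in> {v \<in> \<M>. mcoset N v \<in> D}" if "a \<in> carrier R" "v \<in> {v \<in> \<M>. mcoset N v \<in> D}" for a v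
    using that Q.sub_smult[OF D] mquot_smult[OF N] by fastforce
  show "N \<subseteq> {v \<in> \<M>. mcoset N v \<in> D}"
  proof
    fix v assume v: "v \<in> N"
    then have "mcoset N v = N" using mcoset_zero_iff[OF N c[OF v]] by simp
    then show "v \<in> {v \<in> \<M>. mcoset N v \<in> D}" using z c[OF v] by simp
  qed
  then show "sub {v \<in> \<M>. mcoset N v \<in> D}"
  proof (intro submoduleI)
    show "\<ominus>\<^bsub>M\<^esub> a \<in> {v \<in> \<M>. mcoset N v \<in> D}" if "a \<in> {v \<in> \<M>. mcoset N v \<in> D}" for a
      using sm[of "\<ominus> \<one>" a] that by (simp add: smult_l_minus)
    show "a \<oplus>\<^sub>M b \<in> {v \<in> \<M>. mcoset N v \<in> D}" if "a \<in> {v \<in> \<M>. mcoset N v \<in> D}" "b \<in> {v \<in> \<M>. mcoset N v \<in> D}" for a b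
      using that Q.sub_add[OF D, of "mcoset N a" "mcoset N b"] mquot_add[OF N] by simp
  qed (use sm sub_zero[OF N] in auto)
qed

lemma module_length_quot: assumes N: "sub N"
  shows "module_length R (mquot N) = sup_chain_length {C. sub C \<and> N \<subseteq> C}"
  unfolding module_length_def
proof (rule antisym)
  show "sup_chain_length {D. submodule D R (mquot N)} \<le> sup_chain_length {C. sub C \<and> N \<subseteq> C}"
  proof (rule sup_chain_length_mono[where f = "\<lambda>D. {v \<in> \<M>. mcoset N v \<in> D}"])
    fix A B assume A: "A \<in> {D. submodule D R (mquot N)}" "B \<in> {D. submodule D R (mquot N)}" "A \<subset> B"
    interpret Q: module R "mquot N" by (rule mquot_module[OF N])
    obtain x where x: "x \<in> B" "x \<notin> A" using A by auto
    then have "x \<in> carrier (mquot N)" using Q.sub_carr A by blast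
    then obtain v where "v \<in> \<M>" "x = mcoset N v" by (auto simp: mquot_carrier)
    then show "{v \<in> \<M>. mcoset N v \<in> A} \<subset> {v \<in> \<M>. mcoset N v \<in> B}" using x A by blast
  qed (use mquot_preimage_sub[OF N] in auto)
  show "sup_chain_length {C. sub C \<and> N \<subseteq> C} \<le> sup_chain_length {D. submodule D R (mquot N)}"
  proof (rule sup_chain_length_mono[where f = "\<lambda>C. mcoset N ` C"])
    fix A B assume A: "A \<in> {C. sub C \<and> N \<subseteq> C}" "B \<in> {C. sub C \<and> N \<subseteq> C}" "A \<subset> B"
    then obtain v where v: "v \<in> B" "v \<notin> A" by auto
    then have "mcoset N v \<notin> mcoset N ` A" using mcoset_image_mem[OF N, of A v] A sub_carr[of B] by auto
    then show "mcoset N ` A \<subset> mcoset N ` B" using A v by blast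
  qed (use mquot_image_sub[OF N] in auto)
qed

lemma annihilator_quot: assumes N: "sub N" shows "annihilator R (mquot N) = ann_quot N"
proof -
  have "a \<odot>\<^bsub>mquot N\<^esub> mcoset N v = \<zero>\<^bsub>mquot N\<^esub> \<longleftrightarrow> a \<bullet> v \<in> N" if "a \<in> carrier R" "v \<in> \<M>" for a v
    using that by (simp add: mquot_smult[OF N] mquot_zero mcoset_zero_iff[OF N])
  then show ?thesis unfolding annihilator_def ann_quot_def mquot_carrier by auto
qed

lemma annihilator_eq: "annihilator R M = ann_quot {\<zero>\<^sub>M}"
  by (auto simp: annihilator_def ann_quot_def)

lemma ideal_smult_eq_ext: assumes "I \<noteq> {}" "I \<subseteq> carrier R"
  shows "ideal_smult R M I \<M> = ext {\<zero>\<^sub>M} I"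
proof
  let ?S = "{a \<bullet> x |a x. a \<in> I \<and> x \<in> \<M>}"
  have s: "sub (gen_submodule R M ?S)" using assms by (intro gen_sub) auto
  show "ideal_smult R M I \<M> \<subseteq> ext {\<zero>\<^sub>M} I"
    unfolding ideal_smult_def by (rule gen_least) (use assms in \<open>auto intro: ext_sub sub_zero_module ext_prod\<close>)
  show "ext {\<zero>\<^sub>M} I \<subseteq> ideal_smult R M I \<M>"
    unfolding ideal_smult_def using sub_zero[OF s] gen_self[of ?S] by (intro ext_least s) auto
qed

lemma seq_smult_eq: assumes "set xs \<subseteq> carrier R" shows "seq_smult R M xs = ext {\<zero>\<^sub>M} (set xs)"
proof -
  have i: "ideal (Idl (set xs)) R" by (rule R.genideal_ideal[OF assms])
  have "Idl (set xs) \<noteq> {}" "Idl (set xs) \<subseteq> carrier R"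
    using additive_subgroup.zero_closed[OF ideal.axioms(1)[OF i]] ideal.Icarr[OF i] by auto
  then show ?thesis unfolding seq_smult_def using ideal_smult_eq_ext ext_Idl[OF sub_zero_module assms] by simp
qed

lemma seq_smult_quot: assumes N: "sub N" and xs: "set xs \<subseteq> carrier R"
  shows "seq_smult R (mquot N) xs = mcoset N ` ext N (set xs)"
proof -
  interpret Q: module R "mquot N" by (rule mquot_module[OF N])
  have e: "sub (ext N (set xs))" using N xs by (intro ext_sub) auto
  have "Q.ext {N} (set xs) = mcoset N ` ext N (set xs)"
  proof
    have zN: "Q.sub {N}" using Q.sub_zero_module by (simp add: mquot_zero)
    have NN: "N \<in> mcoset N ` ext N (set xs)"
      using mcoset_zero_iff[OF N] sub_zero[OF N] sub_zero[OF e] by (metis M.zero_closed imageI)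
    show "Q.ext {N} (set xs) \<subseteq> mcoset N ` ext N (set xs)"
    proof (rule Q.ext_least[OF mquot_image_sub[OF N e]])
      fix x v assume "x \<in> set xs" "v \<in> carrier (mquot N)"
      then show "x \<odot>\<^bsub>mquot N\<^esub> v \<in> mcoset N ` ext N (set xs)"
        using xs mquot_smult[OF N] ext_prod[of x "set xs" _ N] by (auto simp: mquot_carrier)
    qed (use NN in auto)
    have QE: "Q.sub (Q.ext {N} (set xs))" by (rule Q.ext_sub[OF zN xs])
    have "ext N (set xs) \<subseteq> {v \<in> \<M>. mcoset N v \<in> Q.ext {N} (set xs)}"
    proof (rule ext_least)
      fix x v assume xv: "x \<in> set xs" "v \<in> \<M>"
      then have "x \<odot>\<^bsub>mquot N\<^esub> mcoset N v \<in> Q.ext {N} (set xs)" by (intro Q.ext_prod) (auto simp: mquot_carrier)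
      then show "x \<bullet> v \<in> {v \<in> \<M>. mcoset N v \<in> Q.ext {N} (set xs)}" using xv xs mquot_smult[OF N, of x v] by auto
    qed (use mquot_preimage_sub[OF N QE] in auto)
    then show "mcoset N ` ext N (set xs) \<subseteq> Q.ext {N} (set xs)" by auto
  qed
  then show ?thesis using Q.seq_smult_eq[OF xs] by (simp add: mquot_zero)
qed

lemma rseq_iff: "sub B \<Longrightarrow> set xs \<subseteq> carrier R \<Longrightarrow>
  rseq B xs \<longleftrightarrow> (\<forall>i<length xs. reg (ext B (set (take i xs))) (xs ! i))"
proof (induction xs arbitrary: B)
  case (Cons x xs)
  have e: "sub (ext B {x})" using Cons.prems by (intro ext_sub) auto
  have "ext (ext B {x}) (set (take i xs)) = ext B (insert x (set (take i xs)))" for i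
    using Cons.prems set_take_subset[of i xs] by (subst ext_insert_eq(2)) auto
  then have "rseq (ext B {x}) xs \<longleftrightarrow> (\<forall>i<length xs. reg (ext B (insert x (set (take i xs)))) (xs ! i))"
    using Cons.IH[OF e] Cons.prems by simp
  then show ?case using Cons.prems by (auto simp: less_Suc_eq_0_disj ext_empty)
qed simp

text \<open>Each condition lives in an iterated quotient (M/N)/(C/N), where C is N extended by the
  earlier elements; on representatives, vanishing there means membership in C.\<close>

lemma regular_seq_quot: assumes N: "sub N"
  shows "regular_seq R (mquot N) xs \<longleftrightarrow> set xs \<subseteq> carrier R \<and> rseq N xs \<and> ext N (set xs) \<noteq> \<M>"
proof (cases "set xs \<subseteq> carrier R")
  case True
  interpret Q: module R "mquot N" by (rule mquot_module[OF N])
  have e: "sub (ext N (set ys))" "N \<subseteq> ext N (set ys)" if "set ys \<subseteq> set xs" for ys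
    using that True N ext_base by (auto intro: ext_sub)
  have 1: "(let Q' = quot_module (mquot N) (seq_smult R (mquot N) (take i xs)) in
       \<forall>z\<in>carrier Q'. (xs ! i) \<odot>\<^bsub>Q'\<^esub> z = \<zero>\<^bsub>Q'\<^esub> \<longrightarrow> z = \<zero>\<^bsub>Q'\<^esub>) \<longleftrightarrow> reg (ext N (set (take i xs))) (xs ! i)"
    if i: "i < length xs" for i
  proof -
    let ?C = "ext N (set (take i xs))"
    have sx: "set (take i xs) \<subseteq> set xs" by (rule set_take_subset)
    have tk: "set (take i xs) \<subseteq> carrier R" using sx True by auto
    note C = e[OF sx]
    note D = mquot_image_sub[OF N C(1)]
    have xi: "xs ! i \<in> carrier R" using True i nth_mem by blast
    have z: "\<And>v. v \<in> \<M> \<Longrightarrow> Q.mcoset (mcoset N ` ?C) (mcoset N v) = mcoset N ` ?C \<longleftrightarrow> v \<in> ?C"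
      using Q.mcoset_zero_iff[OF D] mcoset_image_mem[OF N C] by (auto simp: mquot_carrier)
    have "(\<forall>z\<in>carrier (Q.mquot (mcoset N ` ?C)). (xs ! i) \<odot>\<^bsub>Q.mquot (mcoset N ` ?C)\<^esub> z = \<zero>\<^bsub>Q.mquot (mcoset N ` ?C)\<^esub> \<longrightarrow> z = \<zero>\<^bsub>Q.mquot (mcoset N ` ?C)\<^esub>)
      \<longleftrightarrow> (\<forall>v\<in>\<M>. xs ! i \<bullet> v \<in> ?C \<longrightarrow> v \<in> ?C)"
      using xi z Q.mquot_smult[OF D xi] mquot_smult[OF N xi]
      by (auto simp: Q.mquot_carrier mquot_carrier Q.mquot_zero)
    then show ?thesis unfolding seq_smult_quot[OF N tk] Let_def reg_def .
  qed
  have 2: "seq_smult R (mquot N) xs = carrier (mquot N) \<longleftrightarrow> ext N (set xs) = \<M>"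
  proof
    assume "seq_smult R (mquot N) xs = carrier (mquot N)"
    then have "mcoset N ` ext N (set xs) = mcoset N ` \<M>" using seq_smult_quot[OF N True] by (simp add: mquot_carrier)
    then have "v \<in> ext N (set xs)" if "v \<in> \<M>" for v using mcoset_image_mem[OF N e[OF order_refl] that] that by blast
    then have "\<M> \<subseteq> ext N (set xs)" by blast
    then show "ext N (set xs) = \<M>" using sub_subset[OF e(1)] by blast
  qed (use seq_smult_quot[OF N True] mquot_carrier in auto)
  show ?thesis unfolding regular_seq_def rseq_iff[OF N True] using 1 2 True by auto
qed (auto simp: regular_seq_def)

end

section \<open>Dimension and length through chains of primes and submodules\<close>

lemma (in ideal) quot_mem_iff: assumes "ideal J R" "I \<subseteq> J" "a \<in> carrier R" shows "I +> a \<in> (+>) I ` J \<longleftrightarrow> a \<in> J"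
proof
  assume "I +> a \<in> (+>) I ` J"
  then obtain b where b: "b \<in> J" "I +> a = I +> b" by auto
  have "a \<in> I +> b" using b(2) abelian_subgroup.a_rcos_self[OF abelian_subgroupI3[OF ideal.axioms(1)[OF is_ideal] is_abelian_group] assms(3)] by simp
  then obtain i where "i \<in> I" "a = i \<oplus> b" unfolding a_r_coset_def' by auto
  then show "a \<in> J" using assms(2) b additive_subgroup.a_closed[OF ideal.axioms(1)[OF assms(1)]] by auto
qed auto

lemma (in cring) krull_dim_quot:
  assumes I: "ideal I R"
  shows "krull_dim (R Quot I) = sup_chain_length {P. primeideal P R \<and> I \<subseteq> P}"
  unfolding krull_dim_def
proof (rule antisym)
  interpret I: ideal I R by fact
  have cQ: "cring (R Quot I)" by (rule I.quotient_is_cring[OF is_cring])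
  have car: "carrier (R Quot I) = (+>) I ` carrier R" by (auto simp: FactRing_def A_RCOSETS_def')
  have mlt: "(I +> a) \<otimes>\<^bsub>R Quot I\<^esub> (I +> b) = I +> (a \<otimes> b)" if "a \<in> carrier R" "b \<in> carrier R" for a b
    using I.rcoset_mult_add that by (simp add: FactRing_def)
  have rh: "ring_hom_ring R (R Quot I) ((+>) I)" by (rule I.rcos_ring_hom_ring)
  show "sup_chain_length {P. primeideal P (R Quot I)} \<le> sup_chain_length {P. primeideal P R \<and> I \<subseteq> P}"
  proof (rule sup_chain_length_mono[where f = "\<lambda>P. {r \<in> carrier R. I +> r \<in> P}"])
    fix P assume "P \<in> {P. primeideal P (R Quot I)}"
    then interpret P: primeideal P "R Quot I" by simp
    have id: "ideal {r \<in> carrier R. I +> r \<in> P} R" by (rule ring_hom_ring.ideal_vimage[OF rh P.is_ideal])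
    have "primeideal {r \<in> carrier R. I +> r \<in> P} R"
    proof (rule primeidealI[OF id is_cring])
      show "carrier R \<noteq> {r \<in> carrier R. I +> r \<in> P}"
      proof
        assume "carrier R = {r \<in> carrier R. I +> r \<in> P}"
        then have "carrier (R Quot I) \<subseteq> P" unfolding car by blast
        then show False using P.I_notcarr P.a_subset by auto
      qed
      fix a b assume "a \<in> carrier R" "b \<in> carrier R" "a \<otimes> b \<in> {r \<in> carrier R. I +> r \<in> P}"
      then show "a \<in> {r \<in> carrier R. I +> r \<in> P} \<or> b \<in> {r \<in> carrier R. I +> r \<in> P}"
        using P.I_prime[of "I +> a" "I +> b"] mlt car by auto
    qed
    moreover have "I \<subseteq> {r \<in> carrier R. I +> r \<in> P}"
    proof
      fix r assume r: "r \<in> I"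
      have "I +> r = I"
        using abelian_subgroup.a_rcos_const[OF abelian_subgroupI3[OF ideal.axioms(1)[OF I] is_abelian_group] r] .
      moreover have "I \<in> P"
      proof -
        have "\<zero>\<^bsub>R Quot I\<^esub> = I" by (simp add: FactRing_def)
        then show ?thesis using additive_subgroup.zero_closed[OF ideal.axioms(1)[OF P.is_ideal]] by simp
      qed
      ultimately show "r \<in> {r \<in> carrier R. I +> r \<in> P}" using r I.Icarr by auto
    qed
    ultimately show "{r \<in> carrier R. I +> r \<in> P} \<in> {P. primeideal P R \<and> I \<subseteq> P}" by auto
  next
    fix A B assume AB: "A \<in> {P. primeideal P (R Quot I)}" "B \<in> {P. primeideal P (R Quot I)}" "A \<subset> B"
    then obtain x where x: "x \<in> B" "x \<notin> A" by auto
    interpret B: primeideal B "R Quot I" using AB by simp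
    have "x \<in> carrier (R Quot I)" using x B.Icarr by auto
    then obtain r where "r \<in> carrier R" "x = I +> r" unfolding car by auto
    then show "{r \<in> carrier R. I +> r \<in> A} \<subset> {r \<in> carrier R. I +> r \<in> B}" using x AB by blast
  qed
  show "sup_chain_length {P. primeideal P R \<and> I \<subseteq> P} \<le> sup_chain_length {P. primeideal P (R Quot I)}"
  proof (rule sup_chain_length_mono[where f = "\<lambda>P. (+>) I ` P"])
    fix P assume "P \<in> {P. primeideal P R \<and> I \<subseteq> P}"
    then have P: "primeideal P R" "I \<subseteq> P" by auto
    interpret P: primeideal P R by fact
    note mem = I.quot_mem_iff[OF P.is_ideal P(2)]
    have "primeideal ((+>) I ` P) (R Quot I)"
    proof (rule primeidealI[OF ring_ideal_imp_quot_ideal[OF I P.is_ideal] cQ])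
      have "\<one> \<notin> P" using P.one_imp_carrier P.I_notcarr by auto
      then have "I +> \<one> \<notin> (+>) I ` P" using mem by auto
      then show "carrier (R Quot I) \<noteq> (+>) I ` P" unfolding car by blast
      fix a b assume ab: "a \<in> carrier (R Quot I)" "b \<in> carrier (R Quot I)" "a \<otimes>\<^bsub>R Quot I\<^esub> b \<in> (+>) I ` P"
      then obtain r s where rs: "r \<in> carrier R" "s \<in> carrier R" "a = I +> r" "b = I +> s" unfolding car by auto
      then have "r \<otimes> s \<in> P" using ab(3) mlt mem[of "r \<otimes> s"] by auto
      then show "a \<in> (+>) I ` P \<or> b \<in> (+>) I ` P" using P.I_prime rs by auto
    qed
    then show "(+>) I ` P \<in> {P. primeideal P (R Quot I)}" by simp
  next
    fix A B assume AB: "A \<in> {P. primeideal P R \<and> I \<subseteq> P}" "B \<in> {P. primeideal P R \<and> I \<subseteq> P}" "A \<subset> B"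
    then obtain x where x: "x \<in> B" "x \<notin> A" by auto
    have iA: "ideal A R" and iB: "ideal B R" using AB primeideal.axioms(1) by auto
    have "I +> x \<notin> (+>) I ` A" using I.quot_mem_iff[OF iA] AB x ideal.Icarr[OF iB] by auto
    then show "(+>) I ` A \<subset> (+>) I ` B" using x AB by blast
  qed
qed

context noetherian_cring
begin

lemma prime_chain_of_list: "As \<noteq> [] \<Longrightarrow> (\<forall>P\<in>set As. primeideal P R) \<Longrightarrow> sorted_wrt (\<subset>) As \<Longrightarrow>
  prime_chain (length As - 1) (hd As) (last As)"
proof (induction As)
  case (Cons P As)
  show ?case
  proof (cases As)
    case (Cons Q Bs)
    then have "prime_chain (length As - 1) (hd As) (last As)" using Cons.IH Cons.prems by auto
    moreover have "P \<subset> hd As" using Cons Cons.prems by auto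
    ultimately have "prime_chain (Suc (length As - 1)) P (last As)" using Cons.prems unfolding prime_chain.simps by auto
    then show ?thesis using Cons by simp
  qed (use Cons in auto)
qed simp

lemma list_of_prime_chain: "prime_chain k P Q \<Longrightarrow> \<exists>As. length As = Suc k \<and> hd As = P \<and> (\<forall>P'\<in>set As. primeideal P' R \<and> P \<subseteq> P') \<and> sorted_wrt (\<subset>) As"
proof (induction k arbitrary: P)
  case 0
  then show ?case by (intro exI[of _ "[P]"]) auto
next
  case (Suc k)
  then obtain P' where P': "primeideal P R" "P \<subset> P'" "prime_chain k P' Q" by auto
  obtain As where As: "length As = Suc k" "hd As = P'" "\<forall>P''\<in>set As. primeideal P'' R \<and> P' \<subseteq> P''" "sorted_wrt (\<subset>) As"
    using Suc.IH[OF P'(3)] by blast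
  then show ?case using P' by (intro exI[of _ "P # As"]) auto
qed

text \<open>The dimension of the closed set V(I), that is of R/I, expressed by primes of R.\<close>

definition vdim where "vdim I = sup_chain_length {P. primeideal P R \<and> I \<subseteq> P}"

lemma prime_chain_le_vdim: assumes "prime_chain k P Q" "I \<subseteq> P" shows "enat k \<le> vdim I"
proof -
  obtain As where As: "length As = Suc k" "\<forall>P'\<in>set As. primeideal P' R \<and> P \<subseteq> P'" "sorted_wrt (\<subset>) As"
    using list_of_prime_chain[OF assms(1)] by blast
  then have "enat (length As - 1) \<le> vdim I"
    unfolding vdim_def using assms(2) by (intro sup_chain_length_ge) auto
  then show ?thesis using As by simp
qed

lemma vdim_le: assumes "\<And>k P Q. prime_chain k P Q \<Longrightarrow> I \<subseteq> P \<Longrightarrow> enat k \<le> b" shows "vdim I \<le> b"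
  unfolding vdim_def
proof (rule sup_chain_length_least)
  fix As assume As: "As \<noteq> []" "set As \<subseteq> {P. primeideal P R \<and> I \<subseteq> P}" "sorted_wrt (\<subset>) As"
  have "prime_chain (length As - 1) (hd As) (last As)" using As by (intro prime_chain_of_list) auto
  moreover have "I \<subseteq> hd As" using As hd_in_set[OF As(1)] by blast
  ultimately show "enat (length As - 1) \<le> b" by (rule assms)
qed

end

context local_fg_module
begin

lemma vdim_finite: obtains d where "vdim I = enat d"
proof -
  obtain d where d: "\<And>k P Q. prime_chain k P Q \<Longrightarrow> k \<le> d" using prime_chain_bounded by blast
  then have "vdim I \<le> enat d" by (intro vdim_le) auto
  then show ?thesis using that enat_ile by blast
qed

lemma schain_of_list: "As \<noteq> [] \<Longrightarrow> (\<forall>A\<in>set As. sub A) \<Longrightarrow> sorted_wrt (\<subset>) As \<Longrightarrow>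
  schain (carrier R - \<mm>) (length As - 1) (hd As) \<M>"
proof (induction As)
  case (Cons A As)
  show ?case
  proof (cases As)
    case Nil
    then show ?thesis using Cons.prems carrier_is_submodule sub_subset by auto
  next
    case (Cons B Bs)
    then have c: "schain (carrier R - \<mm>) (length As - 1) (hd As) \<M>" using Cons.IH Cons.prems by auto
    have "A \<subset> hd As" "sub A" "sub (hd As)" using Cons Cons.prems by auto
    then have "schain (carrier R - \<mm>) (Suc (length As - 1)) A \<M>" using c sstep_iff unfolding schain.simps by blast
    then show ?thesis using Cons by simp
  qed
qed simp

lemma list_of_schain: "schain (carrier R - \<mm>) k A \<M> \<Longrightarrow> \<exists>As. length As = Suc k \<and> hd As = A \<and> (\<forall>B\<in>set As. sub B \<and> A \<subseteq> B) \<and> sorted_wrt (\<subset>) As"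
proof (induction k arbitrary: A)
  case 0
  then show ?case by (intro exI[of _ "[A]"]) auto
next
  case (Suc k)
  then obtain B where B: "sub A" "sstep (carrier R - \<mm>) A B" "schain (carrier R - \<mm>) k B \<M>" by auto
  then have lt: "A \<subset> B" using sstep_iff schain_sub by blast
  obtain As where As: "length As = Suc k" "hd As = B" "\<forall>C\<in>set As. sub C \<and> B \<subseteq> C" "sorted_wrt (\<subset>) As"
    using Suc.IH[OF B(3)] by blast
  then show ?case using B lt by (intro exI[of _ "A # As"]) auto
qed

lemma module_length_finite_iff: assumes N: "sub N"
  shows "module_length R (mquot N) < \<infinity> \<longleftrightarrow> m_primary N"
proof
  assume "module_length R (mquot N) < \<infinity>"
  then obtain n where n: "sup_chain_length {C. sub C \<and> N \<subseteq> C} = enat n"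
    unfolding module_length_quot[OF N] by auto
  have "k \<le> n" if k: "schain (carrier R - \<mm>) k N \<M>" for k
  proof -
    obtain As where As: "length As = Suc k" "\<forall>B\<in>set As. sub B \<and> N \<subseteq> B" "sorted_wrt (\<subset>) As"
      using list_of_schain[OF k] by blast
    then have "enat (length As - 1) \<le> enat n"
      unfolding n[symmetric] by (intro sup_chain_length_ge) auto
    then show ?thesis using As by simp
  qed
  then have "bounded_schain (carrier R - \<mm>) N \<M>" unfolding bounded_schain_def by blast
  then show "m_primary N" by (rule bounded_imp_m_primary[OF N])
next
  assume "m_primary N"
  then obtain n where n: "\<And>k. schain (carrier R - \<mm>) k N \<M> \<Longrightarrow> k \<le> n"
    using m_primary_imp_bounded[OF N] unfolding bounded_schain_def by blast
  have le: "sup_chain_length {C. sub C \<and> N \<subseteq> C} \<le> enat n"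
  proof (rule sup_chain_length_least)
    fix As assume As: "As \<noteq> []" "set As \<subseteq> {C. sub C \<and> N \<subseteq> C}" "sorted_wrt (\<subset>) As"
    have "schain (carrier R - \<mm>) (length As - 1) (hd As) \<M>" using As by (intro schain_of_list) auto
    then have "schain (carrier R - \<mm>) (length As - 1) N \<M>"
      using schain_mono[OF _ N] As hd_in_set[OF As(1)] by blast
    then show "enat (length As - 1) \<le> enat n" using n by simp
  qed
  show "module_length R (mquot N) < \<infinity>" unfolding module_length_quot[OF N]
    using le_less_trans[OF le, of \<infinity>] by simp
qed

lemma module_dim_eq: "module_dim R M = vdim (ann_quot {\<zero>\<^sub>M})"
  unfolding module_dim_def annihilator_eq vdim_def
  by (rule krull_dim_quot) (intro ann_quot_ideal sub_zero_module)

lemma module_dim_quot: assumes "sub N" shows "module_dim R (mquot N) = vdim (ann_quot N)"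
  unfolding module_dim_def annihilator_quot[OF assms] vdim_def
  by (rule krull_dim_quot) (intro ann_quot_ideal assms)

lemma system_of_parameters_iff:
  "system_of_parameters R \<mm> M xs \<longleftrightarrow>
    enat (length xs) = vdim (ann_quot {\<zero>\<^sub>M}) \<and> set xs \<subseteq> \<mm> \<and> m_primary (ext {\<zero>\<^sub>M} (set xs))"
proof (cases "set xs \<subseteq> \<mm>")
  case True
  then have c: "set xs \<subseteq> carrier R" using m_carr by auto
  then have "sub (ext {\<zero>\<^sub>M} (set xs))" by (intro ext_sub sub_zero_module)
  then show ?thesis
    unfolding system_of_parameters_def module_dim_eq seq_smult_eq[OF c] using module_length_finite_iff by simp
qed (auto simp: system_of_parameters_def)

end

context module
begin

section \<open>Powers of parameter ideals\<close>

definition mul_gen where "mul_gen X N = gen_submodule R M {x \<bullet> w |x w. x \<in> X \<and> w \<in> N}"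

lemma mul_gen_sub: "X \<subseteq> carrier R \<Longrightarrow> sub N \<Longrightarrow> sub (mul_gen X N)"
  unfolding mul_gen_def using sub_carr by (intro gen_sub) auto

lemma mul_gen_prod: "x \<in> X \<Longrightarrow> w \<in> N \<Longrightarrow> x \<bullet> w \<in> mul_gen X N"
  unfolding mul_gen_def using gen_self[of "{x \<bullet> w |x w. x \<in> X \<and> w \<in> N}"] by auto

lemma mul_gen_least: "sub C \<Longrightarrow> (\<And>x w. x \<in> X \<Longrightarrow> w \<in> N \<Longrightarrow> x \<bullet> w \<in> C) \<Longrightarrow> mul_gen X N \<subseteq> C"
  unfolding mul_gen_def by (rule gen_least) auto

text \<open>This is \<open>(x\<^sub>1, \<dots>, x\<^sub>k)\<^sup>nM\<close>, see \<open>ideal_smult_pow\<close>; the monomials are split according to whether they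
  involve the first generator.\<close>

fun pow_smult where
  "pow_smult [] 0 = \<M>"
| "pow_smult [] (Suc n) = {\<zero>\<^sub>M}"
| "pow_smult (x # xs) 0 = \<M>"
| "pow_smult (x # xs) (Suc n) = ((\<lambda>v. x \<bullet> v) ` pow_smult (x # xs) n) +\<^sub>M pow_smult xs (Suc n)"

lemma pow_smult_0: "pow_smult xs 0 = \<M>"
  by (cases xs) auto

lemma pow_smult_sub: "set xs \<subseteq> carrier R \<Longrightarrow> sub (pow_smult xs n)"
  by (induction xs n rule: pow_smult.induct) (auto intro: carrier_is_submodule sub_zero_module add_sub times_sub)

lemma pow_smult_tail_le: "set (x # xs) \<subseteq> carrier R \<Longrightarrow> pow_smult xs n \<subseteq> pow_smult (x # xs) n"
proof (cases n)
  case (Suc m)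
  assume c: "set (x # xs) \<subseteq> carrier R"
  then have "sub ((\<lambda>v. x \<bullet> v) ` pow_smult (x # xs) m)" "sub (pow_smult xs (Suc m))" by (auto intro!: times_sub pow_smult_sub)
  then show ?thesis using add_le(2) Suc by simp
qed (auto simp: pow_smult_0)

text \<open>The recursion prefers the first generator; this symmetric form gives the comparison with
  powers of the ideal and hence independence of the chosen generators.\<close>

lemma pow_smult_Suc: "set xs \<subseteq> carrier R \<Longrightarrow> pow_smult xs (Suc n) = mul_gen (set xs) (pow_smult xs n)"
proof (induction xs arbitrary: n)
  case Nil
  have "mul_gen {} (pow_smult [] n) \<subseteq> {\<zero>\<^sub>M}" by (rule mul_gen_least[OF sub_zero_module]) auto
  moreover have "\<zero>\<^sub>M \<in> mul_gen {} (pow_smult [] n)" by (rule sub_zero, rule mul_gen_sub) (auto intro: pow_smult_sub)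
  ultimately show ?case by auto
next
  case (Cons x xs)
  have c: "x \<in> carrier R" "set xs \<subseteq> carrier R" using Cons.prems by auto
  note Q = pow_smult_sub[OF Cons.prems]
  note QT = pow_smult_sub[OF c(2)]
  have le1: "(\<lambda>v. x \<bullet> v) ` pow_smult (x # xs) n \<subseteq> pow_smult (x # xs) (Suc n)"
    and le2: "pow_smult xs (Suc n) \<subseteq> pow_smult (x # xs) (Suc n)" for n
    unfolding pow_smult.simps by (rule add_le[OF times_sub[OF c(1) Q] QT])+
  have mem: "y \<bullet> w \<in> pow_smult (x # xs) (Suc n)" if "y \<in> set (x # xs)" "w \<in> pow_smult (x # xs) n" for y w n
    using that
  proof (induction n arbitrary: w)
    case 0
    show ?case
    proof (cases "y = x")
      case True
      then show ?thesis using 0 le1[of 0] by blast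
    next
      case False
      then have "y \<bullet> w \<in> pow_smult xs (Suc 0)" using 0 Cons.IH[OF c(2), of 0] mul_gen_prod[of y "set xs" w "pow_smult xs 0"] by (auto simp: pow_smult_0)
      then show ?thesis using le2[of 0] by blast
    qed
  next
    case (Suc n)
    show ?case
    proof (cases "y = x")
      case True
      then show ?thesis using Suc.prems le1[of "Suc n"] by blast
    next
      case False
      then have y: "y \<in> set xs" "y \<in> carrier R" using Suc.prems c by auto
      \<comment> \<open>Commuting y past x leaves y w' of lower degree in the first summand, and y
        w'' involves only tail generators; one induction hypothesis serves each.\<close>
      obtain w' w'' where w: "w' \<in> pow_smult (x # xs) n" "w'' \<in> pow_smult xs (Suc n)" "w = x \<bullet> w' \<oplus>\<^sub>M w''"
        using Suc.prems(2) by (auto simp: set_add_def')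
      have wc: "w' \<in> \<M>" "w'' \<in> \<M>" using w sub_carr[OF Q] sub_carr[OF QT] by auto
      have "y \<bullet> w = x \<bullet> y \<bullet> w' \<oplus>\<^sub>M y \<bullet> w''"
        using w wc y c by (simp add: smult_r_distr smult_comm[of y x])
      moreover have "y \<bullet> w' \<in> pow_smult (x # xs) (Suc n)" using Suc.IH[OF Suc.prems(1) w(1)] .
      moreover have "y \<bullet> w'' \<in> pow_smult xs (Suc (Suc n))"
        using Cons.IH[OF c(2), of "Suc n"] mul_gen_prod[OF y(1) w(2)] by simp
      ultimately show ?thesis unfolding pow_smult.simps(4)[of x xs "Suc n"] set_add_def' by blast
    qed
  qed
  show ?case
  proof
    have s: "sub (mul_gen (set (x # xs)) (pow_smult (x # xs) n))" by (rule mul_gen_sub[OF Cons.prems Q])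
    show "mul_gen (set (x # xs)) (pow_smult (x # xs) n) \<subseteq> pow_smult (x # xs) (Suc n)" by (rule mul_gen_least[OF Q mem])
    have "pow_smult xs (Suc n) \<subseteq> mul_gen (set (x # xs)) (pow_smult (x # xs) n)"
      unfolding Cons.IH[OF c(2)]
      by (rule mul_gen_least[OF s]) (use pow_smult_tail_le[OF Cons.prems, of n] in \<open>auto intro!: mul_gen_prod\<close>)
    then show "pow_smult (x # xs) (Suc n) \<subseteq> mul_gen (set (x # xs)) (pow_smult (x # xs) n)"
      unfolding pow_smult.simps by (intro add_least[OF s]) (auto intro!: mul_gen_prod)
  qed
qed

lemma pow_smult_antimono: assumes "set xs \<subseteq> carrier R" "k \<le> n" shows "pow_smult xs n \<subseteq> pow_smult xs k"
proof (rule lift_Suc_antimono_le[of "pow_smult xs", OF _ assms(2)])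
  fix j
  show "pow_smult xs (Suc j) \<subseteq> pow_smult xs j" unfolding pow_smult_Suc[OF assms(1)]
    using assms(1) pow_smult_sub[OF assms(1), of j] by (intro mul_gen_least) (auto intro: sub_smult)
qed

lemma ideal_pow_carr: assumes "ideal I R" shows "ideal (I [^]\<^bsub>ideals_set R\<^esub> (n::nat)) R"
proof (induction n)
  case 0
  then show ?case by (simp add: ideals_set_def R.oneideal)
next
  case (Suc n)
  then show ?case using R.ideal_prod_is_ideal[OF Suc assms] by (simp add: ideals_set_def)
qed

text \<open>Both sides obey the recursion of \<open>pow_smult_Suc\<close>. For the ideal power this
  holds because the factor from the ideal may be restricted to generators.\<close>

lemma ideal_smult_pow:
  assumes xs: "set xs \<subseteq> carrier R"
  shows "ideal_smult R M ((Idl (set xs)) [^]\<^bsub>ideals_set R\<^esub> (n::nat)) \<M> = pow_smult xs n"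
proof (induction n)
  let ?I = "Idl (set xs)"
  have I: "ideal ?I R" by (rule R.genideal_ideal[OF xs])
  {
    case 0
    have "\<M> \<subseteq> gen_submodule R M {a \<bullet> x |a x. a \<in> carrier R \<and> x \<in> \<M>}"
    proof
      fix v assume "v \<in> \<M>"
      then have "\<one> \<bullet> v \<in> {a \<bullet> x |a x. a \<in> carrier R \<and> x \<in> \<M>}" by blast
      then show "v \<in> gen_submodule R M {a \<bullet> x |a x. a \<in> carrier R \<and> x \<in> \<M>}"
        using gen_self[of "{a \<bullet> x |a x. a \<in> carrier R \<and> x \<in> \<M>}"] \<open>v \<in> \<M>\<close> by auto
    qed
    moreover have "gen_submodule R M {a \<bullet> x |a x. a \<in> carrier R \<and> x \<in> \<M>} \<subseteq> \<M>"
      by (rule gen_least[OF carrier_is_submodule]) auto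
    ultimately show ?case by (simp add: ideal_smult_def pow_smult_0 ideals_set_def)
  next
    case (Suc n)
    let ?In = "?I [^]\<^bsub>ideals_set R\<^esub> n"
    let ?P = "ideal_smult R M ?In \<M>" and ?P' = "ideal_smult R M (?In \<cdot> ?I) \<M>"
    have In: "ideal ?In R" by (rule ideal_pow_carr[OF I])
    have PI: "ideal (?In \<cdot> ?I) R" by (rule R.ideal_prod_is_ideal[OF In I])
    have P: "sub ?P" unfolding ideal_smult_def using ideal.Icarr[OF In] by (intro gen_sub) auto
    have P': "sub ?P'" unfolding ideal_smult_def using ideal.Icarr[OF PI] by (intro gen_sub) auto
    have m: "sub (mul_gen (set xs) ?P)" by (rule mul_gen_sub[OF xs P])
    have "?P' = mul_gen (set xs) ?P"
    proof
      have "a \<bullet> v \<in> mul_gen (set xs) ?P" if a: "a \<in> ?In \<cdot> ?I" and v: "v \<in> \<M>" for a v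
        using a
      proof (induction a rule: ideal_prod.induct)
        case (prod i j)
        have c: "i \<in> carrier R" "j \<in> carrier R" using prod ideal.Icarr[OF In] ideal.Icarr[OF I] by auto
        have iv: "i \<bullet> v \<in> ?P" unfolding ideal_smult_def
          using gen_self[of "{a \<bullet> x |a x. a \<in> ?In \<and> x \<in> \<M>}"] prod(1) v by auto
        have "j \<bullet> i \<bullet> v \<in> mul_gen (set xs) ?P"
        proof (rule Idl_smult_mem[OF m _ xs _ prod(2)])
          show "i \<bullet> v \<in> \<M>" using c v by simp
          show "g \<bullet> i \<bullet> v \<in> mul_gen (set xs) ?P" if "g \<in> set xs" for g using mul_gen_prod[OF that iv] .
        qed
        then show ?case using c v by (simp add: smult_assoc1 smult_comm[of i j])
      next
        case (sum s1 s2)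
        have "s1 \<in> carrier R" "s2 \<in> carrier R" using sum(1,2) ideal.Icarr[OF PI] by auto
        then show ?case using sum sub_add[OF m] v by (simp add: smult_l_distr)
      qed
      then show "?P' \<subseteq> mul_gen (set xs) ?P" unfolding ideal_smult_def[of R M "?In \<cdot> ?I"] by (intro gen_least[OF m]) auto
      show "mul_gen (set xs) ?P \<subseteq> ?P'"
      proof (rule mul_gen_least[OF P'])
        fix x w assume x: "x \<in> set xs" and w: "w \<in> ?P"
        have xR: "x \<in> carrier R" using x xs by auto
        have "?P \<subseteq> colon ?P' x"
          unfolding ideal_smult_def[of R M ?In]
        proof (rule gen_least[OF colon_sub[OF P' xR]], rule subsetI)
          fix y assume "y \<in> {a \<bullet> x |a x. a \<in> ?In \<and> x \<in> \<M>}"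
          then obtain a v where y: "y = a \<bullet> v" "a \<in> ?In" "v \<in> \<M>" by auto
          have aR: "a \<in> carrier R" using y ideal.Icarr[OF In] by auto
          have "a \<otimes> x \<in> ?In \<cdot> ?I" using y(2) R.genideal_self[OF xs] x by (intro ideal_prod.prod) auto
          then have "(a \<otimes> x) \<bullet> v \<in> ?P'" unfolding ideal_smult_def
            using gen_self[of "{a \<bullet> x |a x. a \<in> ?In \<cdot> ?I \<and> x \<in> \<M>}"] y(3) by auto
          then show "y \<in> colon ?P' x" using y aR xR by (simp add: colon_def smult_assoc1 smult_comm[of x a])
        qed
        then show "x \<bullet> w \<in> ?P'" using w by (auto simp: colon_def)
      qed
    qed
    then show ?case using Suc pow_smult_Suc[OF xs, of n] by (simp add: ideals_set_def)
  }
qed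

lemma pow_smult_cong: "set xs \<subseteq> carrier R \<Longrightarrow> set ys \<subseteq> carrier R \<Longrightarrow> Idl (set xs) = Idl (set ys) \<Longrightarrow> pow_smult xs n = pow_smult ys n"
  using ideal_smult_pow[of xs n] ideal_smult_pow[of ys n] by simp

definition powers where "powers xs \<alpha> = map2 (\<lambda>x k. x [^] (k::nat)) xs \<alpha>"

lemma powers_simps [simp]: "powers [] \<alpha> = []" "powers (x # xs) (k # \<alpha>) = x [^] k # powers xs \<alpha>"
  by (auto simp: powers_def)

lemma powers_length: "length \<alpha> = length xs \<Longrightarrow> length (powers xs \<alpha>) = length xs"
  by (simp add: powers_def)

lemma powers_carr: "set xs \<subseteq> carrier R \<Longrightarrow> set (powers xs \<alpha>) \<subseteq> carrier R"
  unfolding powers_def by (auto dest!: set_zip_leftD)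

text \<open>Pigeonhole: a monomial whose degree n exceeds the sum of all \<alpha>_i - 1 has some
  exponent at least \<alpha>_i. The bound is an inequality because passing to the tail leaves slack
  when the first entry exceeds 1.\<close>

lemma pow_smult_le_ext_powers:
  "set xs \<subseteq> carrier R \<Longrightarrow> length \<alpha> = length xs \<Longrightarrow> (\<forall>a\<in>set \<alpha>. 1 \<le> a) \<Longrightarrow> sum_list \<alpha> + 1 \<le> length xs + n \<Longrightarrow>
    pow_smult xs n \<subseteq> ext {\<zero>\<^sub>M} (set (powers xs \<alpha>))"
proof (induction xs n arbitrary: \<alpha> rule: pow_smult.induct)
  case (2 n)
  then show ?case using ext_base by auto
next
  case (3 x xs)
  \<comment> \<open>For n = 0 the degree bound contradicts the positivity of the exponents.\<close>
  have "length \<alpha> \<le> sum_list \<alpha>" using 3(3) by (induction \<alpha>) auto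
  then show ?case using 3 by auto
next
  case (4 x xs n)
  then obtain j \<beta> where \<alpha>: "\<alpha> = j # \<beta>" by (cases \<alpha>) auto
  have c: "x \<in> carrier R" "set xs \<subseteq> carrier R" using 4 by auto
  have j: "1 \<le> j" and \<beta>: "length \<beta> = length xs" "\<forall>a\<in>set \<beta>. 1 \<le> a" using 4 \<alpha> by auto
  let ?E = "ext {\<zero>\<^sub>M} (set (powers (x # xs) \<alpha>))" and ?B = "ext {\<zero>\<^sub>M} (set (powers xs \<beta>))"
  have E: "sub ?E" using powers_carr[OF 4(3)] by (intro ext_sub sub_zero_module)
  have B: "sub ?B" using powers_carr[OF c(2)] by (intro ext_sub sub_zero_module)
  have BE: "?B \<subseteq> ?E" using powers_carr[OF 4(3), of \<alpha>] \<alpha> by (intro ext_mono sub_zero_module) auto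
  have e: "ext {\<zero>\<^sub>M} (set (powers (x # xs) (k # \<beta>))) = ext ?B {x [^] k}" for k
    using c powers_carr[OF c(2), of \<beta>] ext_insert_eq(1)[OF sub_zero_module] by simp
  have "(\<lambda>v. x \<bullet> v) ` pow_smult (x # xs) n \<subseteq> ?E"
  proof (cases "j = 1")
    case True
    then have "x \<in> set (powers (x # xs) \<alpha>)" using \<alpha> c by simp
    then show ?thesis using sub_carr[OF pow_smult_sub[OF 4(3)]] by (auto intro: ext_prod)
  next
    case False
    have *: "pow_smult (x # xs) n \<subseteq> ext ?B {x [^] (j - 1)}"
      unfolding e[symmetric] using 4(3-6) \<alpha> False j by (intro 4(1)) auto
    show ?thesis
    proof (rule image_subsetI)
      fix v assume "v \<in> pow_smult (x # xs) n"
      then obtain u where u: "u \<in> \<M>" "congr ?B v (x [^] (j - 1) \<bullet> u)" using * ext_singleE[OF _ B] c by blast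
      have "congr ?B (x \<bullet> v) (x \<bullet> x [^] (j - 1) \<bullet> u)" by (rule congr_smult[OF B c(1) u(2)])
      also have "x \<bullet> x [^] (j - 1) \<bullet> u = x [^] j \<bullet> u" using pow_Suc_smult[OF c(1) u(1), of "j - 1"] j by (simp del: R.nat_pow_Suc)
      finally show "x \<bullet> v \<in> ?E" unfolding \<alpha> e using u(1) B c by (auto simp: ext_single_iff)
    qed
  qed
  moreover have "pow_smult xs (Suc n) \<subseteq> ?B" using 4(3-6) \<alpha> j by (intro 4(2)) auto
  ultimately show ?case unfolding pow_smult.simps using BE by (intro add_least[OF E]) auto
qed (auto)

lemma Lambda_set_iff: "\<alpha> \<in> Lambda_set d n \<longleftrightarrow> length \<alpha> = d \<and> (\<forall>a\<in>set \<alpha>. 1 \<le> a) \<and> sum_list \<alpha> = d + n - 1"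
  unfolding Lambda_set_def by (auto simp: all_set_conv_all_nth)

lemma pow_smult_le_ext_Lambda:
  assumes "set xs \<subseteq> carrier R" "1 \<le> n" "\<alpha> \<in> Lambda_set (length xs) n"
  shows "pow_smult xs n \<subseteq> ext {\<zero>\<^sub>M} (set (powers xs \<alpha>))"
  using assms by (intro pow_smult_le_ext_powers) (auto simp: Lambda_set_iff)

lemma parametric_decomposition_iff:
  assumes xs: "set xs \<subseteq> carrier R"
  shows "parametric_decomposition R M xs \<longleftrightarrow>
    (\<forall>n\<ge>1. pow_smult xs n = (\<Inter>\<alpha>\<in>Lambda_set (length xs) n. ext {\<zero>\<^sub>M} (set (powers xs \<alpha>))))"
proof -
  have "seq_smult R M (map2 (\<lambda>x k. x [^] (k::nat)) xs \<alpha>) = ext {\<zero>\<^sub>M} (set (powers xs \<alpha>))" for \<alpha>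
    unfolding powers_def[symmetric] by (rule seq_smult_eq[OF powers_carr[OF xs]])
  then show ?thesis unfolding parametric_decomposition_def ideal_smult_pow[OF xs] by auto
qed

text \<open>All systems of powers at once: the induction over the sequence meets components with
  arbitrary exponents, and \<open>rseq_exchange\<close> supplies them all.\<close>

definition regular_powers where
  "regular_powers B xs \<longleftrightarrow> (\<forall>\<alpha>. length \<alpha> = length xs \<longrightarrow> (\<forall>a\<in>set \<alpha>. 1 \<le> a) \<longrightarrow> rseq B (powers xs \<alpha>))"

end

section \<open>Decomposition for regular sequences\<close>

context local_fg_module
begin

lemma pow_m: "x \<in> \<mm> \<Longrightarrow> 1 \<le> k \<Longrightarrow> x [^] (k::nat) \<in> \<mm>"
  by (cases k) (auto simp: m_carr I_l_closed)

lemma powers_m: "set xs \<subseteq> \<mm> \<Longrightarrow> length \<alpha> = length xs \<Longrightarrow> (\<forall>a\<in>set \<alpha>. 1 \<le> a) \<Longrightarrow> set (powers xs \<alpha>) \<subseteq> \<mm>"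
proof
  fix y assume h: "set xs \<subseteq> \<mm>" "\<forall>a\<in>set \<alpha>. 1 \<le> a" and "y \<in> set (powers xs \<alpha>)"
  then obtain x k where xk: "(x, k) \<in> set (zip xs \<alpha>)" "y = x [^] k" unfolding powers_def by auto
  then have "x \<in> \<mm>" "1 \<le> k" using set_zip_leftD[OF xk(1)] set_zip_rightD[OF xk(1)] h by auto
  then show "y \<in> \<mm>" using pow_m xk by simp
qed

text \<open>The induction on the sequence, applied modulo B + x^j M, places v in B + x^j M +
  (xs)^(n+1-j) M for 1 <= j <= n. The inner induction \<open>key\<close> recombines these
  memberships into B + (x, xs)^n M.\<close>

lemma regular_powers_decomposition:
  "sub B \<Longrightarrow> set xs \<subseteq> \<mm> \<Longrightarrow> xs \<noteq> [] \<Longrightarrow> regular_powers B xs \<Longrightarrow> 1 \<le> n \<Longrightarrow> v \<in> \<M> \<Longrightarrow>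
    (\<And>\<alpha>. \<alpha> \<in> Lambda_set (length xs) n \<Longrightarrow> v \<in> ext B (set (powers xs \<alpha>))) \<Longrightarrow> v \<in> B +\<^sub>M pow_smult xs n"
proof (induction xs arbitrary: B n v)
  case (Cons x xs)
  have c: "x \<in> carrier R" "set xs \<subseteq> carrier R" "set (x # xs) \<subseteq> carrier R" using Cons.prems m_carr by auto
  note B = Cons.prems(1)
  note QT = pow_smult_sub[OF c(2)] and Q = pow_smult_sub[OF c(3)]
  have sB: "sub (B +\<^sub>M pow_smult xs k)" for k by (rule add_sub[OF B QT])
  have rq: "rseq B (x [^] j # powers xs \<alpha>)" if "1 \<le> j" "length \<alpha> = length xs" "\<forall>a\<in>set \<alpha>. 1 \<le> a" for j :: nat and \<alpha>
    using Cons.prems(4)[unfolded regular_powers_def, rule_format, of "j # \<alpha>"] that by auto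
  have rx: "reg (ext B (set (powers xs \<alpha>))) x" if \<alpha>: "length \<alpha> = length xs" "\<forall>a\<in>set \<alpha>. 1 \<le> a" for \<alpha>
  proof -
    have "rseq B (x # powers xs \<alpha>)" using rq[of 1] \<alpha> c by simp
    then have "rseq B (powers xs \<alpha> @ [x])"
      using rseq_rotate[OF B, of x "powers xs \<alpha>"] Cons.prems(2) powers_m[of xs \<alpha>] \<alpha> by auto
    then show ?thesis using rseq_append[OF B powers_carr[OF c(2)]] by auto
  qed
  \<comment> \<open>By the induction hypothesis B + (xs)^k M is an intersection of components B +
    (xs^\<alpha>)M, and x is regular modulo each of them, as rotating it to the end of the sequence
    shows.\<close>
  have regQ: "reg (B +\<^sub>M pow_smult xs k) x" if k: "1 \<le> k" for k
  proof (cases "xs = []")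
    case True
    then have "pow_smult xs k = {\<zero>\<^sub>M}" using k by (cases k) auto
    then have "B +\<^sub>M pow_smult xs k = B" using sub_zero[OF B] add_le(1)[OF B sub_zero_module] add_least[OF B, of B "{\<zero>\<^sub>M}"] by auto
    then show ?thesis using rx[of "[]"] True B by (simp add: ext_empty)
  next
    case False
    show ?thesis unfolding reg_def
    proof (intro ballI impI)
      fix w assume w: "w \<in> \<M>" "x \<bullet> w \<in> B +\<^sub>M pow_smult xs k"
      show "w \<in> B +\<^sub>M pow_smult xs k"
      proof (rule Cons.IH[OF B _ False _ k w(1)])
        show "regular_powers B xs" unfolding regular_powers_def
        proof (intro allI impI)
          fix \<alpha> :: "nat list" assume \<alpha>: "length \<alpha> = length xs" "\<forall>a\<in>set \<alpha>. 1 \<le> a"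
          have "rseq B (x # powers xs \<alpha>)" using rq[of 1] \<alpha> c by simp
          then have "rseq B (powers xs \<alpha> @ [x])"
            using rseq_rotate[OF B, of x "powers xs \<alpha>"] Cons.prems(2) powers_m[of xs \<alpha>] \<alpha> by auto
          then show "rseq B (powers xs \<alpha>)" using rseq_append[OF B powers_carr[OF c(2)]] by auto
        qed
        fix \<alpha> assume \<alpha>: "\<alpha> \<in> Lambda_set (length xs) k"
        let ?E = "ext B (set (powers xs \<alpha>))"
        have E: "sub ?E" using B powers_carr[OF c(2)] by (intro ext_sub)
        have "ext {\<zero>\<^sub>M} (set (powers xs \<alpha>)) \<subseteq> ?E" using B powers_carr[OF c(2)] sub_zero[OF B] by (intro ext_mono) auto
        then have "B +\<^sub>M pow_smult xs k \<subseteq> ?E"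
          using pow_smult_le_ext_Lambda[OF c(2) k \<alpha>] ext_base[of B] by (intro add_least[OF E]) auto
        then show "w \<in> ?E" using rx[of \<alpha>] \<alpha> w by (auto simp: reg_def Lambda_set_iff)
      qed (use Cons.prems in auto)
    qed
  qed
  \<comment> \<open>The membership for j = 1 gives v = xu modulo B + (xs)^n M. Cancelling the
    regular x turns the membership of v for j + 1 into that of u for j, with n lowered by 1.\<close>
  have key: "v \<in> B +\<^sub>M pow_smult (x # xs) n"
    if "v \<in> \<M>" "\<And>j. 1 \<le> j \<Longrightarrow> j \<le> n \<Longrightarrow> v \<in> ext (B +\<^sub>M pow_smult xs (n + 1 - j)) {x [^] j}" for n v
    using that
  proof (induction n arbitrary: v)
    case 0
    then show ?case using add_le(2)[OF B carrier_is_submodule] by (auto simp: pow_smult_0)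
  next
    case (Suc n)
    let ?K = "\<lambda>k. B +\<^sub>M pow_smult xs k"
    have "v \<in> ext (?K (Suc n)) {x}" using Suc.prems(2)[of 1] c by simp
    then obtain u where u: "u \<in> \<M>" "congr (?K (Suc n)) v (x \<bullet> u)" using ext_singleE[OF _ sB c(1)] by blast
    have "u \<in> B +\<^sub>M pow_smult (x # xs) n"
    proof (rule Suc.IH[OF u(1)])
      fix j assume j: "1 \<le> j" "j \<le> n"
      let ?k = "n + 1 - j"
      have "v \<in> ext (?K ?k) {x [^] Suc j}" using Suc.prems(2)[of "Suc j"] j by (simp del: R.nat_pow_Suc)
      then obtain u' where u': "u' \<in> \<M>" "congr (?K ?k) v (x [^] Suc j \<bullet> u')"
        using ext_singleE[OF _ sB, of v ?k "x [^] Suc j"] c by (metis R.nat_pow_closed)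
      have "?K (Suc n) \<subseteq> ?K ?k" using add_le[OF B QT[of ?k]] pow_smult_antimono[OF c(2), of ?k "Suc n"] j
        by (intro add_least[OF sB]) auto
      then have "congr (?K ?k) (x \<bullet> u) v" using congr_sym[OF sB congr_mono[OF u(2)]] by blast
      from congr_trans[OF sB this u'(2)] have "congr (?K ?k) (x \<bullet> u) (x \<bullet> x [^] j \<bullet> u')"
        using pow_Suc_smult[OF c(1) u'(1)] by simp
      then have "x \<bullet> (u \<ominus>\<^sub>M x [^] j \<bullet> u') \<in> ?K ?k" using u u' c by (simp add: congr_def smult_minus_distr)
      moreover have "reg (?K ?k) x" using j by (intro regQ) simp
      ultimately have "u \<ominus>\<^sub>M x [^] j \<bullet> u' \<in> ?K ?k" using u(1) u'(1) c unfolding reg_def by blast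
      then have "congr (?K ?k) u (x [^] j \<bullet> u')" using u(1) u'(1) c by (simp add: congr_def)
      then show "u \<in> ext (?K ?k) {x [^] j}" using u'(1) sB c by (auto simp: ext_single_iff)
    qed
    then obtain r where r: "r \<in> pow_smult (x # xs) n" "congr B u r" using add_mem_iff[OF B Q] by auto
    let ?T = "B +\<^sub>M pow_smult (x # xs) (Suc n)"
    have T: "sub ?T" by (rule add_sub[OF B Q])
    note lT = add_le[OF B Q[of "Suc n"]] and lQ = add_le[OF times_sub[OF c(1) Q[of n]] QT[of "Suc n"]]
    have "x \<bullet> r \<in> ?T" using lT(2) lQ(1) r(1) by auto
    moreover have "congr ?T (x \<bullet> u) (x \<bullet> r)" using congr_mono[OF congr_smult[OF B c(1) r(2)] lT(1)] .
    ultimately have "x \<bullet> u \<in> ?T" using congr_memI[OF T] by blast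
    moreover have "?K (Suc n) \<subseteq> ?T" using lT lQ by (intro add_least[OF T]) auto
    ultimately show ?case using congr_memI[OF T congr_mono[OF u(2)]] by blast
  qed
  show ?case
  proof (rule key[OF Cons.prems(6)])
    fix j assume j: "1 \<le> j" "j \<le> n"
    let ?k = "n + 1 - j"
    let ?Bj = "ext B {x [^] j}"
    have xj: "x [^] j \<in> carrier R" using c by auto
    have Bj: "sub ?Bj" using B xj by (intro ext_sub) auto
    have T: "sub (ext (B +\<^sub>M pow_smult xs ?k) {x [^] j})" using xj by (intro ext_sub sB) auto
    have BjT: "?Bj \<subseteq> ext (B +\<^sub>M pow_smult xs ?k) {x [^] j}"
      using xj add_le(1)[OF B QT] by (intro ext_mono sB) auto
    show "v \<in> ext (B +\<^sub>M pow_smult xs ?k) {x [^] j}"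
    proof (cases "xs = []")
      \<comment> \<open>\<open>Lambda_set 0 k\<close> is empty for k >= 2, so no induction
        hypothesis is available for the empty tail; the only component, with exponent n, gives the
        claim directly.\<close>
      case True
      have "[n] \<in> Lambda_set (length (x # xs)) n" using True Cons.prems(5) by (simp add: Lambda_set_iff)
      then have "v \<in> ext B {x [^] n}" using Cons.prems(7)[of "[n]"] True by simp
      then show ?thesis using ext_pow_le[OF B c(1) j(2)] BjT by blast
    next
      case False
      have "v \<in> ?Bj +\<^sub>M pow_smult xs ?k"
      proof (rule Cons.IH[OF Bj _ False])
        show "regular_powers ?Bj xs" unfolding regular_powers_def using rq[OF j(1)] by auto
        show "1 \<le> ?k" using j by simp
        fix \<alpha> assume "\<alpha> \<in> Lambda_set (length xs) ?k"
        then have "j # \<alpha> \<in> Lambda_set (length (x # xs)) n" using j by (auto simp: Lambda_set_iff)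
        then have "v \<in> ext B (insert (x [^] j) (set (powers xs \<alpha>)))" using Cons.prems(7)[of "j # \<alpha>"] by simp
        then show "v \<in> ext ?Bj (set (powers xs \<alpha>))" using ext_insert_eq(2)[OF B xj powers_carr[OF c(2)]] by simp
      qed (use Cons.prems in auto)
      moreover have "?Bj +\<^sub>M pow_smult xs ?k \<subseteq> ext (B +\<^sub>M pow_smult xs ?k) {x [^] j}"
        using BjT add_le(2)[OF B QT[of ?k]] ext_base[of "B +\<^sub>M pow_smult xs ?k"] by (intro add_least[OF T]) auto
      ultimately show ?thesis by blast
    qed
  qed
qed simp

text \<open>Some power of y maps M into N + zM, and so regularity passes from y to z.\<close>

lemma reg_of_m_primary:
  assumes "sub N" "y \<in> \<mm>" "reg N y" "z \<in> \<mm>" "m_primary (ext N {z})"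
  shows "reg N z"
proof -
  obtain t :: nat where "\<forall>v\<in>\<M>. y [^] t \<bullet> v \<in> ext N {z}" using assms by (auto simp: m_primary_def)
  then show ?thesis using reg_of_pow_multiple[OF assms(1) m_carr[OF assms(4)] m_carr[OF assms(2)] assms(3), of t] by blast
qed

text \<open>A common replacement \<open>z\<close> of the last elements of both sequences can be moved to the front, which
  reduces the claim to shorter sequences modulo \<open>zM\<close>.\<close>

lemma rseq_exchange:
  "sub B \<Longrightarrow> length ys = n \<Longrightarrow> length xs = n \<Longrightarrow> rseq B ys \<Longrightarrow> set ys \<subseteq> \<mm> \<Longrightarrow> set xs \<subseteq> \<mm> \<Longrightarrow>
    m_primary (ext B (set ys)) \<Longrightarrow> m_primary (ext B (set xs)) \<Longrightarrow> rseq B xs"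
proof (induction n arbitrary: B ys xs)
  case (Suc n)
  obtain ys' y where ys: "ys = ys' @ [y]" using Suc.prems(2) by (cases ys rule: rev_cases) auto
  obtain xs' x where xs: "xs = xs' @ [x]" using Suc.prems(3) by (cases xs rule: rev_cases) auto
  have m: "set ys' \<subseteq> \<mm>" "y \<in> \<mm>" "set xs' \<subseteq> \<mm>" "x \<in> \<mm>" using Suc.prems ys xs by auto
  have c: "set ys' \<subseteq> carrier R" "y \<in> carrier R" "set xs' \<subseteq> carrier R" "x \<in> carrier R" using m m_carr by auto
  note B = Suc.prems(1)
  let ?N1 = "ext B (set ys')" and ?N2 = "ext B (set xs')"
  have N: "sub ?N1" "sub ?N2" using B c by (auto intro: ext_sub)
  have e1: "ext ?N1 {w} = ext B (insert w (set ys'))" and e2: "ext ?N2 {w} = ext B (insert w (set xs'))" if "w \<in> \<mm>" for w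
    using ext_insert_eq(1)[OF B m_carr[OF that] c(1)] ext_insert_eq(1)[OF B m_carr[OF that] c(3)] by auto
  have mp: "m_primary (ext ?N1 {y})" "m_primary (ext ?N2 {x})" using Suc.prems(7,8) e1[OF m(2)] e2[OF m(4)] ys xs by auto
  obtain z where z: "z \<in> \<mm>" "m_primary (ext ?N1 {z})" "m_primary (ext ?N2 {z})"
    using exists_m_primary_replacement[OF N(1) m(2) mp(1) N(2) m(4) mp(2)] by blast
  have zR: "z \<in> carrier R" using z m_carr by auto
  have r: "rseq B ys'" "reg ?N1 y" using Suc.prems(4) rseq_append[OF B c(1)] ys by auto
  have "reg ?N1 z" using reg_of_m_primary[OF N(1) m(2) r(2) z(1,2)] .
  then have "rseq B (ys' @ [z])" using r rseq_append[OF B c(1)] by auto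
  then have "rseq B (z # ys')" using rseq_rotate[OF B z(1) m(1)] by simp
  then have rz: "reg B z" "rseq (ext B {z}) ys'" by auto
  have Bz: "sub (ext B {z})" using B zR by (intro ext_sub) auto
  have "rseq (ext B {z}) xs'"
  proof (rule Suc.IH[OF Bz _ _ rz(2) m(1,3)])
    show "length ys' = n" "length xs' = n" using Suc.prems ys xs by auto
    show "m_primary (ext (ext B {z}) (set ys'))" using z(2) e1[OF z(1)] ext_insert_eq(2)[OF B zR c(1)] by simp
    show "m_primary (ext (ext B {z}) (set xs'))" using z(3) e2[OF z(1)] ext_insert_eq(2)[OF B zR c(3)] by simp
  qed
  then have "rseq B (z # xs')" using rz by simp
  then have "rseq B (xs' @ [z])" using rseq_rotate[OF B z(1) m(3)] by simp
  then have r2: "rseq B xs'" "reg ?N2 z" using rseq_append[OF B c(3)] by auto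
  have "reg ?N2 x" using reg_of_m_primary[OF N(2) z(1) r2(2) m(4) mp(2)] .
  then show ?case using r2 rseq_append[OF B c(3)] xs by auto
qed simp

lemma m_primary_pow: assumes N: "sub N" and x: "x \<in> carrier R" and mp: "m_primary (ext N {x})"
  shows "m_primary (ext N {x [^] (k::nat)})"
  unfolding m_primary_def
proof
  fix a assume a: "a \<in> \<mm>"
  then obtain t :: nat where t: "\<forall>v\<in>\<M>. a [^] t \<bullet> v \<in> ext N {x}" using mp by (auto simp: m_primary_def)
  have "(a [^] t) [^] k \<bullet> v \<in> ext N {x [^] k}" if "v \<in> \<M>" for v
    using t a m_carr that by (intro pow_multiple[OF N x]) auto
  then have "a [^] (t * k) \<bullet> v \<in> ext N {x [^] k}" if "v \<in> \<M>" for v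
    using that a m_carr by (simp add: R.nat_pow_pow)
  then show "\<exists>t::nat. \<forall>v\<in>\<M>. a [^] t \<bullet> v \<in> ext N {x [^] k}" by blast
qed

lemma m_primary_pw: "sub B \<Longrightarrow> set xs \<subseteq> carrier R \<Longrightarrow> length \<alpha> = length xs \<Longrightarrow> m_primary (ext B (set xs)) \<Longrightarrow>
  m_primary (ext B (set (powers xs \<alpha>)))"
proof (induction xs arbitrary: B \<alpha>)
  case (Cons x xs)
  then obtain k \<beta> where \<alpha>: "\<alpha> = k # \<beta>" by (cases \<alpha>) auto
  have c: "x \<in> carrier R" "set xs \<subseteq> carrier R" "x [^] k \<in> carrier R" using Cons.prems by auto
  note B = Cons.prems(1)
  have E: "sub (ext B (set xs))" "sub (ext B {x [^] k})" using B c by (auto intro!: ext_sub)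
  have "m_primary (ext (ext B (set xs)) {x})" using Cons.prems(4) ext_insert_eq(1)[OF B c(1,2)] by simp
  then have "m_primary (ext (ext B (set xs)) {x [^] k})" by (rule m_primary_pow[OF E(1) c(1)])
  then have "m_primary (ext (ext B {x [^] k}) (set xs))" using ext_insert_eq[OF B c(3,2)] by simp
  then have "m_primary (ext (ext B {x [^] k}) (set (powers xs \<beta>)))" using Cons.IH[OF E(2) c(2)] Cons.prems \<alpha> by auto
  then show ?case using ext_insert_eq(2)[OF B c(3) powers_carr[OF c(2)]] \<alpha> by simp
qed simp

lemma ext_eq_add: assumes "sub B" "X \<subseteq> carrier R" shows "ext B X = ext {\<zero>\<^sub>M} X +\<^sub>M B"
proof
  have E: "sub (ext {\<zero>\<^sub>M} X)" "sub (ext B X)" using assms by (auto intro: ext_sub sub_zero_module)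
  note l = add_le[OF E(1) assms(1)]
  show "ext B X \<subseteq> ext {\<zero>\<^sub>M} X +\<^sub>M B"
    by (rule ext_least[OF add_sub[OF E(1) assms(1)] l(2)]) (use l(1) in \<open>auto intro!: ext_prod\<close>)
  show "ext {\<zero>\<^sub>M} X +\<^sub>M B \<subseteq> ext B X"
    using assms sub_zero[OF assms(1)] ext_base[of B X] by (intro add_least[OF E(2)] ext_mono) auto
qed

text \<open>Induction from the end: if h = xu modulo (xs)M, then xu lies in H + (xs)M, and by
  regularity so does u. As x kills H, the products xu and hence h already lie in (xs)M.\<close>

lemma rseq_Int_zero:
  assumes H: "sub H" and mH: "\<And>a h. a \<in> \<mm> \<Longrightarrow> h \<in> H \<Longrightarrow> a \<bullet> h = \<zero>\<^sub>M"
  shows "rseq H xs \<Longrightarrow> set xs \<subseteq> \<mm> \<Longrightarrow> h \<in> H \<Longrightarrow> h \<in> ext {\<zero>\<^sub>M} (set xs) \<Longrightarrow> h = \<zero>\<^sub>M"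
proof (induction xs rule: rev_induct)
  case Nil
  then show ?case by (simp add: ext_empty sub_zero_module)
next
  case (snoc x xs)
  have c: "set xs \<subseteq> carrier R" "x \<in> carrier R" using snoc.prems m_carr by auto
  let ?E = "ext {\<zero>\<^sub>M} (set xs)"
  have E: "sub ?E" "sub (ext H (set xs))" using c H by (auto intro: ext_sub sub_zero_module)
  have EH: "?E \<subseteq> ext H (set xs)" using c H sub_zero[OF H] by (intro ext_mono) auto
  have r: "rseq H xs" "reg (ext H (set xs)) x" using snoc.prems(1) rseq_append[OF H c(1)] by auto
  have "h \<in> ext ?E {x}" using snoc.prems(4) ext_insert_eq(1)[OF sub_zero_module c(2,1)] by simp
  then obtain u where u: "u \<in> \<M>" "congr ?E h (x \<bullet> u)" using ext_singleE[OF _ E(1) c(2)] by blast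
  have "h \<in> ext H (set xs)" using snoc.prems(3) ext_base[of H "set xs"] by auto
  then have "x \<bullet> u \<in> ext H (set xs)" using congr_mem[OF E(2) congr_mono[OF u(2) EH]] by simp
  then have "u \<in> ext H (set xs)" using r(2) u(1) by (auto simp: reg_def)
  then obtain h' where h': "h' \<in> H" "congr ?E u h'" using ext_eq_add[OF H c(1)] add_mem_iff[OF E(1) H] by auto
  have "congr ?E (x \<bullet> u) (x \<bullet> h')" by (rule congr_smult[OF E(1) c(2) h'(2)])
  moreover have "x \<bullet> h' = \<zero>\<^sub>M" using mH[of x h'] h' snoc.prems(2) by auto
  ultimately have "x \<bullet> u \<in> ?E" using congr_zero_iff[OF E(1)] by simp
  then have "h \<in> ?E" using congr_memI[OF E(1) u(2)] by blast
  then show ?case using snoc.IH[OF r(1)] snoc.prems by auto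
qed

lemma parametric_decomposition_of_rseq:
  assumes H: "sub H" and mH: "\<And>a h. a \<in> \<mm> \<Longrightarrow> h \<in> H \<Longrightarrow> a \<bullet> h = \<zero>\<^sub>M"
    and ys: "rseq H ys" "set ys \<subseteq> \<mm>" "m_primary (ext H (set ys))"
    and xs: "set xs \<subseteq> \<mm>" "m_primary (ext {\<zero>\<^sub>M} (set xs))" "length xs = length ys" "xs \<noteq> []"
  shows "parametric_decomposition R M xs"
proof -
  have c: "set xs \<subseteq> carrier R" using xs m_carr by auto
  have rp: "rseq H (powers xs \<alpha>)" if \<alpha>: "length \<alpha> = length xs" "\<forall>a\<in>set \<alpha>. 1 \<le> a" for \<alpha>
  proof (rule rseq_exchange[OF H refl _ ys(1,2) _ ys(3)])
    have "m_primary (ext {\<zero>\<^sub>M} (set (powers xs \<alpha>)))" by (rule m_primary_pw[OF sub_zero_module c \<alpha>(1) xs(2)])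
    moreover have "ext {\<zero>\<^sub>M} (set (powers xs \<alpha>)) \<subseteq> ext H (set (powers xs \<alpha>))"
      using sub_zero[OF H] powers_carr[OF c] by (intro ext_mono H) auto
    ultimately show "m_primary (ext H (set (powers xs \<alpha>)))" by (rule m_primary_mono)
  qed (use \<alpha> xs powers_length powers_m in auto)
  have "regular_powers H xs" unfolding regular_powers_def using rp by blast
  have "pow_smult xs n = (\<Inter>\<alpha>\<in>Lambda_set (length xs) n. ext {\<zero>\<^sub>M} (set (powers xs \<alpha>)))" if n: "1 \<le> n" for n
  proof
    show "pow_smult xs n \<subseteq> (\<Inter>\<alpha>\<in>Lambda_set (length xs) n. ext {\<zero>\<^sub>M} (set (powers xs \<alpha>)))"
      using pow_smult_le_ext_Lambda[OF c n] by blast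
    show "(\<Inter>\<alpha>\<in>Lambda_set (length xs) n. ext {\<zero>\<^sub>M} (set (powers xs \<alpha>))) \<subseteq> pow_smult xs n"
    proof
      fix v assume v: "v \<in> (\<Inter>\<alpha>\<in>Lambda_set (length xs) n. ext {\<zero>\<^sub>M} (set (powers xs \<alpha>)))"
      \<comment> \<open>Any member of the index set would serve: it keeps v - w inside one
        component, which meets H only in zero.\<close>
      define \<alpha> where "\<alpha> = n # replicate (length xs - 1) 1"
      have \<alpha>: "\<alpha> \<in> Lambda_set (length xs) n" using xs(4) n
        by (cases xs) (auto simp: \<alpha>_def Lambda_set_iff sum_list_replicate)
      have E: "sub (ext {\<zero>\<^sub>M} (set (powers xs \<alpha>)))" using powers_carr[OF c] by (intro ext_sub sub_zero_module)
      have vE: "v \<in> ext {\<zero>\<^sub>M} (set (powers xs \<alpha>))" using v \<alpha> by blast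
      have vC: "v \<in> \<M>" using sub_carr[OF E vE] .
      have "v \<in> H +\<^sub>M pow_smult xs n"
      proof (rule regular_powers_decomposition[OF H xs(1,4) \<open>regular_powers H xs\<close> n vC])
        fix \<beta> assume "\<beta> \<in> Lambda_set (length xs) n"
        moreover have "ext {\<zero>\<^sub>M} (set (powers xs \<beta>)) \<subseteq> ext H (set (powers xs \<beta>))"
          using sub_zero[OF H] powers_carr[OF c] by (intro ext_mono H) auto
        ultimately show "v \<in> ext H (set (powers xs \<beta>))" using v by blast
      qed
      then obtain w where w: "w \<in> pow_smult xs n" "congr H v w" using add_mem_iff[OF H pow_smult_sub[OF c]] by auto
      have "w \<in> ext {\<zero>\<^sub>M} (set (powers xs \<alpha>))" using pow_smult_le_ext_Lambda[OF c n \<alpha>] w by blast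
      then have d: "v \<ominus>\<^sub>M w \<in> ext {\<zero>\<^sub>M} (set (powers xs \<alpha>))" using sub_minus[OF E vE] by blast
      have "v \<ominus>\<^sub>M w = \<zero>\<^sub>M"
        using rp[of \<alpha>] \<alpha> w(2) d powers_m[OF xs(1), of \<alpha>] by (intro rseq_Int_zero[OF H mH, of "powers xs \<alpha>"]) (auto simp: Lambda_set_iff congr_def)
      then have "congr (pow_smult xs n) v w" using w vC sub_zero[OF pow_smult_sub[OF c]] by (auto simp: congr_def)
      then show "v \<in> pow_smult xs n" using congr_memI[OF pow_smult_sub[OF c]] w by blast
    qed
  qed
  then show ?thesis unfolding parametric_decomposition_iff[OF c] by blast
qed

section \<open>The torsion submodule \<open>H\<^sup>0\<^sub>\<mm>(M)\<close>\<close>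

abbreviation Z where "Z \<equiv> {\<zero>\<^sub>M}"

text \<open>H^0_\<mm>(M) with an exponent that may depend on a. This suits arguments that treat the
  parameters separately.\<close>

definition m_torsion where "m_torsion = {w \<in> \<M>. \<forall>a\<in>\<mm>. \<exists>t::nat. a [^] t \<bullet> w = \<zero>\<^sub>M}"

lemma minus_self: "u \<in> \<M> \<Longrightarrow> u \<ominus>\<^sub>M u = \<zero>\<^sub>M"
  by (simp add: a_minus_def M.r_neg)

lemma pow_kill_mono: "a \<in> carrier R \<Longrightarrow> w \<in> \<M> \<Longrightarrow> a [^] (t::nat) \<bullet> w = \<zero>\<^sub>M \<Longrightarrow> t \<le> n \<Longrightarrow> a [^] n \<bullet> w = \<zero>\<^sub>M"
  using colon_pow_mono[OF sub_zero_module, of a t n] by (auto simp: colon_def)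

lemma m_torsion_sub: "sub m_torsion"
proof (rule submoduleI)
  show sm: "b \<bullet> w \<in> m_torsion" if b: "b \<in> carrier R" "w \<in> m_torsion" for b w
  proof -
    have w: "w \<in> \<M>" using b by (auto simp: m_torsion_def)
    have "\<exists>t::nat. a [^] t \<bullet> b \<bullet> w = \<zero>\<^sub>M" if a: "a \<in> \<mm>" for a
    proof -
      obtain t :: nat where t: "a [^] t \<bullet> w = \<zero>\<^sub>M" using a b(2) by (auto simp: m_torsion_def)
      have "a [^] t \<bullet> b \<bullet> w = b \<bullet> a [^] t \<bullet> w" using a b w m_carr by (intro smult_comm) auto
      then show ?thesis using t b by auto
    qed
    then show ?thesis using b w by (auto simp: m_torsion_def)
  qed
  show "\<ominus>\<^bsub>M\<^esub> w \<in> m_torsion" if "w \<in> m_torsion" for w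
    using sm[of "\<ominus> \<one>" w] that by (simp add: smult_l_minus m_torsion_def)
  show "u \<oplus>\<^sub>M v \<in> m_torsion" if uv: "u \<in> m_torsion" "v \<in> m_torsion" for u v
  proof -
    have c: "u \<in> \<M>" "v \<in> \<M>" using uv by (auto simp: m_torsion_def)
    have "\<exists>t::nat. a [^] t \<bullet> (u \<oplus>\<^sub>M v) = \<zero>\<^sub>M" if a: "a \<in> \<mm>" for a
    proof -
      have aR: "a \<in> carrier R" using a m_carr by auto
      obtain s t :: nat where "a [^] s \<bullet> u = \<zero>\<^sub>M" "a [^] t \<bullet> v = \<zero>\<^sub>M" using a uv unfolding m_torsion_def by blast
      then have "a [^] (max s t) \<bullet> u = \<zero>\<^sub>M" "a [^] (max s t) \<bullet> v = \<zero>\<^sub>M"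
        using pow_kill_mono[OF aR c(1), of s "max s t"] pow_kill_mono[OF aR c(2), of t "max s t"] by auto
      then have "a [^] (max s t) \<bullet> (u \<oplus>\<^sub>M v) = \<zero>\<^sub>M" using aR c by (simp add: smult_r_distr)
      then show ?thesis by blast
    qed
    then show ?thesis using c by (auto simp: m_torsion_def)
  qed
qed (auto simp: m_torsion_def)

text \<open>A uniform exponent exists because \<mm> is finitely generated: by pigeonhole, applied to
  R as a module, a high power of \<mm> lies in the ideal of T-th powers of the generators.\<close>

lemma local_cohomology_0_eq: "local_cohomology_0 R \<mm> M = m_torsion"
proof
  have mem: "a [^] n \<in> \<mm> [^]\<^bsub>ideals_set R\<^esub> n" if "a \<in> \<mm>" for a and n :: nat
  proof (induction n)
    case 0
    then show ?case by (simp add: ideals_set_def)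
  next
    case (Suc n)
    then show ?case using ideal_prod.prod[OF Suc that] by (simp add: ideals_set_def)
  qed
  then show "local_cohomology_0 R \<mm> M \<subseteq> m_torsion"
    unfolding local_cohomology_0_def m_torsion_def by blast
  interpret RM: fg_noetherian_module R "ring_module R" by (rule ring_module_fg)
  obtain G where G: "G \<subseteq> carrier R" "finite G" "\<mm> = Idl G" using finetely_gen[OF is_ideal] by auto
  obtain gs where gs: "set gs = G" using finite_list[OF G(2)] by auto
  have gc: "set gs \<subseteq> carrier R" and gm: "set gs \<subseteq> \<mm>" using gs G R.genideal_self by auto
  show "m_torsion \<subseteq> local_cohomology_0 R \<mm> M"
  proof
    fix w assume w: "w \<in> m_torsion"
    then have wc: "w \<in> \<M>" by (auto simp: m_torsion_def)
    have "\<forall>g\<in>set gs. \<exists>t::nat. g [^] t \<bullet> w = \<zero>\<^sub>M" using w gm by (auto simp: m_torsion_def)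
    then obtain f where f: "\<And>g. g \<in> set gs \<Longrightarrow> g [^] (f g :: nat) \<bullet> w = \<zero>\<^sub>M" by metis
    \<comment> \<open>T dominates every \<open>f g\<close>; the successor makes it positive, as
      \<open>pow_smult_le_ext_powers\<close> demands of exponents.\<close>
    define T where "T = Suc (sum_list (map f gs))"
    have T: "g [^] T \<bullet> w = \<zero>\<^sub>M" if "g \<in> set gs" for g
      using pow_kill_mono[OF _ wc f[OF that], of T] that gc member_le_sum_list[of "f g" "map f gs"]
      by (auto simp: T_def simp del: R.nat_pow_Suc)
    define \<alpha> where "\<alpha> = replicate (length gs) T"
    \<comment> \<open>The exponents in \<alpha> sum to \<open>length gs * T\<close>, so any degree
      above that suffices.\<close>
    define n where "n = length gs * T + 1"
    have pwe: "set (RM.powers gs \<alpha>) = (\<lambda>g. g [^] T) ` set gs" unfolding \<alpha>_def by (induction gs) auto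
    have Qle: "RM.pow_smult gs n \<subseteq> RM.ext {\<zero>} (set (RM.powers gs \<alpha>))"
      using RM.pow_smult_le_ext_powers[of gs \<alpha> n] gc by (auto simp: \<alpha>_def n_def T_def sum_list_replicate)
    have id: "ideal {r \<in> carrier R. r \<bullet> w \<in> Z} R" by (rule colon_elem_ideal[OF sub_zero_module wc])
    have extle: "RM.ext {\<zero>} (set (RM.powers gs \<alpha>)) \<subseteq> {r \<in> carrier R. r \<bullet> w \<in> Z}"
    proof (rule RM.ext_least)
      show "RM.sub {r \<in> carrier R. r \<bullet> w \<in> Z}" using id submodule_ring_module_iff by simp
      show "{\<zero>} \<subseteq> {r \<in> carrier R. r \<bullet> w \<in> Z}" using wc by auto
      fix x v assume xv: "x \<in> set (RM.powers gs \<alpha>)" "v \<in> carrier (ring_module R)"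
      then obtain g where g: "g \<in> set gs" "x = g [^] T" using pwe by auto
      then have "x \<in> {r \<in> carrier R. r \<bullet> w \<in> Z}" using T[OF g(1)] gc by auto
      then have "x \<otimes> v \<in> {r \<in> carrier R. r \<bullet> w \<in> Z}" using ideal.I_r_closed[OF id, of x v] xv(2) by simp
      then show "x \<odot>\<^bsub>ring_module R\<^esub> v \<in> {r \<in> carrier R. r \<bullet> w \<in> Z}" by simp
    qed
    have "a \<bullet> w = \<zero>\<^sub>M" if a: "a \<in> \<mm> [^]\<^bsub>ideals_set R\<^esub> n" for a
    proof -
      have "a \<in> carrier R" using ideal.Icarr[OF ideal_pow_carr[OF is_ideal] a] .
      then have "a = a \<odot>\<^bsub>ring_module R\<^esub> \<one>" by simp
      then have "a \<in> ideal_smult R (ring_module R) (\<mm> [^]\<^bsub>ideals_set R\<^esub> n) (carrier (ring_module R))"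
        unfolding ideal_smult_def
        using a by (intro subsetD[OF RM.gen_self] CollectI exI[of _ a] exI[of _ \<one>]) auto
      then have "a \<in> RM.pow_smult gs n" using RM.ideal_smult_pow[OF gc, of n] G(3) gs by simp
      then show ?thesis using Qle extle by auto
    qed
    then show "w \<in> local_cohomology_0 R \<mm> M" using wc unfolding local_cohomology_0_def by blast
  qed
qed

text \<open>H is concentrated at \<mm>: for P strictly below \<mm> and b in \<mm> outside P, a fixed
  power b^c kills H. So b^c Ann(M/H) lies in Ann(M), and P contains Ann(M/H) if it contains Ann(M).
  A chain of length 0 may start at \<mm> itself and is treated separately.\<close>

lemma vdim_m_torsion: "vdim (ann_quot m_torsion) = vdim (ann_quot Z)"
proof (rule antisym)
  have le: "ann_quot Z \<subseteq> ann_quot m_torsion" using sub_zero[OF m_torsion_sub] by (intro ann_quot_mono) auto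
  show "vdim (ann_quot m_torsion) \<le> vdim (ann_quot Z)"
  proof (rule vdim_le)
    show "enat k \<le> vdim (ann_quot Z)" if "prime_chain k P Q" "ann_quot m_torsion \<subseteq> P" for k P Q
      using prime_chain_le_vdim[OF that(1)] that(2) le by blast
  qed
  show "vdim (ann_quot Z) \<le> vdim (ann_quot m_torsion)"
  proof (rule vdim_le)
    fix k P Q assume p: "prime_chain k P Q" "ann_quot Z \<subseteq> P"
    show "enat k \<le> vdim (ann_quot m_torsion)"
    proof (cases k)
      case 0
      then show ?thesis by (simp add: zero_enat_def[symmetric])
    next
      case (Suc j)
      then obtain P' where P': "P \<subset> P'" "prime_chain j P' Q" using p by auto
      have P: "primeideal P R" and "P' \<subseteq> \<mm>" using prime_chain_prime[OF p(1)] prime_chain_prime[OF P'(2)] prime_le_m by blast+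
      then obtain b where b: "b \<in> \<mm>" "b \<notin> P" using P'(1) by blast
      have bR: "b \<in> carrier R" using b m_carr by auto
      obtain c :: nat where c: "\<And>n. n \<ge> c \<Longrightarrow> colon Z (b [^] n) = colon Z (b [^] c)"
        using colon_stable[OF sub_zero_module bR] by blast
      have kill: "b [^] c \<bullet> w = \<zero>\<^sub>M" if w: "w \<in> m_torsion" for w
      proof -
        obtain t :: nat where t: "b [^] t \<bullet> w = \<zero>\<^sub>M" and wc: "w \<in> \<M>" using w b(1) by (auto simp: m_torsion_def)
        have "b [^] (max c t) \<bullet> w = \<zero>\<^sub>M" using pow_kill_mono[OF bR wc t] by simp
        then have "w \<in> colon Z (b [^] (max c t))" using wc by (simp add: colon_def)
        then have "w \<in> colon Z (b [^] c)" using c[of "max c t"] by simp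
        then show ?thesis by (simp add: colon_def)
      qed
      have "ann_quot m_torsion \<subseteq> P"
      proof
        fix a assume a: "a \<in> ann_quot m_torsion"
        then have aR: "a \<in> carrier R" and "\<And>v. v \<in> \<M> \<Longrightarrow> b [^] c \<bullet> a \<bullet> v = \<zero>\<^sub>M" using kill by (auto simp: ann_quot_def)
        then have "b [^] c \<otimes> a \<in> ann_quot Z" using bR by (auto simp: ann_quot_def smult_assoc1)
        then have "b [^] c \<otimes> a \<in> P" using p(2) by auto
        then have "b [^] c \<in> P \<or> a \<in> P" using primeideal.I_prime[OF P _ aR] bR by auto
        then show "a \<in> P" using prime_pow_mem[OF P bR] b(2) by blast
      qed
      then show ?thesis using prime_chain_le_vdim[OF p(1)] by blast
    qed
  qed
qed

text \<open>Krull's intersection theorem is applied to one element at a time, with the powers of the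
  others held fixed.\<close>

lemma multi_krull:
  "sub A \<Longrightarrow> set zs \<subseteq> \<mm> \<Longrightarrow> v \<in> \<M> \<Longrightarrow> (\<And>k::nat. k \<ge> l \<Longrightarrow> v \<in> ext A ((\<lambda>z. z [^] k) ` set zs)) \<Longrightarrow> v \<in> A"
proof (induction zs)
  case Nil
  then show ?case using Nil(4)[of l] by (simp add: ext_empty)
next
  case (Cons z zs)
  have z: "z \<in> \<mm>" "z \<in> carrier R" and c: "set zs \<subseteq> carrier R" using Cons.prems m_carr by auto
  have pc: "(\<lambda>z. z [^] (k::nat)) ` set zs \<subseteq> carrier R" for k using c by auto
  show ?case
  proof (rule Cons.IH[OF Cons.prems(1) _ Cons.prems(3)])
    fix k :: nat assume k: "k \<ge> l"
    let ?A = "ext A ((\<lambda>z. z [^] k) ` set zs)"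
    have A: "sub ?A" by (rule ext_sub[OF Cons.prems(1) pc])
    show "v \<in> ?A"
    proof (rule krull_intersection[OF A z(1) Cons.prems(3)])
      fix j :: nat
      \<comment> \<open>High enough for the power of z and for those of the remaining elements; k >=
        l keeps the hypothesis applicable.\<close>
      let ?n = "max j k"
      have T: "sub (ext ?A {z [^] j})" using z by (intro ext_sub A) auto
      have "ext A ((\<lambda>z. z [^] ?n) ` set (z # zs)) \<subseteq> ext ?A {z [^] j}"
      proof (rule ext_least[OF T])
        show "A \<subseteq> ext ?A {z [^] j}" using ext_base[of A] ext_base[of ?A] by blast
        fix y w assume y: "y \<in> (\<lambda>z. z [^] ?n) ` set (z # zs)" and w: "w \<in> \<M>"
        have pow: "x [^] ?n \<bullet> w = x [^] i \<bullet> x [^] (?n - i) \<bullet> w" if "x \<in> carrier R" "i \<le> ?n" for x and i :: nat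
          using pow_add_smult[OF that(1) w, of i "?n - i"] that by simp
        consider "y = z [^] ?n" | x where "x \<in> set zs" "y = x [^] ?n" using y by auto
        then show "y \<bullet> w \<in> ext ?A {z [^] j}"
        proof cases
          case 1
          then show ?thesis using pow[OF z(2), of j] z w by (auto intro!: ext_prod)
        next
          case 2
          then have "x \<in> carrier R" using c by auto
          then have "y \<bullet> w = x [^] k \<bullet> x [^] (?n - k) \<bullet> w" "x [^] (?n - k) \<bullet> w \<in> \<M>" using pow[of x k] 2 w by auto
          then have "y \<bullet> w \<in> ?A" using ext_prod[of "x [^] k" "(\<lambda>z. z [^] k) ` set zs" "x [^] (?n - k) \<bullet> w" A] 2(1) by simp
          then show ?thesis using ext_base by blast
        qed
      qed
      moreover have "v \<in> ext A ((\<lambda>z. z [^] ?n) ` set (z # zs))" using k by (intro Cons.prems(4)) simp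
      ultimately show "v \<in> ext ?A {z [^] j}" by blast
    qed
  qed (use Cons.prems in auto)
qed

text \<open>Induction on the parameters, modulo B throughout. Modulo x^c M the claim gives a^n w =
  x^c v, and x^t w = 0 forces x^(t+c) v = 0. With c stationary already x^c v = 0, so a^n w =
  0.\<close>

lemma m_primary_torsion:
  assumes "finite X"
  shows "X \<subseteq> carrier R \<Longrightarrow> sub B \<Longrightarrow> m_primary (ext B X) \<Longrightarrow> w \<in> \<M> \<Longrightarrow> (\<forall>x\<in>X. \<exists>t::nat. x [^] t \<bullet> w \<in> B) \<Longrightarrow>
    a \<in> \<mm> \<Longrightarrow> \<exists>n::nat. a [^] n \<bullet> w \<in> B"
  using assms
proof (induction X arbitrary: B rule: finite_induct)
  case empty
  then show ?case by (auto simp: ext_empty m_primary_def)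
next
  case (insert x X)
  note B = insert.prems(2)
  have x: "x \<in> carrier R" and X: "X \<subseteq> carrier R" and aR: "a \<in> carrier R" using insert.prems m_carr by auto
  obtain c :: nat where c: "\<And>n. n \<ge> c \<Longrightarrow> colon B (x [^] n) = colon B (x [^] c)" using colon_stable[OF B x] by blast
  have xc: "x [^] c \<in> carrier R" using x by auto
  have E: "sub (ext B {x [^] c})" "sub (ext B X)" using B xc X by (auto intro!: ext_sub)
  have "m_primary (ext (ext B X) {x})" using insert.prems(3) ext_insert_eq(1)[OF B x X] by simp
  then have "m_primary (ext (ext B X) {x [^] c})" by (rule m_primary_pow[OF E(2) x])
  then have "m_primary (ext (ext B {x [^] c}) X)" using ext_insert_eq[OF B xc X] by simp
  moreover have "\<forall>y\<in>X. \<exists>t::nat. y [^] t \<bullet> w \<in> ext B {x [^] c}" using insert.prems(5) ext_base by blast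
  ultimately obtain n :: nat where n: "a [^] n \<bullet> w \<in> ext B {x [^] c}"
    using insert.IH[OF X E(1) _ insert.prems(4) _ insert.prems(6)] by blast
  then obtain v where v: "v \<in> \<M>" "congr B (a [^] n \<bullet> w) (x [^] c \<bullet> v)" using ext_singleE[OF _ B xc] by blast
  obtain t :: nat where t: "x [^] t \<bullet> w \<in> B" using insert.prems(5) by auto
  have "x [^] t \<bullet> a [^] n \<bullet> w = a [^] n \<bullet> x [^] t \<bullet> w" using x aR insert.prems(4) by (intro smult_comm) auto
  then have "x [^] t \<bullet> a [^] n \<bullet> w \<in> B" using sub_smult[OF B _ t] aR by simp
  then have "x [^] t \<bullet> x [^] c \<bullet> v \<in> B" using congr_mem[OF B congr_smult[OF B _ v(2), of "x [^] t"]] x by simp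
  then have "v \<in> colon B (x [^] (t + c))" using v(1) pow_add_smult[OF x v(1)] by (simp add: colon_def)
  then have "v \<in> colon B (x [^] c)" using c[of "t + c"] by simp
  then have "x [^] c \<bullet> v \<in> B" by (simp add: colon_def)
  then show ?case using congr_memI[OF B v(2)] by blast
qed

definition sop where "sop d xs \<longleftrightarrow> length xs = d \<and> set xs \<subseteq> \<mm> \<and> m_primary (ext Z (set xs))"

lemma sop_cong: "sop d xs \<Longrightarrow> length ys = length xs \<Longrightarrow> set ys = set xs \<Longrightarrow> sop d ys"
  by (simp add: sop_def)

lemma sop_powers: "sop d xs \<Longrightarrow> length \<alpha> = length xs \<Longrightarrow> (\<forall>a\<in>set \<alpha>. 1 \<le> a) \<Longrightarrow> sop d (powers xs \<alpha>)"
  unfolding sop_def using m_primary_pw[OF sub_zero_module, of xs \<alpha>] powers_m[of xs \<alpha>] powers_length[of \<alpha> xs] m_carr by blast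

lemma powers_replicate: "set xs \<subseteq> carrier R \<Longrightarrow> powers xs (replicate (length xs) k) = map (\<lambda>x. x [^] k) xs"
  by (induction xs) auto

lemma powers_append: "length \<alpha> = length xs \<Longrightarrow> powers (xs @ ys) (\<alpha> @ \<beta>) = powers xs \<alpha> @ powers ys \<beta>"
  by (simp add: powers_def)

lemma powers_ones: "set xs \<subseteq> carrier R \<Longrightarrow> powers xs (replicate (length xs) 1) = xs"
  by (induction xs) auto

lemma sop_Cons_pow: assumes "sop d (x # ys)" "1 \<le> k" shows "sop d (x [^] (k::nat) # ys)"
  using sop_powers[OF assms(1), of "k # replicate (length ys) 1"] assms powers_ones[of ys] m_carr
  by (auto simp: sop_def subset_iff)

end

section \<open>Consequences of parametric decomposition\<close>

text \<open>Condition (ii) as a hypothesis, with d left free until it is identified with the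
  dimension.\<close>

locale all_parametric = local_fg_module +
  fixes d :: nat
  assumes param: "sop d xs \<Longrightarrow> parametric_decomposition R M xs"
begin

text \<open>Exactly one exponent is 2. If it is not the first one, the first generator itself occurs
  in the component, which makes membership of its multiples trivial.\<close>

lemma Lambda2_cases:
  assumes "\<alpha> \<in> Lambda_set (Suc (length ys)) (Suc (Suc 0))"
  obtains \<beta> where "\<alpha> = 1 # \<beta>" "length \<beta> = length ys" "\<forall>a\<in>set \<beta>. 1 \<le> a"
  | "\<alpha> = 2 # replicate (length ys) 1"
proof -
  obtain j \<beta> where \<alpha>: "\<alpha> = j # \<beta>" "length \<beta> = length ys" "\<forall>a\<in>set \<beta>. 1 \<le> a" "1 \<le> j" "j + sum_list \<beta> = length ys + 2"
    using assms by (cases \<alpha>) (auto simp: Lambda_set_iff)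
  have aux: "length \<beta> \<le> sum_list \<beta> \<and> (sum_list \<beta> \<le> length \<beta> \<longrightarrow> \<beta> = replicate (length \<beta>) 1)"
    if "\<forall>a\<in>set \<beta>. 1 \<le> a" for \<beta> :: "nat list"
    using that by (induction \<beta>) auto
  show ?thesis
  proof (cases "j = 1")
    case False
    then have "j = 2" "sum_list \<beta> \<le> length \<beta>" using \<alpha> aux[OF \<alpha>(3)] by auto
    then show ?thesis using that(2) \<alpha> aux[OF \<alpha>(3)] by metis
  qed (use \<alpha> that in auto)
qed

lemma mem_pow_smult_2:
  assumes s: "sop d xs" and v: "\<And>\<alpha>. \<alpha> \<in> Lambda_set (length xs) (Suc (Suc 0)) \<Longrightarrow> v \<in> ext Z (set (powers xs \<alpha>))"
  shows "v \<in> pow_smult xs (Suc (Suc 0))"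
proof -
  have c: "set xs \<subseteq> carrier R" using s m_carr by (auto simp: sop_def)
  have "pow_smult xs (Suc (Suc 0)) = (\<Inter>\<alpha>\<in>Lambda_set (length xs) (Suc (Suc 0)). ext Z (set (powers xs \<alpha>)))"
    using param[OF s] unfolding parametric_decomposition_iff[OF c] by auto
  then show ?thesis using v by blast
qed

text \<open>The splitting of the square as x(\<qq>M) + (b, cs)^2 M writes xu as xw + r, and r lies
  in (b^2, cs)M by pigeonhole. So a correction of u inside \<qq>M doubles the exponent of b.\<close>

lemma step_double:
  assumes s: "sop d (x # b # cs)"
  shows "colon (ext Z (set (b # cs))) x \<subseteq> ext Z (set (x # b # cs)) +\<^sub>M colon (ext Z (insert (b [^] (2::nat)) (set cs))) x"
proof
  have c: "x \<in> carrier R" "set (b # cs) \<subseteq> carrier R" "set (x # b # cs) \<subseteq> carrier R" using s m_carr by (auto simp: sop_def)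
  have c2: "insert (b [^] (2::nat)) (set cs) \<subseteq> carrier R" using c by auto
  let ?Y = "ext Z (set (b # cs))" and ?E = "ext Z (set (x # b # cs))" and ?F = "ext Z (insert (b [^] (2::nat)) (set cs))"
  have Y: "sub ?Y" and E: "sub ?E" and F: "sub ?F" using c c2 by (auto intro!: ext_sub sub_zero_module)
  fix u assume "u \<in> colon ?Y x"
  then have u: "u \<in> \<M>" "x \<bullet> u \<in> ?Y" by (auto simp: colon_def)
  have "x \<bullet> u \<in> pow_smult (x # b # cs) (Suc (Suc 0))"
  proof (rule mem_pow_smult_2[OF s])
    fix \<alpha> assume "\<alpha> \<in> Lambda_set (length (x # b # cs)) (Suc (Suc 0))"
    then have "\<alpha> \<in> Lambda_set (Suc (length (b # cs))) (Suc (Suc 0))" by simp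
    then show "x \<bullet> u \<in> ext Z (set (powers (x # b # cs) \<alpha>))"
    proof (cases rule: Lambda2_cases)
      case (1 \<beta>)
      then have "x \<in> set (powers (x # b # cs) \<alpha>)" using c by simp
      then show ?thesis using u by (intro ext_prod)
    next
      case 2
      have "powers (x # b # cs) \<alpha> = x [^] (2::nat) # b # cs" unfolding 2 using powers_ones[OF c(2)] by simp
      then have "?Y \<subseteq> ext Z (set (powers (x # b # cs) \<alpha>))" using c by (intro ext_mono sub_zero_module) auto
      then show ?thesis using u by blast
    qed
  qed
  then obtain w r where w: "w \<in> pow_smult (x # b # cs) (Suc 0)" "r \<in> pow_smult (b # cs) (Suc (Suc 0))" "x \<bullet> u = x \<bullet> w \<oplus>\<^sub>M r"
    unfolding pow_smult.simps(4)[of x "b # cs" "Suc 0"] set_add_def' by blast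
  have wE: "w \<in> ?E"
  proof -
    have "pow_smult (x # b # cs) (Suc 0) \<subseteq> ?E" unfolding pow_smult_Suc[OF c(3)] pow_smult_0
      by (rule mul_gen_least[OF E]) (auto intro: ext_prod)
    then show ?thesis using w by blast
  qed
  have rF: "r \<in> ?F"
  proof -
    have "pow_smult (b # cs) (Suc (Suc 0)) \<subseteq> ext Z (set (powers (b # cs) (2 # replicate (length cs) 1)))"
      using c(2) by (intro pow_smult_le_ext_powers) (auto simp: sum_list_replicate)
    then show ?thesis using w(2) powers_ones[of cs] c(2) by auto
  qed
  have wc: "w \<in> \<M>" "r \<in> \<M>" using sub_carr[OF E wE] sub_carr[OF F rF] by auto
  have "x \<bullet> u \<ominus>\<^sub>M x \<bullet> w = r" unfolding w(3)
    using wc c(1) M.a_comm[of "x \<bullet> w" r] add_minus_cancel_M[of r "x \<bullet> w"] by simp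
  then have "u \<ominus>\<^sub>M w \<in> colon ?F x" using rF u wc c(1) by (simp add: colon_def smult_minus_distr)
  moreover have "congr ?E u (u \<ominus>\<^sub>M w)"
  proof -
    have "u \<ominus>\<^sub>M w \<oplus>\<^sub>M w = u" by (rule minus_add_cancel_M[OF u(1) wc(1)])
    then have "u \<ominus>\<^sub>M (u \<ominus>\<^sub>M w) = w"
      using add_minus_cancel_M[of w "u \<ominus>\<^sub>M w"] M.a_comm[of "u \<ominus>\<^sub>M w" w] u wc by simp
    then show ?thesis using wE u wc by (simp add: congr_def)
  qed
  ultimately show "u \<in> ?E +\<^sub>M colon ?F x" using add_mem_iff[OF E colon_sub[OF F c(1)]] by blast
qed

text \<open>The doubling is repeated with a power of b as parameter. The ideal of that system lies
  in the original one, so all corrections stay in \<qq>M.\<close>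

lemma step_double_iter:
  assumes s: "sop d (x # b # cs)"
  shows "colon (ext Z (set (b # cs))) x \<subseteq> ext Z (set (x # b # cs)) +\<^sub>M colon (ext Z (insert (b [^] ((2::nat) ^ k)) (set cs))) x"
proof (induction k)
  have c: "x \<in> carrier R" "b \<in> carrier R" "set cs \<subseteq> carrier R" "set (x # b # cs) \<subseteq> carrier R" using s m_carr by (auto simp: sop_def)
  let ?E = "ext Z (set (x # b # cs))" and ?F = "\<lambda>k. ext Z (insert (b [^] ((2::nat) ^ k)) (set cs))"
  have E: "sub ?E" and F: "\<And>k. sub (?F k)" using c by (auto intro!: ext_sub sub_zero_module)
  {
    case 0
    show ?case using add_le(2)[OF E colon_sub[OF F c(1)], of 0] c by simp
  next
    case (Suc k)
    have "sop d (b [^] ((2::nat) ^ k) # x # cs)" by (rule sop_Cons_pow, rule sop_cong[OF s]) auto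
    then have s': "sop d (x # b [^] ((2::nat) ^ k) # cs)" by (rule sop_cong) auto
    have pe: "(b [^] ((2::nat) ^ k)) [^] (2::nat) = b [^] ((2::nat) ^ Suc k)" using c by (simp add: R.nat_pow_pow mult.commute)
    let ?E' = "ext Z (set (x # b [^] ((2::nat) ^ k) # cs))"
    have "?E' \<subseteq> ?E"
    proof (rule ext_least[OF E ext_base])
      fix y w assume y: "y \<in> set (x # b [^] ((2::nat) ^ k) # cs)" "w \<in> \<M>"
      have "b [^] ((2::nat) ^ k) = b [^] Suc (2 ^ k - 1)" by simp
      then have "b [^] ((2::nat) ^ k) \<bullet> w = b \<bullet> b [^] ((2::nat) ^ k - 1) \<bullet> w"
        using pow_Suc_smult[OF c(2) y(2), of "2 ^ k - 1"] by metis
      moreover have "b \<bullet> b [^] ((2::nat) ^ k - 1) \<bullet> w \<in> ?E"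
        by (rule ext_prod) (use y(2) c(2) in auto)
      ultimately have "b [^] ((2::nat) ^ k) \<bullet> w \<in> ?E" by metis
      moreover have "y = b [^] ((2::nat) ^ k) \<or> y \<in> set (x # b # cs)" using y(1) by auto
      ultimately show "y \<bullet> w \<in> ?E" using ext_prod[of y "set (x # b # cs)" w Z] y(2) by blast
    qed
    have C: "sub (colon (?F k) x)" "sub (colon (?F (Suc k)) x)" by (rule colon_sub[OF F c(1)])+
    have sm: "sub (?E +\<^sub>M colon (?F (Suc k)) x)" by (rule add_sub[OF E C(2)])
    have "colon (?F k) x \<subseteq> ?E' +\<^sub>M colon (?F (Suc k)) x" using step_double[OF s'] pe by simp
    also have "\<dots> \<subseteq> ?E +\<^sub>M colon (?F (Suc k)) x"
      using \<open>?E' \<subseteq> ?E\<close> add_le[OF E C(2)] by (intro add_least[OF sm]) auto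
    finally have "?E +\<^sub>M colon (?F k) x \<subseteq> ?E +\<^sub>M colon (?F (Suc k)) x"
      using add_le[OF E C(2)] by (intro add_least[OF sm]) auto
    then show ?case using Suc by blast
  }
qed

text \<open>First b is replaced by a high power. The induction hypothesis then removes the other bs
  while this power stays among the as, and Artin-Rees removes the power: (B + b^K M) : x lies in (B
  : x) + b^(K-n) M, whose second part is inside \<qq>M.\<close>

lemma colon_eliminate:
  "sop d (x # as @ bs) \<Longrightarrow> colon (ext Z (set (as @ bs))) x \<subseteq> ext Z (set (x # as @ bs)) +\<^sub>M colon (ext Z (set as)) x"
proof (induction bs arbitrary: as)
  case Nil
  then have c: "set (x # as) \<subseteq> carrier R" "x \<in> carrier R" "set as \<subseteq> carrier R" using m_carr by (auto simp: sop_def)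
  then have "sub (ext Z (set (x # as)))" "sub (ext Z (set as))" by (auto intro!: ext_sub sub_zero_module)
  then show ?case using add_le(2)[OF _ colon_sub[OF _ c(2)]] by simp
next
  case (Cons b bs)
  have c: "x \<in> carrier R" "b \<in> carrier R" "set as \<subseteq> carrier R" "set bs \<subseteq> carrier R"
    "set (x # as @ b # bs) \<subseteq> carrier R" using Cons.prems m_carr by (auto simp: sop_def)
  let ?E = "ext Z (set (x # as @ b # bs))" and ?B = "ext Z (set as)"
  have E: "sub ?E" and B: "sub ?B" using c by (auto intro!: ext_sub sub_zero_module)
  have CB: "sub (colon ?B x)" by (rule colon_sub[OF B c(1)])
  have T: "sub (?E +\<^sub>M colon ?B x)" by (rule add_sub[OF E CB])
  note l = add_le[OF E CB]
  obtain n :: nat where n: "\<And>k. colon (ext ?B {b [^] (n + k)}) x \<subseteq> ext (colon ?B x) {b [^] (k::nat)}"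
    using artin_rees[OF B c(1,2)] by blast
  \<comment> \<open>Doubling only reaches powers of 2; this one exceeds the Artin-Rees constant n,
    so that a positive power of b is left over.\<close>
  let ?K = "(2::nat) ^ Suc n"
  have K: "?K = n + (?K - n)" "1 \<le> ?K - n" using less_exp[of "Suc n"] by auto
  let ?bK = "b [^] ?K"
  have bK: "?bK \<in> carrier R" using c by auto
  have s1: "sop d (x # b # as @ bs)" by (rule sop_cong[OF Cons.prems]) auto
  have "sop d (b # x # as @ bs)" by (rule sop_cong[OF Cons.prems]) auto
  then have "sop d (?bK # x # as @ bs)" by (rule sop_Cons_pow) simp
  then have s2: "sop d (x # (as @ [?bK]) @ bs)" by (rule sop_cong) auto
  have bE: "?bK \<bullet> w \<in> ?E" if "w \<in> \<M>" for w
  proof -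
    have "?bK \<bullet> w = b \<bullet> b [^] (?K - 1) \<bullet> w" using pow_Suc_smult[OF c(2) that, of "?K - 1"] by simp
    then show ?thesis using that c(2) by (auto intro: ext_prod)
  qed
  have "ext Z (set (x # (as @ [?bK]) @ bs)) \<subseteq> ?E"
    using bE by (intro ext_least[OF E ext_base]) (auto intro: ext_prod)
  moreover have "colon (ext Z (set (as @ [?bK]))) x \<subseteq> ?E +\<^sub>M colon ?B x"
  proof -
    have "colon (ext Z (set (as @ [?bK]))) x = colon (ext ?B {b [^] (n + (?K - n))}) x"
      using ext_insert_eq(1)[OF sub_zero_module bK c(3)] K(1) by simp
    also have "\<dots> \<subseteq> ext (colon ?B x) {b [^] (?K - n)}" by (rule n)
    also have "\<dots> \<subseteq> ?E +\<^sub>M colon ?B x"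
    proof (rule ext_least[OF T l(2)])
      fix y w assume y: "y \<in> {b [^] (?K - n)}" "w \<in> \<M>"
      obtain j where j: "?K - n = Suc j" using K(2) by (cases "?K - n") auto
      have "b [^] (?K - n) \<bullet> w = b \<bullet> b [^] j \<bullet> w"
        unfolding j by (rule pow_Suc_smult[OF c(2) y(2)])
      moreover have "b \<bullet> b [^] j \<bullet> w \<in> ?E" using y c(2) by (intro ext_prod) auto
      ultimately show "y \<bullet> w \<in> ?E +\<^sub>M colon ?B x" using l(1) y by auto
    qed
    finally show ?thesis .
  qed
  moreover have s2E: "sub (ext Z (set (x # (as @ [?bK]) @ bs)))" using c bK by (intro ext_sub sub_zero_module) auto
  ultimately have "ext Z (set (x # (as @ [?bK]) @ bs)) +\<^sub>M colon (ext Z (set (as @ [?bK]))) x \<subseteq> ?E +\<^sub>M colon ?B x"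
    using l by (intro add_least[OF T]) auto
  then have "colon (ext Z (set ((as @ [?bK]) @ bs))) x \<subseteq> ?E +\<^sub>M colon ?B x" using Cons.IH[OF s2] by blast
  moreover have "insert ?bK (set (as @ bs)) = set ((as @ [?bK]) @ bs)" by auto
  ultimately have "?E +\<^sub>M colon (ext Z (insert ?bK (set (as @ bs)))) x \<subseteq> ?E +\<^sub>M colon ?B x"
    using l by (intro add_least[OF T]) auto
  moreover have "set (b # as @ bs) = set (as @ b # bs)" "set (x # b # as @ bs) = set (x # as @ b # bs)" by auto
  ultimately show ?case using step_double_iter[OF s1, of "Suc n"] by (simp del: set_append set_simps power_Suc)
qed

text \<open>Elimination of all ys leaves the surplus xM, to be removed by Krull's theorem. If u =
  x^k a modulo A, then x^(k+1) a lies in Y, and elimination for x^(k+1) instead of x writes a,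
  modulo Y, as x^(k+1) f plus an element killed by x^(k+1).\<close>

lemma colon_eq:
  assumes s: "sop d (x # ys)"
  shows "colon (ext Z (set ys)) x \<subseteq> ext Z (set ys) +\<^sub>M colon Z x"
proof
  have c: "x \<in> carrier R" "set ys \<subseteq> carrier R" "x \<in> \<mm>" using s m_carr by (auto simp: sop_def)
  let ?Y = "ext Z (set ys)"
  let ?A = "?Y +\<^sub>M colon Z x"
  have Y: "sub ?Y" and C: "sub (colon Z x)" using c by (auto intro!: ext_sub sub_zero_module colon_sub)
  have A: "sub ?A" by (rule add_sub[OF Y C])
  note l = add_le[OF Y C]
  fix u assume "u \<in> colon ?Y x"
  then have u: "u \<in> \<M>" "x \<bullet> u \<in> ?Y" by (auto simp: colon_def)
  have xA: "x \<bullet> w \<in> ?Y" if wA: "w \<in> ?A" for w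
  proof -
    obtain w' where w': "w' \<in> colon Z x" "congr ?Y w w'" using wA add_mem_iff[OF Y C] by auto
    then have "congr ?Y (x \<bullet> w) \<zero>\<^sub>M" using congr_smult[OF Y c(1) w'(2)] by (simp add: colon_def)
    then show ?thesis using congr_zero_iff[OF Y] by simp
  qed
  show "u \<in> ?A"
  proof (rule krull_intersection[OF A c(3) u(1)])
    fix k :: nat
    show "u \<in> ext ?A {x [^] k}"
    proof (induction k)
      case 0
      then show ?case using ext_prod[of \<one> "{\<one>}" u ?A] u by auto
    next
      case (Suc k)
      have xk: "x [^] k \<in> carrier R" "x [^] Suc k \<in> carrier R" using c by auto
      obtain a where a: "a \<in> \<M>" "congr ?A u (x [^] k \<bullet> a)" using ext_singleE[OF Suc A xk(1)] by blast
      have "x \<bullet> (u \<ominus>\<^sub>M x [^] k \<bullet> a) \<in> ?Y" using a(2) by (intro xA) (auto simp: congr_def)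
      then have "congr ?Y (x \<bullet> u) (x [^] Suc k \<bullet> a)"
        using u(1) a(1) c(1) xk pow_Suc_smult[OF c(1) a(1), of k] by (simp add: congr_def smult_minus_distr del: R.nat_pow_Suc)
      then have "x [^] Suc k \<bullet> a \<in> ?Y" using congr_mem[OF Y] u(2) by blast
      then have "a \<in> colon (ext Z (set ([] @ ys))) (x [^] Suc k)" using a(1) by (simp add: colon_def)
      moreover have "sop d (x [^] Suc k # [] @ ys)" using sop_Cons_pow[OF s, of "Suc k"] by simp
      ultimately have aE: "a \<in> ext Z (set (x [^] Suc k # [] @ ys)) +\<^sub>M colon (ext Z (set [])) (x [^] Suc k)"
        using colon_eliminate by blast
      have e: "ext Z (set (x [^] Suc k # [] @ ys)) = ext ?Y {x [^] Suc k}"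
        using ext_insert_eq(1)[OF sub_zero_module xk(2) c(2)] by simp
      have e': "ext Z (set []) = Z" by (simp add: ext_empty sub_zero_module)
      have EY: "sub (ext ?Y {x [^] Suc k})" "sub (colon Z (x [^] Suc k))"
        using Y xk by (auto intro!: ext_sub colon_sub sub_zero_module simp del: R.nat_pow_Suc)
      obtain a0 where a0: "a0 \<in> \<M>" "x [^] Suc k \<bullet> a0 = \<zero>\<^sub>M" "congr (ext ?Y {x [^] Suc k}) a a0"
        using aE unfolding e e' add_mem_iff[OF EY] by (auto simp: colon_def)
      then have "a \<ominus>\<^sub>M a0 \<in> ext ?Y {x [^] Suc k}" by (simp add: congr_def)
      then obtain f where f: "f \<in> \<M>" "congr ?Y (a \<ominus>\<^sub>M a0) (x [^] Suc k \<bullet> f)" using ext_singleE[OF _ Y xk(2)] by blast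
      \<comment> \<open>a0 is only killed by x^(k+1), but the factor x^k in front moves it into 0 :
        x, which is part of A.\<close>
      have "x [^] k \<bullet> a0 \<in> ?A"
        using l(2) a0 xk pow_Suc_smult[OF c(1) a0(1), of k] by (auto simp: colon_def simp del: R.nat_pow_Suc)
      note [trans] = congr_trans[OF A]
      have "congr ?A u (x [^] k \<bullet> a)" by (rule a(2))
      also have "congr ?A (x [^] k \<bullet> a) (x [^] k \<bullet> (a \<ominus>\<^sub>M a0))"
      proof -
        have "a \<ominus>\<^sub>M (a \<ominus>\<^sub>M a0) = a0"
          using add_minus_cancel_M[of a0 "a \<ominus>\<^sub>M a0"] M.a_comm[of "a \<ominus>\<^sub>M a0" a0] minus_add_cancel_M[of a a0] a a0 by simp
        then have "x [^] k \<bullet> a \<ominus>\<^sub>M x [^] k \<bullet> (a \<ominus>\<^sub>M a0) = x [^] k \<bullet> a0"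
          using smult_minus_distr[OF xk(1) a(1), of "a \<ominus>\<^sub>M a0"] a a0 by simp
        then show ?thesis using \<open>x [^] k \<bullet> a0 \<in> ?A\<close> a a0 xk by (simp add: congr_def)
      qed
      also have "congr ?A (x [^] k \<bullet> (a \<ominus>\<^sub>M a0)) (x [^] k \<bullet> x [^] Suc k \<bullet> f)"
        using congr_mono[OF congr_smult[OF Y xk(1) f(2)] l(1)] .
      finally have "congr ?A u (x [^] k \<bullet> x [^] Suc k \<bullet> f)" .
      moreover have "x [^] k \<bullet> x [^] Suc k \<bullet> f = x [^] Suc k \<bullet> x [^] k \<bullet> f" using xk f by (intro smult_comm) auto
      moreover have "x [^] k \<bullet> f \<in> \<M>" using xk f by auto
      ultimately show ?case using ext_single_iff[OF A xk(2)] by metis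
    qed
  qed
qed

text \<open>The remaining parameters are raised to the power k as well. Reading the ideal with y as
  first generator, the square lies in (y^2, x^k, zs^k)M; since k is arbitrarily large,
  \<open>multi_krull\<close> leaves y^2 M.\<close>

lemma smult_mem_square:
  assumes s: "sop d (x # y # zs)" and w: "w \<in> \<M>" and xl: "x [^] (l::nat) \<bullet> w = \<zero>\<^sub>M"
  shows "y \<bullet> w \<in> ext Z {y [^] (2::nat)}"
proof (rule multi_krull[where zs = "x # zs" and l = "Suc l"])
  have m: "x \<in> \<mm>" "y \<in> \<mm>" "set zs \<subseteq> \<mm>" using s by (auto simp: sop_def)
  have c: "x \<in> carrier R" "y \<in> carrier R" "set zs \<subseteq> carrier R" using m m_carr by auto
  show "sub (ext Z {y [^] (2::nat)})" using c by (intro ext_sub sub_zero_module) auto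
  show "set (x # zs) \<subseteq> \<mm>" using m by auto
  show "y \<bullet> w \<in> \<M>" using c w by auto
  fix k :: nat assume k: "Suc l \<le> k"
  let ?zk = "map (\<lambda>z. z [^] k) zs"
  let ?x' = "x [^] k \<oplus> y"
  have kill: "x [^] k \<bullet> w = \<zero>\<^sub>M" using pow_kill_mono[OF c(1) w xl, of k] k by simp
  have zk: "set ?zk \<subseteq> carrier R" using c by auto
  have xk: "x [^] k \<in> carrier R" "?x' \<in> carrier R" using c by auto
  have "sop d (powers (x # y # zs) (k # 1 # replicate (length zs) k))" using k by (intro sop_powers[OF s]) auto
  then have s1: "sop d (x [^] k # y # ?zk)" using powers_replicate[OF c(3), of k] c by simp
  \<comment> \<open>Equal ideals have equal \<open>pow_smult\<close>: membership is checked for the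
    list beginning with \<open>x [^] k \<oplus> y\<close> and evaluated for the list beginning with
    y.\<close>
  have id: "Idl (set (?x' # y # ?zk)) = Idl (set (y # x [^] k # ?zk))"
  proof
    let ?I = "Idl (set (y # x [^] k # ?zk))" and ?J = "Idl (set (?x' # y # ?zk))"
    have cI: "set (y # x [^] k # ?zk) \<subseteq> carrier R" and cJ: "set (?x' # y # ?zk) \<subseteq> carrier R" using zk xk c by auto
    interpret I: ideal ?I R by (rule R.genideal_ideal[OF cI])
    interpret J: ideal ?J R by (rule R.genideal_ideal[OF cJ])
    have sI: "set (y # x [^] k # ?zk) \<subseteq> ?I" by (rule R.genideal_self[OF cI])
    have sJ: "set (?x' # y # ?zk) \<subseteq> ?J" by (rule R.genideal_self[OF cJ])
    have "?x' \<in> ?I" using sI by (intro I.a_closed) auto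
    then show "?J \<subseteq> ?I" using sI by (intro R.genideal_minimal I.is_ideal) auto
    have p: "?x' \<in> ?J" "y \<in> ?J" using sJ by auto
    have "?x' \<oplus> \<ominus> y \<in> ?J" by (rule J.a_closed[OF p(1) J.a_inv_closed[OF p(2)]])
    moreover have "?x' \<oplus> \<ominus> y = x [^] k" using xk c by (simp add: R.a_assoc R.r_neg)
    ultimately show "?I \<subseteq> ?J" using sJ by (intro R.genideal_minimal J.is_ideal) auto
  qed
  have cI: "set (y # x [^] k # ?zk) \<subseteq> carrier R" and cJ: "set (?x' # y # ?zk) \<subseteq> carrier R" using zk xk c by auto
  have "ext Z (set (?x' # y # ?zk)) = ext Z (set (y # x [^] k # ?zk))"
    using ext_Idl[OF sub_zero_module cI] ext_Idl[OF sub_zero_module cJ] id by simp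
  also have "set (y # x [^] k # ?zk) = set (x [^] k # y # ?zk)" by auto
  finally have "m_primary (ext Z (set (?x' # y # ?zk)))" using s1 by (simp add: sop_def)
  moreover have "?x' \<in> \<mm>" using pow_m[OF m(1), of k] k m(2) by auto
  ultimately have s2: "sop d (?x' # y # ?zk)" using s1 by (simp add: sop_def)
  have yw: "?x' \<bullet> w = y \<bullet> w" using kill w c xk by (simp add: smult_l_distr)
  have "y \<bullet> w \<in> pow_smult (?x' # y # ?zk) (Suc (Suc 0))"
  proof (rule mem_pow_smult_2[OF s2])
    fix \<alpha> assume "\<alpha> \<in> Lambda_set (length (?x' # y # ?zk)) (Suc (Suc 0))"
    then have "\<alpha> \<in> Lambda_set (Suc (length (y # ?zk))) (Suc (Suc 0))" by simp
    then show "y \<bullet> w \<in> ext Z (set (powers (?x' # y # ?zk) \<alpha>))"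
    proof (cases rule: Lambda2_cases)
      case (1 \<beta>)
      then have "?x' \<in> set (powers (?x' # y # ?zk) \<alpha>)" using xk by simp
      then show ?thesis using w yw[symmetric] by (auto intro: ext_prod)
    next
      case 2
      have "y \<in> set (powers (?x' # y # ?zk) \<alpha>)" unfolding 2 using c by simp
      then show ?thesis using w by (intro ext_prod)
    qed
  qed
  then have "y \<bullet> w \<in> pow_smult (y # x [^] k # ?zk) (Suc (Suc 0))" unfolding pow_smult_cong[OF cJ cI id] .
  also have "\<dots> \<subseteq> ext Z (set (powers (y # x [^] k # ?zk) (2 # replicate (length (x [^] k # ?zk)) 1)))"
    by (rule pow_smult_le_ext_powers[OF cI]) (auto simp: sum_list_replicate)
  also have "powers (y # x [^] k # ?zk) (2 # replicate (length (x [^] k # ?zk)) 1) = y [^] (2::nat) # x [^] k # ?zk"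
    using powers_ones[of "x [^] k # ?zk"] cI by simp
  also have "ext Z (set (y [^] (2::nat) # x [^] k # ?zk)) = ext (ext Z {y [^] (2::nat)}) ((\<lambda>z. z [^] k) ` set (x # zs))"
    using ext_insert_eq(2)[OF sub_zero_module, of "y [^] (2::nat)" "set (x [^] k # ?zk)"] cI c by simp
  finally show "y \<bullet> w \<in> ext (ext Z {y [^] (2::nat)}) ((\<lambda>z. z [^] k) ` set (x # zs))" .
qed

lemma smult_eq_square:
  assumes s: "sop d (x # y # zs)" and w: "w \<in> \<M>" and xl: "x [^] (l::nat) \<bullet> w = \<zero>\<^sub>M"
  obtains c where "c \<in> \<M>" "y \<bullet> w = y \<bullet> y \<bullet> c"
proof -
  have y: "y \<in> carrier R" using s m_carr by (auto simp: sop_def)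
  obtain c where c: "c \<in> \<M>" "congr Z (y \<bullet> w) (y [^] (2::nat) \<bullet> c)"
    using ext_singleE[OF smult_mem_square[OF assms] sub_zero_module] y by (metis R.nat_pow_closed)
  have "y \<bullet> w = y [^] (2::nat) \<bullet> c"
    using c(2) minus_add_cancel_M[of "y \<bullet> w" "y [^] (2::nat) \<bullet> c"] y w c(1) by (simp add: congr_def)
  then have "y \<bullet> w = y \<bullet> y \<bullet> c" using y c(1) by (simp add: numeral_2_eq_2 smult_assoc1)
  then show ?thesis using that c(1) by blast
qed

text \<open>With y^k in place of y, the equation y^k w = y^(2k) v shows that y^k kills w - y^k v. So
  w lies in the stationary colon plus y^k M for every k, and Krull's theorem applies.\<close>

lemma pow_torsion_transfer:
  assumes s: "sop d (x # y # zs)" and w: "w \<in> \<M>" and xl: "x [^] (l::nat) \<bullet> w = \<zero>\<^sub>M"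
  shows "\<exists>t::nat. y [^] t \<bullet> w = \<zero>\<^sub>M"
proof -
  have y: "y \<in> carrier R" "y \<in> \<mm>" using s m_carr by (auto simp: sop_def)
  obtain c :: nat where c: "\<And>n. n \<ge> c \<Longrightarrow> colon Z (y [^] n) = colon Z (y [^] c)"
    using colon_stable[OF sub_zero_module y(1)] by blast
  let ?K = "colon Z (y [^] c)"
  have K: "sub ?K" using y by (intro colon_sub sub_zero_module) auto
  have KK: "colon Z (y [^] n) \<subseteq> ?K" for n :: nat
    using c[of n] colon_pow_mono[OF sub_zero_module y(1), of n c] by (cases "c \<le> n") auto
  have "w \<in> ?K"
  proof (rule krull_intersection[OF K y(2) w])
    fix k :: nat
    show "w \<in> ext ?K {y [^] k}"
    proof (cases "k = 0")
      case True
      then show ?thesis using ext_prod[of \<one> "{\<one>}" w ?K] w by auto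
    next
      case False
      have "sop d (y # x # zs)" by (rule sop_cong[OF s]) auto
      then have "sop d (y [^] k # x # zs)" using sop_Cons_pow False by simp
      then have "sop d (x # y [^] k # zs)" by (rule sop_cong) auto
      then obtain v where v: "v \<in> \<M>" "y [^] k \<bullet> w = y [^] k \<bullet> y [^] k \<bullet> v"
        using smult_eq_square[OF _ w xl] by blast
      have yk: "y [^] k \<in> carrier R" using y by auto
      have "y [^] k \<bullet> (w \<ominus>\<^sub>M y [^] k \<bullet> v) = \<zero>\<^sub>M"
        using v w yk by (simp add: smult_minus_distr minus_self)
      then have "w \<ominus>\<^sub>M y [^] k \<bullet> v \<in> colon Z (y [^] k)" using v w yk by (simp add: colon_def)
      then have "w \<ominus>\<^sub>M y [^] k \<bullet> v \<in> ?K" using KK by blast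
      then have "congr ?K w (y [^] k \<bullet> v)" using v w yk by (simp add: congr_def)
      then show ?thesis using v ext_single_iff[OF K yk] by blast
    qed
  qed
  then show ?thesis by (auto simp: colon_def)
qed

lemma sop_two_front: assumes "sop d xs" "x \<in> set xs" "y \<in> set xs" "x \<noteq> y"
  obtains zs where "sop d (x # y # zs)"
proof -
  have y: "y \<in> set (remove1 x xs)" using assms by simp
  then have "set (x # y # remove1 y (remove1 x xs)) = set xs" "length (x # y # remove1 y (remove1 x xs)) = length xs"
    using assms
    by (metis mset_eq_setD perm_remove mset.simps(2))
      (metis assms(2) y length_Cons perm_remove mset.simps(2) size_mset)
  then show ?thesis using that sop_cong[OF assms(1)] by blast
qed

lemma pow_torsion_in_m_torsion:
  assumes s: "sop d xs" and x: "x \<in> set xs" and w: "w \<in> \<M>" and xl: "x [^] (l::nat) \<bullet> w = \<zero>\<^sub>M"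
  shows "w \<in> m_torsion"
proof -
  have c: "set xs \<subseteq> carrier R" using s m_carr by (auto simp: sop_def)
  have "\<exists>t::nat. y [^] t \<bullet> w \<in> Z" if y: "y \<in> set xs" for y
  proof (cases "x = y")
    case True
    then show ?thesis using xl by auto
  next
    case False
    obtain zs where "sop d (x # y # zs)" using sop_two_front[OF s x y False] by blast
    then show ?thesis using pow_torsion_transfer[OF _ w xl] by auto
  qed
  then have "\<exists>n::nat. a [^] n \<bullet> w \<in> Z" if "a \<in> \<mm>" for a
    using s that w c by (intro m_primary_torsion[of "set xs"] sub_zero_module) (auto simp: sop_def)
  then show ?thesis using w by (auto simp: m_torsion_def)
qed

text \<open>The factorization yh = y^2 v is iterated inside the torsion submodule. Thus yh is
  divisible there by every power of y, while one fixed power kills the whole submodule.\<close>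

lemma param_kills_m_torsion:
  assumes s: "sop d (x # y # zs)" and h: "h \<in> m_torsion"
  shows "y \<bullet> h = \<zero>\<^sub>M"
proof -
  have y: "y \<in> carrier R" "y \<in> \<mm>" and x: "x \<in> \<mm>" using s m_carr by (auto simp: sop_def)
  obtain c :: nat where c: "\<And>n. n \<ge> c \<Longrightarrow> colon Z (y [^] n) = colon Z (y [^] c)"
    using colon_stable[OF sub_zero_module y(1)] by blast
  have yt: "w \<in> m_torsion" if "w \<in> \<M>" "y [^] n \<bullet> w = \<zero>\<^sub>M" for w and n :: nat
    using pow_torsion_in_m_torsion[OF s _ that] by simp
  have tK: "y [^] c \<bullet> w = \<zero>\<^sub>M" if w: "w \<in> m_torsion" for w
  proof -
    obtain t :: nat where t: "y [^] t \<bullet> w = \<zero>\<^sub>M" and wc: "w \<in> \<M>" using w y(2) by (auto simp: m_torsion_def)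
    have "y [^] (max c t) \<bullet> w = \<zero>\<^sub>M" using pow_kill_mono[OF y(1) wc t] by simp
    then have "w \<in> colon Z (y [^] (max c t))" using wc by (simp add: colon_def)
    then have "w \<in> colon Z (y [^] c)" using c[of "max c t"] by simp
    then show ?thesis by (simp add: colon_def)
  qed
  have "\<exists>h'\<in>m_torsion. y \<bullet> h = y [^] Suc j \<bullet> h'" for j
  proof (induction j)
    case 0
    then show ?case using h y by (intro bexI[of _ h]) auto
  next
    case (Suc j)
    then obtain h' where h': "h' \<in> m_torsion" "y \<bullet> h = y [^] Suc j \<bullet> h'" by blast
    then obtain l :: nat where l: "x [^] l \<bullet> h' = \<zero>\<^sub>M" and hc: "h' \<in> \<M>" using x by (auto simp: m_torsion_def)
    obtain v where v: "v \<in> \<M>" "y \<bullet> h' = y \<bullet> y \<bullet> v" using smult_eq_square[OF s hc l] by blast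
    \<comment> \<open>This keeps the iteration inside the torsion submodule: h' - yv is killed by y
      and hence torsion, so yv is torsion, y^(c+1) kills v, and v is torsion.\<close>
    have "y \<bullet> (h' \<ominus>\<^sub>M y \<bullet> v) = \<zero>\<^sub>M" using v hc y by (simp add: smult_minus_distr minus_self)
    then have "h' \<ominus>\<^sub>M y \<bullet> v \<in> m_torsion" using yt[of "h' \<ominus>\<^sub>M y \<bullet> v" 1] v hc y by simp
    then have "congr m_torsion h' (y \<bullet> v)" using v hc y by (simp add: congr_def)
    then have "y \<bullet> v \<in> m_torsion" using congr_mem[OF m_torsion_sub] h' by blast
    then have "y [^] c \<bullet> y \<bullet> v = \<zero>\<^sub>M" by (rule tK)
    then have "v \<in> m_torsion" using yt[OF v(1), of "c + 1"] pow_add_smult[OF y(1) v(1), of c 1] y by simp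
    moreover have "y \<bullet> h = y [^] Suc (Suc j) \<bullet> v"
    proof -
      have "y \<bullet> h = y [^] j \<bullet> y \<bullet> h'" using h'(2) pow_add_smult[OF y(1) hc, of j 1] y by simp
      also have "\<dots> = y [^] (j + 2) \<bullet> v"
        unfolding v(2) using pow_add_smult[OF y(1) v(1), of j 2] y v(1) by (simp add: numeral_2_eq_2 smult_assoc1)
      finally show ?thesis by simp
    qed
    ultimately show ?case by blast
  qed
  then obtain h' where h': "h' \<in> m_torsion" "y \<bullet> h = y [^] Suc c \<bullet> h'" by blast
  then have hc: "h' \<in> \<M>" by (auto simp: m_torsion_def)
  then show ?thesis using h' tK[OF h'(1)] pow_Suc_smult[OF y(1) hc, of c] y by (simp del: R.nat_pow_Suc)
qed

text \<open>An arbitrary a in \<mm> need not be a parameter, but x^k + a completes the ys to a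
  system of parameters for some k >= 1. As x and x^k + a kill the torsion, so does a.\<close>

lemma m_kills_m_torsion:
  assumes s: "sop d (x # y # zs)" and h: "h \<in> m_torsion" and a: "a \<in> \<mm>"
  shows "a \<bullet> h = \<zero>\<^sub>M"
proof -
  let ?ys = "y # zs"
  have m: "x \<in> \<mm>" "set ?ys \<subseteq> \<mm>" using s by (auto simp: sop_def)
  have c: "x \<in> carrier R" "a \<in> carrier R" "set ?ys \<subseteq> carrier R" using m a m_carr by auto
  have hc: "h \<in> \<M>" using h by (auto simp: m_torsion_def)
  let ?N = "ext Z (set ?ys)"
  have N: "sub ?N" using c by (intro ext_sub sub_zero_module) auto
  have e: "ext ?N {z} = ext Z (set (z # ?ys))" if "z \<in> carrier R" for z
    using ext_insert_eq(1)[OF sub_zero_module that c(3)] by simp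
  have mp: "m_primary (ext ?N {x})" using s e[OF c(1)] by (simp add: sop_def)
  obtain F where F: "prime_cover (ann_quot ?N) F" using finite_prime_cover[OF ann_quot_ideal[OF N]] by blast
  note D = prime_coverD[OF F]
  have "\<exists>k\<ge>1. \<forall>P\<in>F. P \<noteq> \<mm> \<longrightarrow> x [^] (k::nat) \<oplus> a \<notin> P"
  proof (rule ccontr)
    assume "\<not> ?thesis"
    then have "\<forall>k. \<exists>P\<in>F. P \<noteq> \<mm> \<and> x [^] (Suc k) \<oplus> a \<in> P" by (metis le_add1 plus_1_eq_Suc)
    then obtain f where f: "\<And>k. f k \<in> F" "\<And>k. f k \<noteq> \<mm>" "\<And>k. x [^] (Suc k) \<oplus> a \<in> f k" by metis
    \<comment> \<open>Pigeonhole on the finite cover: two exponents lead to the same prime. It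
      contains the difference x^(i+1) (1 - x^(j-i)), but neither x, which is a parameter, nor the
      second factor, which is a unit.\<close>
    have "\<not> inj f" using finite_subset[of "range f" F] D(1) f(1) finite_imageD[of f UNIV] by auto
    then obtain i j where ij: "i < j" "f i = f j" unfolding inj_def by (metis nat_neq_iff)
    let ?P = "f i"
    have P: "primeideal ?P R" "ann_quot ?N \<subseteq> ?P" using D f(1) by auto
    interpret P: primeideal ?P R by (rule P(1))
    have xP: "x \<notin> ?P" by (rule m_primary_notin_prime[OF N m(1) mp P f(2)])
    let ?u = "x [^] Suc i" and ?v = "x [^] (j - i)"
    have uv: "?u \<in> carrier R" "?v \<in> carrier R" using c by auto
    have je: "x [^] Suc j = ?u \<otimes> ?v" using ij R.nat_pow_mult[OF c(1), of "Suc i" "j - i"] by (simp del: R.nat_pow_Suc)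
    have p: "?u \<oplus> a \<in> ?P" "?u \<otimes> ?v \<oplus> a \<in> ?P" using f(3)[of i] f(3)[of j] ij(2) je by (simp_all del: R.nat_pow_Suc)
    have "(?u \<oplus> a) \<ominus> (?u \<otimes> ?v \<oplus> a) \<in> ?P"
      unfolding R.minus_eq by (rule P.a_closed[OF p(1) P.a_inv_closed[OF p(2)]])
    moreover have "(?u \<oplus> a) \<ominus> (?u \<otimes> ?v \<oplus> a) = ?u \<otimes> (\<one> \<ominus> ?v)" using uv c by algebra
    ultimately have "\<one> \<ominus> ?v \<in> ?P" using P.I_prime[of ?u "\<one> \<ominus> ?v"] uv prime_pow_mem[OF P(1) c(1), of "Suc i"] xP by auto
    then have "\<one> \<ominus> ?v \<in> \<mm>" using prime_le_m[OF P(1)] by blast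
    moreover have "?v \<in> \<mm>" using pow_m[OF m(1)] ij by simp
    ultimately have "(\<one> \<ominus> ?v) \<oplus> ?v \<in> \<mm>" by (rule a_closed)
    then have "\<one> \<in> \<mm>" using uv by (simp add: R.minus_eq R.a_assoc R.l_neg)
    then show False using one_imp_carrier I_notcarr by blast
  qed
  then obtain k :: nat where k: "k \<ge> 1" "\<And>P. P \<in> F \<Longrightarrow> P \<noteq> \<mm> \<Longrightarrow> x [^] k \<oplus> a \<notin> P" by blast
  let ?z = "x [^] k \<oplus> a"
  have z: "?z \<in> \<mm>" using pow_m[OF m(1) k(1)] a by auto
  have "m_primary (ext ?N {?z})" by (rule m_primary_replace[OF N m(1) mp z F k(2)])
  then have "sop d (?z # ?ys)" using s z m e[OF m_carr[OF z]] by (simp add: sop_def)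
  \<comment> \<open>\<open>param_kills_m_torsion\<close> speaks about the second entry of the
    system, hence the reordering here and for x.\<close>
  then have "sop d (y # ?z # zs)" by (rule sop_cong) auto
  then have zh: "?z \<bullet> h = \<zero>\<^sub>M" by (rule param_kills_m_torsion[OF _ h])
  have "sop d (y # x # zs)" by (rule sop_cong[OF s]) auto
  then have "x \<bullet> h = \<zero>\<^sub>M" by (rule param_kills_m_torsion[OF _ h])
  then have "x [^] k \<bullet> h = \<zero>\<^sub>M" using pow_kill_mono[OF c(1) hc, of 1 k] k(1) c by simp
  then show ?thesis using zh hc c by (simp add: smult_l_distr)
qed

text \<open>Let as and bs be the parameters before and after x. If xv = h modulo (as)M with h
  torsion, another factor x kills h, so x^2 v lies in (as)M. Now \<open>colon_eq\<close> for x^2,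
  the as and the k-th powers of the bs puts v into (as, bs^k)M plus torsion, and
  \<open>multi_krull\<close> discards the bs.\<close>

lemma rseq_m_torsion:
  assumes s: "sop d xs" and mH: "\<And>a h. a \<in> \<mm> \<Longrightarrow> h \<in> m_torsion \<Longrightarrow> a \<bullet> h = \<zero>\<^sub>M"
  shows "rseq m_torsion xs"
proof -
  have m: "set xs \<subseteq> \<mm>" using s by (auto simp: sop_def)
  then have c: "set xs \<subseteq> carrier R" using m_carr by auto
  have "reg (ext m_torsion (set (take i xs))) (xs ! i)" if i: "i < length xs" for i
    unfolding reg_def
  proof (intro ballI impI)
    let ?x = "xs ! i" and ?as = "take i xs" and ?bs = "drop (Suc i) xs"
    have xs: "xs = ?as @ ?x # ?bs" by (rule id_take_nth_drop[OF i])
    have x: "?x \<in> set xs" using i by auto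
    have cc: "?x \<in> carrier R" "set ?as \<subseteq> carrier R" "set ?bs \<subseteq> carrier R" "?x \<in> \<mm>" "set ?bs \<subseteq> \<mm>"
      using c m x set_take_subset[of i xs] set_drop_subset[of "Suc i" xs] by auto
    let ?X = "ext Z (set ?as)" and ?T = "ext m_torsion (set ?as)"
    have X: "sub ?X" and T: "sub ?T" using cc by (auto intro: ext_sub sub_zero_module m_torsion_sub)
    fix v assume v: "v \<in> \<M>" "?x \<bullet> v \<in> ?T"
    obtain h where h: "h \<in> m_torsion" "congr ?X (?x \<bullet> v) h"
      using v(2) ext_eq_add[OF m_torsion_sub cc(2)] add_mem_iff[OF X m_torsion_sub] by auto
    have "congr ?X (?x \<bullet> ?x \<bullet> v) \<zero>\<^sub>M" using congr_smult[OF X cc(1) h(2)] mH[OF cc(4) h(1)] by simp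
    then have xx: "?x [^] (2::nat) \<bullet> v \<in> ?X" using congr_zero_iff[OF X] cc v by (simp add: numeral_2_eq_2 smult_assoc1)
    show "v \<in> ?T"
    proof (rule multi_krull[OF T cc(5) v(1), of 1])
      fix k :: nat assume k: "1 \<le> k"
      let ?ys = "?as @ map (\<lambda>z. z [^] k) ?bs"
      have cy: "set ?ys \<subseteq> carrier R" using cc by auto
      have Y: "sub (ext Z (set ?ys))" by (rule ext_sub[OF sub_zero_module cy])
      have "sop d (powers xs (replicate (length ?as) 1 @ 2 # replicate (length ?bs) k))"
        using i k by (intro sop_powers[OF s]) auto
      moreover have "powers xs (replicate (length ?as) 1 @ 2 # replicate (length ?bs) k) = ?as @ ?x [^] (2::nat) # map (\<lambda>z. z [^] k) ?bs"
      proof -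
        have "powers (?as @ ?x # ?bs) (replicate (length ?as) 1 @ 2 # replicate (length ?bs) k)
          = powers ?as (replicate (length ?as) 1) @ powers (?x # ?bs) (2 # replicate (length ?bs) k)"
          by (rule powers_append) simp
        then show ?thesis unfolding xs[symmetric] powers_ones[OF cc(2)] powers_simps powers_replicate[OF cc(3)] .
      qed
      ultimately have "sop d (?as @ ?x [^] (2::nat) # map (\<lambda>z. z [^] k) ?bs)" by simp
      then have s2: "sop d (?x [^] (2::nat) # ?ys)" by (rule sop_cong) auto
      have "?X \<subseteq> ext Z (set ?ys)" using cy by (intro ext_mono sub_zero_module) auto
      then have "v \<in> colon (ext Z (set ?ys)) (?x [^] (2::nat))" using xx v(1) by (auto simp: colon_def)
      then have "v \<in> ext Z (set ?ys) +\<^sub>M colon Z (?x [^] (2::nat))" using colon_eq[OF s2] by blast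
      moreover have "colon Z (?x [^] (2::nat)) \<subseteq> m_torsion"
        using pow_torsion_in_m_torsion[OF s x, of _ 2] unfolding colon_def by blast
      moreover have "sub (colon Z (?x [^] (2::nat)))" using cc by (intro colon_sub sub_zero_module) auto
      ultimately obtain u where u: "u \<in> m_torsion" "congr (ext Z (set ?ys)) v u" using add_mem_iff[OF Y] by blast
      then have "v \<in> ext Z (set ?ys) +\<^sub>M m_torsion" using add_mem_iff[OF Y m_torsion_sub] by blast
      then have "v \<in> ext m_torsion (set ?ys)" using ext_eq_add[OF m_torsion_sub cy] by simp
      then show "v \<in> ext ?T ((\<lambda>z. z [^] k) ` set ?bs)"
        using ext_ext[OF m_torsion_sub cc(2), of "(\<lambda>z. z [^] k) ` set ?bs"] cc(3) by auto
    qed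
  qed
  then show ?thesis using rseq_iff[OF m_torsion_sub c] by blast
qed

end

context local_fg_module
begin

section \<open>The characterization\<close>

lemma ann_quot_ext_le_m:
  assumes "sub N" "ann_quot N \<subseteq> \<mm>"
  shows "set xs \<subseteq> \<mm> \<Longrightarrow> ann_quot (ext N (set xs)) \<subseteq> \<mm>"
proof (induction xs)
  case Nil
  then show ?case using assms by (simp add: ext_empty)
next
  case (Cons x xs)
  have c: "x \<in> carrier R" "set xs \<subseteq> carrier R" using Cons.prems m_carr by auto
  have "ann_quot (ext (ext N (set xs)) {x}) \<subseteq> \<mm>"
    using Cons assms c by (intro ann_quot_ext_le_prime[OF prime_m] ext_sub) auto
  then show ?case using ext_insert_eq(1)[OF assms(1) c] by simp
qed

lemma ann_quot_carrier: "ann_quot \<M> = carrier R"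
  by (auto simp: ann_quot_def)

lemma ann_quot_eq_carrier: assumes "sub N" "ann_quot N = carrier R" shows "N = \<M>"
proof -
  have "\<one> \<in> ann_quot N" using assms by simp
  then have "\<M> \<subseteq> N" by (auto simp: ann_quot_def)
  then show ?thesis using sub_subset[OF assms(1)] by blast
qed

lemma ann_quot_le_m: "sub N \<Longrightarrow> N \<noteq> \<M> \<Longrightarrow> ann_quot N \<subseteq> \<mm>"
  using ann_quot_eq_carrier proper_ideal_le_m[OF ann_quot_ideal] by blast

lemma vdim_carrier: "vdim (carrier R) \<le> 0"
proof (rule vdim_le)
  fix k P Q assume p: "prime_chain k P Q" "carrier R \<subseteq> P"
  then have "primeideal P R" using prime_chain_prime by blast
  then have "P \<subseteq> \<mm>" "\<mm> \<noteq> carrier R" using prime_le_m I_notcarr by auto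
  then show "enat k \<le> 0" using p(2) m_carr by blast
qed

lemma regular_seq_length_le_vdim:
  assumes "sub N" "rseq N ys" "set ys \<subseteq> \<mm>" "ext N (set ys) \<noteq> \<M>"
  shows "enat (length ys) \<le> vdim (ann_quot N)"
proof -
  have E: "sub (ext N (set ys))" using assms m_carr by (intro ext_sub) auto
  obtain P0 where "ann_quot N \<subseteq> P0" "prime_chain (length ys) P0 \<mm>"
    using rseq_prime_chain[OF assms(1,2,3) prime_m ann_quot_le_m[OF E assms(4)]] by blast
  then show ?thesis using prime_chain_le_vdim by blast
qed

text \<open>A nonmaximal prime in the support of the last quotient would end a chain as long as ys,
  by \<open>rseq_prime_chain\<close>, and \<mm> would prolong this chain beyond the
  dimension.\<close>

lemma m_primary_of_maximal_rseq:
  assumes N: "sub N" and ys: "rseq N ys" "set ys \<subseteq> \<mm>" and d: "vdim (ann_quot N) \<le> enat (length ys)"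
  shows "m_primary (ext N (set ys))"
proof -
  have E: "sub (ext N (set ys))" using N ys m_carr by (intro ext_sub) auto
  show ?thesis unfolding m_primary_iff[OF E]
  proof (intro allI impI, rule ccontr)
    fix P assume P: "primeideal P R" "ann_quot (ext N (set ys)) \<subseteq> P" "P \<noteq> \<mm>"
    obtain P0 where P0: "ann_quot N \<subseteq> P0" "prime_chain (length ys) P0 P"
      using rseq_prime_chain[OF N ys P(1,2)] by blast
    have "P \<subset> \<mm>" using prime_le_m[OF P(1)] P by blast
    then have "prime_chain (Suc (length ys)) P0 \<mm>" using prime_chain_snoc[OF P0(2) _ prime_m] by blast
    then have "enat (Suc (length ys)) \<le> vdim (ann_quot N)" using prime_chain_le_vdim P0(1) by blast
    then have "enat (Suc (length ys)) \<le> enat (length ys)" using d by (rule order_trans)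
    then show False by simp
  qed
qed

text \<open>A finite supremum in \<open>enat\<close> is a maximum, except that the empty set has
  supremum 0; positivity of d excludes this case.\<close>

lemma Sup_enat_attained:
  assumes "Sup S = enat d" "0 < d" shows "enat d \<in> S"
proof (rule ccontr)
  assume n: "enat d \<notin> S"
  have "Sup S \<le> enat (d - 1)"
  proof (rule Sup_least)
    fix x assume x: "x \<in> S"
    then have le: "x \<le> enat d" using assms(1) Sup_upper by metis
    then obtain k where k: "x = enat k" using enat_ile by blast
    then have "k \<le> d" "k \<noteq> d" using le n x by auto
    then show "x \<le> enat (d - 1)" using k by simp
  qed
  then show False using assms by simp
qed

lemma ideal_smult_m_iff:
  assumes "sub N"
  shows "ideal_smult R M \<mm> N = {\<zero>\<^sub>M} \<longleftrightarrow> (\<forall>a\<in>\<mm>. \<forall>h\<in>N. a \<bullet> h = \<zero>\<^sub>M)"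
proof -
  have s: "sub (ideal_smult R M \<mm> N)"
    unfolding ideal_smult_def using sub_carr[OF assms] m_carr by (intro gen_sub) auto
  have "ideal_smult R M \<mm> N = {\<zero>\<^sub>M} \<longleftrightarrow> ideal_smult R M \<mm> N \<subseteq> {\<zero>\<^sub>M}" using sub_zero[OF s] by auto
  also have "\<dots> \<longleftrightarrow> (\<forall>a\<in>\<mm>. \<forall>h\<in>N. a \<bullet> h = \<zero>\<^sub>M)"
    unfolding ideal_smult_def gen_le_iff[OF sub_zero_module] by auto
  finally show ?thesis .
qed

lemma depth_quot:
  assumes "sub N"
  shows "depth R \<mm> (mquot N) = Sup {enat (length ys) |ys. set ys \<subseteq> \<mm> \<and> rseq N ys \<and> ext N (set ys) \<noteq> \<M>}"
proof -
  have "set ys \<subseteq> \<mm> \<and> regular_seq R (mquot N) ys \<longleftrightarrow> set ys \<subseteq> \<mm> \<and> rseq N ys \<and> ext N (set ys) \<noteq> \<M>" for ys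
    using regular_seq_quot[OF assms, of ys] m_carr by auto
  then show ?thesis unfolding depth_def by simp
qed

theorem cohen_macaulay_m_torsion_iff:
  assumes dim: "module_dim R M \<ge> 2"
  shows "(cohen_macaulay R \<mm> (mquot m_torsion) \<and> ideal_smult R M \<mm> m_torsion = {\<zero>\<^sub>M}) \<longleftrightarrow>
    (\<forall>xs. system_of_parameters R \<mm> M xs \<longrightarrow> parametric_decomposition R M xs)"
proof -
  obtain d where d: "vdim (ann_quot Z) = enat d" using vdim_finite by blast
  have d2: "2 \<le> d" using dim unfolding module_dim_eq d by (simp add: numeral_eq_enat)
  have sop: "system_of_parameters R \<mm> M xs \<longleftrightarrow> sop d xs" for xs
    unfolding system_of_parameters_iff d sop_def by auto
  have dH: "vdim (ann_quot m_torsion) = enat d" using vdim_m_torsion d by simp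
  \<comment> \<open>The zero module has dimension 0 by convention, whereas M/H inherits the
    dimension of M; so the first alternative in \<open>cohen_macaulay\<close> cannot occur.\<close>
  have H: "m_torsion \<noteq> \<M>"
  proof
    assume "m_torsion = \<M>"
    then have "enat d \<le> 0" using dH vdim_carrier ann_quot_carrier by simp
    then show False using d2 by (simp add: zero_enat_def)
  qed
  have cm: "cohen_macaulay R \<mm> (mquot m_torsion) \<longleftrightarrow> depth R \<mm> (mquot m_torsion) = enat d"
  proof -
    have "carrier (mquot m_torsion) \<noteq> {\<zero>\<^bsub>mquot m_torsion\<^esub>}"
    proof
      assume "carrier (mquot m_torsion) = {\<zero>\<^bsub>mquot m_torsion\<^esub>}"
      then have "mcoset m_torsion v = m_torsion" if "v \<in> \<M>" for v using that unfolding mquot_carrier mquot_zero by auto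
      then have "\<M> \<subseteq> m_torsion" using mcoset_zero_iff[OF m_torsion_sub] by auto
      then show False using H sub_subset[OF m_torsion_sub] by blast
    qed
    then show ?thesis unfolding cohen_macaulay_def module_dim_quot[OF m_torsion_sub] dH by simp
  qed
  show ?thesis unfolding sop cm ideal_smult_m_iff[OF m_torsion_sub]
  proof (intro iffI allI impI)
    fix xs assume h: "depth R \<mm> (mquot m_torsion) = enat d \<and> (\<forall>a\<in>\<mm>. \<forall>h\<in>m_torsion. a \<bullet> h = \<zero>\<^sub>M)" and xs: "sop d xs"
    \<comment> \<open>The supremum defining the depth is attained, which provides an actual regular
      sequence on M/H of length d.\<close>
    then have "enat d \<in> {enat (length ys) |ys. set ys \<subseteq> \<mm> \<and> rseq m_torsion ys \<and> ext m_torsion (set ys) \<noteq> \<M>}"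
      unfolding depth_quot[OF m_torsion_sub] using d2 by (intro Sup_enat_attained) auto
    then obtain ys where ys: "length ys = d" "set ys \<subseteq> \<mm>" "rseq m_torsion ys" by auto
    have "m_primary (ext m_torsion (set ys))" by (rule m_primary_of_maximal_rseq[OF m_torsion_sub ys(3,2)]) (simp add: ys dH)
    then show "parametric_decomposition R M xs"
      using h xs ys d2 by (intro parametric_decomposition_of_rseq[OF m_torsion_sub _ ys(3,2)]) (auto simp: sop_def)
  next
    assume h: "\<forall>xs. sop d xs \<longrightarrow> parametric_decomposition R M xs"
    interpret all_parametric R M \<mm> d by unfold_locales (use h in blast)
    have "k \<le> d" if "prime_chain k P Q" "ann_quot Z \<subseteq> P" for k P Q using prime_chain_le_vdim[OF that] d by simp
    then obtain xs where xs: "sop d xs" using exists_parameters[OF sub_zero_module, of d] unfolding sop_def by metis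
    \<comment> \<open>The arguments about the torsion submodule compare two parameters; this is
      where d >= 2 enters.\<close>
    then obtain x y zs where e: "xs = x # y # zs" using d2 unfolding sop_def
      by (cases xs; cases "tl xs") auto
    have mH: "a \<bullet> h = \<zero>\<^sub>M" if "a \<in> \<mm>" "h \<in> m_torsion" for a h
      using m_kills_m_torsion[OF _ that(2,1)] xs e by blast
    have r: "rseq m_torsion xs" by (rule rseq_m_torsion[OF xs mH])
    have m: "set xs \<subseteq> \<mm>" and len: "length xs = d" using xs by (auto simp: sop_def)
    have "\<not> carrier R \<subseteq> \<mm>" using I_notcarr m_carr by blast
    \<comment> \<open>Nakayama's lemma: \<mm> stays in the support of M/H when elements of \<mm> are
      divided out.\<close>
    then have "ext m_torsion (set xs) \<noteq> \<M>"
      using ann_quot_ext_le_m[OF m_torsion_sub ann_quot_le_m[OF m_torsion_sub H] m] ann_quot_carrier by metis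
    then have "enat d \<le> depth R \<mm> (mquot m_torsion)"
      unfolding depth_quot[OF m_torsion_sub] using r m len by (intro Sup_upper) blast
    moreover have "depth R \<mm> (mquot m_torsion) \<le> enat d"
      unfolding depth_quot[OF m_torsion_sub]
    proof (rule Sup_least)
      fix k assume "k \<in> {enat (length ys) |ys. set ys \<subseteq> \<mm> \<and> rseq m_torsion ys \<and> ext m_torsion (set ys) \<noteq> \<M>}"
      then obtain ys where "k = enat (length ys)" "set ys \<subseteq> \<mm>" "rseq m_torsion ys" "ext m_torsion (set ys) \<noteq> \<M>" by blast
      then show "k \<le> enat d" using regular_seq_length_le_vdim[OF m_torsion_sub, of ys] dH by simp
    qed
    ultimately show "depth R \<mm> (mquot m_torsion) = enat d \<and> (\<forall>a\<in>\<mm>. \<forall>h\<in>m_torsion. a \<bullet> h = \<zero>\<^sub>M)" using mH by auto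
  qed
qed

end

theorem corollary1p2:
  fixes R :: "('a, 'r) ring_scheme" and M :: "('a, 'b, 'm) module_scheme" and \<mm> :: "'a set"
  assumes "local_ring \<mm> R" and "noetherian_ring R"
    and "module R M" and "fin_gen_module R M"
    and "module_dim R M \<ge> 2"
  shows "(cohen_macaulay R \<mm> (quot_module M (local_cohomology_0 R \<mm> M)) \<and>
      ideal_smult R M \<mm> (local_cohomology_0 R \<mm> M) = {\<zero>\<^bsub>M\<^esub>}) \<longleftrightarrow>
    (\<forall>xs. system_of_parameters R \<mm> M xs \<longrightarrow> parametric_decomposition R M xs)"
proof -
  interpret local_fg_module R M \<mm>
    using assms by (intro local_fg_module.intro fg_noetherian_module.intro fg_noetherian_module_axioms.intro)
  show ?thesis unfolding local_cohomology_0_eq by (rule cohen_macaulay_m_torsion_iff[OF assms(5)])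
qed

end
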